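(* Let $\chi$ be a non-principal Dirichlet character modulo a fixed polynomial $d\in\mathbb{F}_q[t]$ with $\chi^2\neq\chi_0$, and let $\epsilon>0$. Then $$\widetilde{\pi_k}(n,\chi)= \sum_{\gamma_j\neq 0, \pi}m_j^k e^{i n \gamma_j} + m_{+}^k +(-1)^n m_{-}^k + O\left( \frac{k}{\log n}\left(\sum_{\gamma_j \neq 0, \pi}m_j^k + m_{+}^k + m_{-}^k \right) \right)$$ uniformly for integers $n,k$ with $1\leq k \leq q^{1/2-\epsilon} \log n$. The implied constant may depend on $\epsilon$, $\chi$ and $q$, but not on $n$ or $k$.
   Context: $\mathbb{F}_q$ is a finite field, $\mathcal{M}\subset\mathbb{F}_q[t]$ is the set of monic polynomials and $\mathcal{M}_n$ the set of monic polynomials of degree $n$. $\Omega(f)$ is the number of monic irreducible factors of $f$ counted with multiplicity. A Dirichlet character modulo $d$ is regarded as a completely multiplicative function $\mathbb{F}_q[t]\to\mathbb{C}$ vanishing on polynomials not coprime to $d$; $\chi_0$ is the principal character modulo $d$. Define $\pi_{k}(n,\chi)=\sum_{f \in \mathcal{M}_n,\ \Omega(f)=k}\chi(f)$ and $$\widetilde{\pi_{k}}(n,\chi):=\pi_{k}(n,\chi)\frac{n\,(k-1)!\,(-1)^k}{q^{n/2}(\log n)^{k-1}}.$$ The $L$-function $L(u,\chi)=\sum_{f \in \mathcal{M}}\chi(f)u^{\deg f}$ is a polynomial in $u$ for non-principal $\chi$, and (by the known Riemann hypothesis for such $L$-functions) it factors as $$L(u,\chi)=(1-\sqrt{q}u)^{m_{+}}(1+\sqrt{q}u)^{m_{-}}\prod_{j=1}^{d_\chi}(1-\alpha_j(\chi)u)^{m_j}\prod_{j'=1}^{d'_\chi}(1-\beta_{j'}(\chi)u),$$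 where $m_\pm\ge 0$, $m_j\geq 1$ are integers, $|\beta_{j'}(\chi)|=1$, and the $\alpha_j(\chi)=\sqrt{q}e^{i\gamma_j}$ are distinct and non-real (so $\gamma_j\not\equiv 0,\pi$ modulo $2\pi$). The sum over $\gamma_j\neq 0,\pi$ is the sum over $j=1,\dots,d_\chi$.
   Formalization: The formal theorem additionally assumes that L(u,χ) has a zero with |u|=q^{-1/2} (m_+>0, m_->0 or some γ_j); otherwise the error term is O(0) and the claim is false, e.g. q=7, d=t, χ from a cubic character, where L=1 but π_1(3,χ)=-2. *)

theory Defs
  imports
    "HOL-Library.Cardinality"
    "HOL-Computational_Algebra.Computational_Algebra"
begin

text \<open>
  The finite field is a type \<open>'a :: {field, finite}\<close>, so $q$ is \<open>CARD('a)\<close>.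
\<close>

definition monic_polys :: "nat \<Rightarrow> 'a::field poly set"  where
  "monic_polys n = {f. lead_coeff f = 1 \<and> degree f = n}"

text \<open>
  The constant \<open>multiplicity\<close> of \<open>HOL-Computational_Algebra.Factorial_Ring\<close> is not available for
  coefficients of class \<open>field\<close>; \<open>poly_multiplicity\<close> is the same maximum.  For
  \<open>f \<noteq> 0\<close> and irreducible \<open>p\<close> the maximum is over a finite set.
\<close>

definition poly_multiplicity :: "'a::field poly \<Rightarrow> 'a poly \<Rightarrow> nat"  where
  "poly_multiplicity p f = Max {e. p ^ e dvd f}"

definition big_omega :: "'a::field poly \<Rightarrow> nat"  where
  "big_omega f =
     (\<Sum>p | lead_coeff p = 1 \<and> irreducible p \<and> p dvd f. poly_multiplicity p f)"

text \<open>
  The value \<open>chi 1 = 1\<close> follows from multiplicativity and \<open>chi 1 \<noteq> 0\<close>.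
\<close>

definition dirichlet_character :: "'a::field poly \<Rightarrow> ('a poly \<Rightarrow> complex) \<Rightarrow> bool"  where
  "dirichlet_character d chi \<longleftrightarrow>
     d \<noteq> 0 \<and>
     (\<forall>f g. chi (f * g) = chi f * chi g) \<and>
     (\<forall>f g. f mod d = g mod d \<longrightarrow> chi f = chi g) \<and>
     (\<forall>f. chi f \<noteq> 0 \<longleftrightarrow> coprime f d)"

definition principal_character :: "'a::field poly \<Rightarrow> 'a poly \<Rightarrow> complex"  where
  "principal_character d f = (if coprime f d then 1 else 0)"

definition prime_count :: "nat \<Rightarrow> nat \<Rightarrow> ('a::{field,finite} poly \<Rightarrow> complex) \<Rightarrow> complex"  where
  "prime_count k n chi = (\<Sum>f | f \<in> monic_polys n \<and> big_omega f = k. chi f)"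

definition prime_count_normalized ::
  "nat \<Rightarrow> nat \<Rightarrow> ('a::{field,finite} poly \<Rightarrow> complex) \<Rightarrow> complex"  where
  "prime_count_normalized k n chi =
     prime_count k n chi *
       of_real (real n * fact (k - 1) * (-1) ^ k /
                (real CARD('a) powr (real n / 2) * ln (real n) ^ (k - 1)))"

text \<open>
  The $L$-function as a formal power series in $u$: the terms \<open>chi f * u ^ degree f\<close>
  are collected by degree, so equations between $L$ and a polynomial are meaningful for
  all $u$, not only inside the disc of absolute convergence $|u| < 1/q$.
\<close>

definition L_series :: "('a::{field,finite} poly \<Rightarrow> complex) \<Rightarrow> complex fps"  where
  "L_series chi = Abs_fps (\<lambda>n. \<Sum>f\<in>monic_polys n. chi f)"

end

theory Submission
  imports Defs "HOL-Complex_Analysis.Complex_Analysis" "HOL-Real_Asymp.Real_Asymp"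
begin

text \<open>
  For fixed \<open>z\<close>, \<open>f \<mapsto> chi f * z ^ big_omega f\<close> is completely multiplicative, so its generating
  series is the exponential of \<open>z log L(u, chi)\<close> plus terms coming from proper prime powers.  For
  \<open>\<bar>z\<bar> \<le> q powr (1/2 - \<delta>)\<close> these extra terms have radius of convergence larger than \<open>q powr (-1/2)\<close>:
  cubes and higher powers by a trivial estimate, squares because \<open>L(u, chi\<^sup>2)\<close> has no zero with
  \<open>\<bar>u\<bar> \<le> 1/q\<close>.  After the substitution \<open>x = u sqrt q\<close> the series is thus a product of factors
  \<open>(1 - e x) powr (\<mu> e * z)\<close> over the unimodular \<open>e\<close> with multiplicities \<open>\<mu> e\<close>, and of a series with
  geometrically decaying coefficients.  Its \<open>n\<close>-th coefficient is, uniformly in \<open>z\<close>, a sum over \<open>e\<close> of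
  \<open>e ^ n * n powr (- \<mu> e * z - 1)\<close> times a holomorphic function of \<open>z\<close>, up to an error that is
  smaller by a factor \<open>n\<close>; the coefficient of \<open>z ^ k\<close> is then read off by Cauchy's inequality.
\<close>

section \<open>Multiplicities and the prime power recurrence\<close>

text \<open>The size of z is limited by the primes of degree 1: a factor 1 / (1 - chi p * z * u)
  with chi p nonzero has its pole at modulus 1 / |z|, and this must stay outside the circle of
  radius 1 / sqrt q that carries the zeros. Coefficient k is governed by |z| of size about k / ln n,
  whence the range of k. The assumed factorization concerns chi alone, so the information on chi^2
  has to be proved. Excluding reciprocal roots of modulus q is enough, because squares enter through
  u^2, which turns a bound \<open>\<sigma>\<close> < q into sqrt \<open>\<sigma>\<close> < sqrt q.
  All singularities lie on one circle and their exponents vary with z, so the obstacle is uniformity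
  in z. The series in u are therefore treated through the recurrence n a(n) = sum of l(j) a(n - j)
  attached to their logarithmic derivative, where bounds pass from l to a by induction with
  constants independent of z; holomorphy is used in z only.\<close>

definition monic_irreducibles :: "nat \<Rightarrow> 'a::field poly set" where
  "monic_irreducibles m = {p \<in> monic_polys m. irreducible p}"

lemma irreducible_degree_pos:
  fixes p :: "'a::field poly"
  assumes "irreducible p"
  shows "degree p > 0"
proof (rule ccontr)
  assume "\<not> degree p > 0"
  moreover have "p \<noteq> 0" using assms by auto
  ultimately have "is_unit p" by (simp add: is_unit_iff_degree)
  with assms show False by (simp add: irreducible_not_unit)
qed

lemma poly_multiplicity_eqI:
  fixes p :: "'a::field poly"
  assumes p: "irreducible p" and g: "\<not> p dvd g"
  shows "poly_multiplicity p (p ^ a * g) = a"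
proof -
  have p0: "p \<noteq> 0" using p by auto
  have "{e. p ^ e dvd p ^ a * g} = {..a}"
  proof (intro set_eqI iffI; clarsimp)
    fix e assume e: "p ^ e dvd p ^ a * g"
    show "e \<le> a"
    proof (rule ccontr)
      assume "\<not> e \<le> a"
      then obtain b where b: "e = a + Suc b" by (metis less_imp_Suc_add not_le add_Suc_right)
      from e have "p ^ Suc b dvd g" by (simp add: b power_add p0)
      then have "p dvd g" by (simp add: dvd_mult_left)
      with g show False by contradiction
    qed
  next
    fix e assume "e \<le> a"
    then show "p ^ e dvd p ^ a * g" by (simp add: le_imp_power_dvd)
  qed
  then show ?thesis by (auto simp: poly_multiplicity_def intro: Max_eqI)
qed

lemma poly_multiplicity_decompose:
  fixes p f :: "'a::field poly"
  assumes p: "irreducible p" and f: "f \<noteq> 0"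
  obtains g where "f = p ^ poly_multiplicity p f * g" "\<not> p dvd g"
proof -
  have "\<exists>a g. f = p ^ a * g \<and> \<not> p dvd g" using f
  proof (induction "degree f" arbitrary: f rule: less_induct)
    case less
    show ?case
    proof (cases "p dvd f")
      case False
      then show ?thesis by (intro exI[of _ 0] exI[of _ f]) simp
    next
      case True
      then obtain h where h: "f = p * h" by auto
      with less.prems have "h \<noteq> 0" by auto
      moreover have "degree f = degree p + degree h"
        using h less.prems by (simp add: degree_mult_eq)
      then have "degree h < degree f" using irreducible_degree_pos[OF p] by simp
      ultimately obtain a g where "h = p ^ a * g" "\<not> p dvd g" using less.hyps by blast
      with h show ?thesis by (intro exI[of _ "Suc a"] exI[of _ g]) (simp add: mult.assoc)
    qed
  qed
  then obtain a g where ag: "f = p ^ a * g" "\<not> p dvd g" by blast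
  have "poly_multiplicity p f = a" using poly_multiplicity_eqI[OF p ag(2)] ag(1) by simp
  with ag that[of g] show ?thesis by simp
qed

lemma power_dvd_iff_le_poly_multiplicity:
  fixes p f :: "'a::field poly"
  assumes p: "irreducible p" and f: "f \<noteq> 0"
  shows "p ^ e dvd f \<longleftrightarrow> e \<le> poly_multiplicity p f"
proof -
  obtain g where g: "f = p ^ poly_multiplicity p f * g" "\<not> p dvd g"
    using poly_multiplicity_decompose[OF p f] .
  have p0: "p \<noteq> 0" using p by auto
  show ?thesis
  proof
    assume "e \<le> poly_multiplicity p f"
    then show "p ^ e dvd f" by (subst g(1)) (simp add: le_imp_power_dvd)
  next
    assume e: "p ^ e dvd f"
    show "e \<le> poly_multiplicity p f"
    proof (rule ccontr)
      assume "\<not> ?thesis"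
      then obtain b where b: "e = poly_multiplicity p f + Suc b"
        by (metis less_imp_Suc_add not_le add_Suc_right)
      from e have "p ^ poly_multiplicity p f * p ^ Suc b dvd p ^ poly_multiplicity p f * g"
        unfolding b power_add using g(1) by simp
      then have "p ^ Suc b dvd g" by (simp add: p0)
      then have "p dvd g" by (simp add: dvd_mult_left)
      with g show False by simp
    qed
  qed
qed

lemma poly_multiplicity_mult:
  fixes p f g :: "'a::field poly"
  assumes p: "irreducible p" and f: "f \<noteq> 0" and g: "g \<noteq> 0"
  shows "poly_multiplicity p (f * g) = poly_multiplicity p f + poly_multiplicity p g"
proof -
  obtain f' where f': "f = p ^ poly_multiplicity p f * f'" "\<not> p dvd f'"
    using poly_multiplicity_decompose[OF p f] .
  obtain g' where g': "g = p ^ poly_multiplicity p g * g'" "\<not> p dvd g'"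
    using poly_multiplicity_decompose[OF p g] .
  have "\<not> p dvd f' * g'"
    using f' g' field_poly_irreducible_imp_prime[OF p] by (simp add: prime_elem_dvd_mult_iff)
  from poly_multiplicity_eqI[OF p this, of "poly_multiplicity p f + poly_multiplicity p g"]
  show ?thesis using f' g' by (metis (no_types, lifting) mult.assoc mult.left_commute power_add)
qed

lemma poly_multiplicity_eq_0:
  fixes p f :: "'a::field poly"
  assumes p: "irreducible p" and f: "f \<noteq> 0" and "\<not> p dvd f"
  shows "poly_multiplicity p f = 0"
  using poly_multiplicity_eqI[OF p assms(3), of 0] by simp

section \<open>Finiteness and counting of monic polynomials\<close>

lemma finite_degree_le: "finite {f :: 'a::{field,finite} poly. degree f \<le> n}"
proof (rule finite_subset)
  show "{f :: 'a poly. degree f \<le> n} \<subseteq> Poly ` {xs. set xs \<subseteq> UNIV \<and> length xs = Suc n}"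
  proof
    fix f :: "'a poly" assume "f \<in> {f. degree f \<le> n}"
    then have "f = Poly (map (coeff f) [0..<Suc n])"
      by (auto simp: poly_eq_iff coeff_Poly_eq nth_default_def coeff_eq_0 simp del: upt_Suc)
    then show "f \<in> Poly ` {xs. set xs \<subseteq> UNIV \<and> length xs = Suc n}"
      by (intro image_eqI[of _ _ "map (coeff f) [0..<Suc n]"]) auto
  qed
  show "finite (Poly ` {xs :: 'a list. set xs \<subseteq> UNIV \<and> length xs = Suc n})"
    by (intro finite_imageI finite_lists_length_eq) simp
qed

lemma finite_monic_polys [simp]: "finite (monic_polys n :: 'a::{field,finite} poly set)"
  by (rule finite_subset[OF _ finite_degree_le[of n]]) (auto simp: monic_polys_def)

lemma finite_monic_irreducibles [simp]:
  "finite (monic_irreducibles n :: 'a::{field,finite} poly set)"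
  by (simp add: monic_irreducibles_def)

lemma finite_divisors_poly:
  fixes f :: "'a::{field,finite} poly"
  assumes "f \<noteq> 0"
  shows "finite {p. p dvd f}"
  by (rule finite_subset[OF _ finite_degree_le[of "degree f"]]) (use assms in \<open>auto intro: dvd_imp_degree_le\<close>)

lemma monic_polys_nonzero: "f \<in> monic_polys n \<Longrightarrow> f \<noteq> 0"
  by (auto simp: monic_polys_def)

lemma monic_polys_0: "monic_polys 0 = {1 :: 'a::field poly}"
  by (auto simp: monic_polys_def elim!: degree_eq_zeroE)

lemma monic_polys_Suc:
  "monic_polys (Suc n) = (\<lambda>(a, f). pCons a f) ` (UNIV \<times> monic_polys n :: ('a::field \<times> 'a poly) set)"
proof (intro equalityI subsetI)
  fix f :: "'a poly" assume f: "f \<in> monic_polys (Suc n)"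
  obtain a g where g: "f = pCons a g" by (cases f)
  from f g have "g \<noteq> 0" by (auto simp: monic_polys_def)
  with f g have "g \<in> monic_polys n" by (auto simp: monic_polys_def)
  with g show "f \<in> (\<lambda>(a, f). pCons a f) ` (UNIV \<times> monic_polys n)" by auto
next
  fix f :: "'a poly" assume "f \<in> (\<lambda>(a, f). pCons a f) ` (UNIV \<times> monic_polys n)"
  then obtain a g where "f = pCons a g" "g \<in> monic_polys n" by auto
  moreover from this have "g \<noteq> 0" by (auto simp: monic_polys_def)
  ultimately show "f \<in> monic_polys (Suc n)" by (auto simp: monic_polys_def)
qed

lemma card_monic_polys: "card (monic_polys n :: 'a::{field,finite} poly set) = CARD('a) ^ n"
proof (induction n)
  case 0
  then show ?case by (simp add: monic_polys_0)
next
  case (Suc n)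
  have "inj_on (\<lambda>(a, f). pCons a f) (UNIV \<times> monic_polys n :: ('a \<times> 'a poly) set)"
    by (auto simp: inj_on_def)
  then show ?case by (simp add: monic_polys_Suc card_image card_cartesian_product Suc)
qed

lemma monic_polys_mult:
  "f \<in> monic_polys a \<Longrightarrow> g \<in> monic_polys b \<Longrightarrow> f * g \<in> monic_polys (a + b)"
  by (auto simp: monic_polys_def lead_coeff_mult degree_mult_eq leading_coeff_0_iff[symmetric]
      simp del: leading_coeff_0_iff)

lemma monic_polys_power: "f \<in> monic_polys a \<Longrightarrow> f ^ i \<in> monic_polys (i * a)"
  by (induction i) (auto simp: monic_polys_0 dest: monic_polys_mult)

lemma monic_polys_cofactor:
  assumes "f \<in> monic_polys a" "f * g \<in> monic_polys b"
  shows "a \<le> b \<and> g \<in> monic_polys (b - a)"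
proof -
  from assms have "g \<noteq> 0" "f \<noteq> 0" by (auto simp: monic_polys_def)
  moreover have "lead_coeff g = 1"
    using assms lead_coeff_mult[of f g] by (auto simp: monic_polys_def)
  ultimately show ?thesis using assms by (auto simp: monic_polys_def degree_mult_eq)
qed

text \<open>A free weight lets one additivity proof serve two functions: weight 1 gives
  \<open>big_omega\<close>, weight \<open>degree\<close> gives the degree.\<close>

definition prime_weight_sum :: "('a::field poly \<Rightarrow> nat) \<Rightarrow> 'a poly \<Rightarrow> nat" where
  "prime_weight_sum w f =
     (\<Sum>p | lead_coeff p = 1 \<and> irreducible p \<and> p dvd f. poly_multiplicity p f * w p)"

lemma big_omega_eq_prime_weight_sum: "big_omega f = prime_weight_sum (\<lambda>_. 1) f"
  by (simp add: big_omega_def prime_weight_sum_def)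

text \<open>Primes not dividing \<open>f\<close> have multiplicity 0, so \<open>f\<close>,
  \<open>g\<close> and \<open>f * g\<close> can be compared over one common index set.\<close>

lemma prime_weight_sum_superset:
  fixes f :: "'a::{field,finite} poly"
  assumes "f \<noteq> 0" "finite S" "{p. lead_coeff p = 1 \<and> irreducible p \<and> p dvd f} \<subseteq> S"
    and "S \<subseteq> {p. lead_coeff p = 1 \<and> irreducible p}"
  shows "prime_weight_sum w f = (\<Sum>p\<in>S. poly_multiplicity p f * w p)"
  unfolding prime_weight_sum_def
proof (rule sum.mono_neutral_left)
  show "\<forall>p\<in>S - {p. lead_coeff p = 1 \<and> irreducible p \<and> p dvd f}. poly_multiplicity p f * w p = 0"
  proof
    fix p assume "p \<in> S - {p. lead_coeff p = 1 \<and> irreducible p \<and> p dvd f}"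
    with assms(4) have "irreducible p" "\<not> p dvd f" by auto
    then show "poly_multiplicity p f * w p = 0" using poly_multiplicity_eq_0[of p f] assms(1) by simp
  qed
qed (use assms in auto)

lemma prime_weight_sum_mult:
  fixes f g :: "'a::{field,finite} poly"
  assumes "f \<noteq> 0" "g \<noteq> 0"
  shows "prime_weight_sum w (f * g) = prime_weight_sum w f + prime_weight_sum w g"
proof -
  let ?S = "{p. lead_coeff p = 1 \<and> irreducible p \<and> p dvd f * g}"
  have fin: "finite ?S"
    by (rule finite_subset[OF _ finite_divisors_poly[of "f * g"]]) (use assms in auto)
  have "prime_weight_sum w (f * g) = (\<Sum>p\<in>?S. poly_multiplicity p (f * g) * w p)"
    by (rule prime_weight_sum_superset) (use assms fin in auto)
  also have "\<dots> = (\<Sum>p\<in>?S. poly_multiplicity p f * w p + poly_multiplicity p g * w p)"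
    by (rule sum.cong) (auto simp: poly_multiplicity_mult assms algebra_simps)
  also have "\<dots> = prime_weight_sum w f + prime_weight_sum w g"
    unfolding sum.distrib
    by (intro arg_cong2[of _ _ _ _ "(+)"] prime_weight_sum_superset[symmetric])
       (use assms fin in auto)
  finally show ?thesis .
qed

lemma prime_weight_sum_1 [simp]: "prime_weight_sum w 1 = 0"
proof -
  have "{p::'a poly. lead_coeff p = 1 \<and> irreducible p \<and> p dvd 1} = {}"
    using irreducible_not_unit by auto
  then show ?thesis by (simp only: prime_weight_sum_def sum.empty)
qed

lemma prime_weight_sum_irreducible:
  fixes p :: "'a::{field,finite} poly"
  assumes "lead_coeff p = 1" "irreducible p"
  shows "prime_weight_sum w p = w p"
proof -
  have "{r::'a poly. lead_coeff r = 1 \<and> irreducible r \<and> r dvd p} = {p}"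
  proof safe
    fix r assume r: "lead_coeff r = 1" "irreducible r" "r dvd p"
    then obtain s where s: "p = r * s" by auto
    with assms(2) r(2) have "is_unit s" using irreducibleD irreducible_not_unit by blast
    moreover have "lead_coeff s = 1" using s r(1) assms(1) by (simp add: lead_coeff_mult)
    ultimately have "s = 1" by (auto elim!: is_unit_polyE)
    with s show "r = p" by simp
  qed (use assms in auto)
  moreover have "poly_multiplicity p p = 1"
    using poly_multiplicity_eqI[OF assms(2), of 1 1] irreducible_not_unit[OF assms(2)] by simp
  ultimately show ?thesis by (simp add: prime_weight_sum_def)
qed

lemma monic_irreducible_divisor_exists:
  fixes f :: "'a::field poly"
  assumes "degree f > 0"
  shows "\<exists>p. lead_coeff p = 1 \<and> irreducible p \<and> p dvd f"
  using assms
proof (induction "degree f" arbitrary: f rule: less_induct)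
  case less
  show ?case
  proof (cases "irreducible f")
    case True
    let ?p = "smult (inverse (lead_coeff f)) f"
    have f0: "lead_coeff f \<noteq> 0" using less.prems by auto
    have "is_unit [:inverse (lead_coeff f):]" using f0 by (simp add: is_unit_pCons_iff)
    then have "irreducible ([:inverse (lead_coeff f):] * f)"
      using True by (simp add: irreducible_mult_unit_left del: mult_pCons_left)
    then have "irreducible ?p" by simp
    moreover have "?p dvd f" using f0 by (simp add: smult_dvd)
    ultimately show ?thesis using f0 by (intro exI[of _ ?p]) auto
  next
    case False
    have f0: "f \<noteq> 0" using less.prems by auto
    then have "\<not> is_unit f" using less.prems by (simp add: is_unit_iff_degree)
    with False f0 obtain a b where ab: "f = a * b" "\<not> is_unit a" "\<not> is_unit b"
      unfolding irreducible_def by blast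
    with f0 have "a \<noteq> 0" "b \<noteq> 0" by auto
    with ab have "degree a > 0" "degree b > 0" by (auto simp: is_unit_iff_degree)
    moreover have "degree f = degree a + degree b"
      using ab \<open>a \<noteq> 0\<close> \<open>b \<noteq> 0\<close> by (simp add: degree_mult_eq)
    ultimately obtain p where "lead_coeff p = 1" "irreducible p" "p dvd a"
      using less.hyps[of a] by auto
    with ab show ?thesis by auto
  qed
qed

text \<open>Splitting off a monic irreducible divisor lowers the degree, and additivity closes the
  induction. This is the polynomial analogue of log f = sum of Lambda over the divisors of
  f.\<close>

lemma prime_weight_sum_degree:
  fixes f :: "'a::{field,finite} poly"
  assumes "f \<in> monic_polys n"
  shows "prime_weight_sum degree f = n"
  using assms
proof (induction n arbitrary: f rule: less_induct)
  case (less n)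
  show ?case
  proof (cases "n = 0")
    case True
    with less.prems show ?thesis by (simp add: monic_polys_0)
  next
    case False
    with less.prems have "degree f > 0" by (simp add: monic_polys_def)
    then obtain p where p: "lead_coeff p = 1" "irreducible p" "p dvd f"
      using monic_irreducible_divisor_exists by blast
    then obtain g where g: "f = p * g" by auto
    have "p \<in> monic_polys (degree p)" using p by (simp add: monic_polys_def)
    with less.prems g have *: "degree p \<le> n" "g \<in> monic_polys (n - degree p)"
      using monic_polys_cofactor by blast+
    have "degree p > 0" using p irreducible_degree_pos by blast
    then have "prime_weight_sum degree g = n - degree p" using less.IH[OF _ *(2)] * by simp
    then show ?thesis
      using g p * prime_weight_sum_mult[of p g degree] prime_weight_sum_irreducible[of p degree]
        monic_polys_nonzero[OF *(2)] p(2) by fastforce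
  qed
qed

text \<open>Multiplicativity is required off zero only, so that \<open>chi f * z ^ big_omega f\<close> qualifies.\<close>

definition completely_multiplicative :: "('a::field poly \<Rightarrow> complex) \<Rightarrow> bool" where
  "completely_multiplicative \<psi> \<longleftrightarrow>
     \<psi> 1 = 1 \<and> (\<forall>f g. f \<noteq> 0 \<longrightarrow> g \<noteq> 0 \<longrightarrow> \<psi> (f * g) = \<psi> f * \<psi> g)"

definition monic_sum :: "('a::{field,finite} poly \<Rightarrow> complex) \<Rightarrow> nat \<Rightarrow> complex" where
  "monic_sum \<psi> n = (\<Sum>f\<in>monic_polys n. \<psi> f)"

text \<open>The coefficients of \<open>u L'/L\<close>: prime powers \<open>p ^ i\<close> of degree \<open>j\<close> weighted by \<open>degree p\<close>.\<close>

definition mangoldt_sum :: "('a::{field,finite} poly \<Rightarrow> complex) \<Rightarrow> nat \<Rightarrow> complex" where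
  "mangoldt_sum \<psi> j =
     (\<Sum>m | m \<in> {1..j} \<and> m dvd j. of_nat m * (\<Sum>p\<in>monic_irreducibles m. \<psi> p ^ (j div m)))"

section \<open>The recurrence for sums of a completely multiplicative function\<close>

lemma completely_multiplicative_power:
  "completely_multiplicative \<psi> \<Longrightarrow> p \<noteq> 0 \<Longrightarrow> \<psi> (p ^ i) = \<psi> p ^ i"
  by (induction i) (auto simp: completely_multiplicative_def)

lemma sum_multiples_of_prime_power:
  fixes \<psi> :: "'a::{field,finite} poly \<Rightarrow> complex"
  assumes \<psi>: "completely_multiplicative \<psi>" and p: "p \<in> monic_polys m"
  shows "(\<Sum>f | f \<in> monic_polys n \<and> p ^ i dvd f. \<psi> f) =
         (if i * m \<le> n then \<psi> p ^ i * monic_sum \<psi> (n - i * m) else 0)"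
proof (cases "i * m \<le> n")
  case True
  have pi: "p ^ i \<in> monic_polys (i * m)" using p by (rule monic_polys_power)
  have p0: "p \<noteq> 0" using p by (rule monic_polys_nonzero)
  have "{f \<in> monic_polys n. p ^ i dvd f} = (\<lambda>g. p ^ i * g) ` monic_polys (n - i * m)"
  proof (intro equalityI subsetI)
    fix f assume "f \<in> {f \<in> monic_polys n. p ^ i dvd f}"
    then obtain g where "f \<in> monic_polys n" "f = p ^ i * g" by auto
    with monic_polys_cofactor[OF pi] show "f \<in> (\<lambda>g. p ^ i * g) ` monic_polys (n - i * m)" by auto
  next
    fix f assume "f \<in> (\<lambda>g. p ^ i * g) ` monic_polys (n - i * m)"
    then show "f \<in> {f \<in> monic_polys n. p ^ i dvd f}"
      using monic_polys_mult[OF pi, of _ "n - i * m"] True by auto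
  qed
  then have "(\<Sum>f | f \<in> monic_polys n \<and> p ^ i dvd f. \<psi> f) =
      (\<Sum>g\<in>monic_polys (n - i * m). \<psi> (p ^ i * g))"
    by (simp add: sum.reindex inj_on_def p0)
  also have "\<dots> = (\<Sum>g\<in>monic_polys (n - i * m). \<psi> p ^ i * \<psi> g)"
    using \<psi> p0 completely_multiplicative_power[OF \<psi> p0]
    by (intro sum.cong) (auto simp: completely_multiplicative_def dest: monic_polys_nonzero)
  finally show ?thesis using True by (simp add: monic_sum_def sum_distrib_left)
next
  case False
  have "{f \<in> monic_polys n. p ^ i dvd f} = {}"
    using False monic_polys_cofactor[OF monic_polys_power[OF p]] by fastforce
  then show ?thesis using False by (simp only: sum.empty if_False)
qed

lemma sum_multiples_reindex:
  fixes h :: "nat \<Rightarrow> nat \<Rightarrow> 'b::comm_monoid_add"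
  assumes "m \<ge> 1"
  shows "(\<Sum>i=1..n. if i * m \<le> n then h i (i * m) else 0) =
         (\<Sum>j=1..n. if m dvd j then h (j div m) j else 0)"
proof -
  have "(\<Sum>i=1..n. if i * m \<le> n then h i (i * m) else 0) = (\<Sum>i | i \<in> {1..n} \<and> i * m \<le> n. h i (i * m))"
    by (simp add: sum.If_cases Int_def)
  also have "\<dots> = (\<Sum>j | j \<in> {1..n} \<and> m dvd j. h (j div m) j)"
  proof (rule sum.reindex_bij_witness[of _ "\<lambda>j. j div m" "\<lambda>i. i * m"])
    fix j assume j: "j \<in> {j. j \<in> {1..n} \<and> m dvd j}"
    then obtain i where i: "j = m * i" by auto
    have "i \<ge> 1" using j i by (cases i) auto
    moreover have "i \<le> m * i" using assms by (cases m) auto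
    then have "i \<le> n" by (rule order.trans) (use i j in auto)
    ultimately show "j div m \<in> {i. i \<in> {1..n} \<and> i * m \<le> n}"
      using j i assms by (auto simp: mult.commute[of i m])
  next
    fix i assume i: "i \<in> {i. i \<in> {1..n} \<and> i * m \<le> n}"
    then have "1 * 1 \<le> i * m" using assms by (intro mult_le_mono) auto
    then show "i * m \<in> {j. j \<in> {1..n} \<and> m dvd j}" using i by simp
  qed (use assms in auto)
  also have "\<dots> = (\<Sum>j=1..n. if m dvd j then h (j div m) j else 0)"
    by (simp add: sum.If_cases Int_def)
  finally show ?thesis .
qed

text \<open>The multiplicity counts the powers of \<open>p\<close> dividing \<open>f\<close>. An
  irreducible has degree at least 1, so exponents up to \<open>n\<close> suffice, a range
  independent of \<open>p\<close>, which permits exchanging the sums later.\<close>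

lemma poly_multiplicity_eq_sum:
  fixes p f :: "'a::field poly"
  assumes p: "irreducible p" and f: "f \<in> monic_polys n"
  shows "poly_multiplicity p f = (\<Sum>i=1..n. if p ^ i dvd f then 1 else 0)"
proof -
  have f0: "f \<noteq> 0" using f by (rule monic_polys_nonzero)
  have p0: "p \<noteq> 0" using p by auto
  have "p ^ poly_multiplicity p f dvd f"
    using power_dvd_iff_le_poly_multiplicity[OF p f0] by simp
  then have "degree (p ^ poly_multiplicity p f) \<le> degree f" using f0 by (rule dvd_imp_degree_le)
  then have "poly_multiplicity p f * degree p \<le> n"
    using f by (simp add: degree_power_eq p0 monic_polys_def)
  moreover have "poly_multiplicity p f * 1 \<le> poly_multiplicity p f * degree p"
    using irreducible_degree_pos[OF p] by (intro mult_left_mono) auto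
  ultimately have "poly_multiplicity p f \<le> n" by linarith
  then have "{1..n} \<inter> {i. p ^ i dvd f} = {1..poly_multiplicity p f}"
    by (auto simp: power_dvd_iff_le_poly_multiplicity[OF p f0])
  then show ?thesis by (simp add: sum.If_cases)
qed

text \<open>Coefficientwise form of u L' = (u L'/L) L. The degree n of each f is the number of prime
  powers dividing f, each weighted by the degree of its prime; after exchanging sums, the multiples
  of p^i contribute \<open>\<psi>\<close> p ^ i times the sum in degree n - i * degree p.\<close>

lemma monic_sum_recurrence:
  fixes \<psi> :: "'a::{field,finite} poly \<Rightarrow> complex"
  assumes \<psi>: "completely_multiplicative \<psi>"
  shows "of_nat n * monic_sum \<psi> n = (\<Sum>j=1..n. mangoldt_sum \<psi> j * monic_sum \<psi> (n - j))"
proof -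
  have deg: "n = (\<Sum>m=1..n. \<Sum>p\<in>monic_irreducibles m. \<Sum>i=1..n. if p ^ i dvd f then m else 0)"
    if f: "f \<in> monic_polys n" for f :: "'a poly"
  proof -
    have f0: "f \<noteq> 0" using f by (rule monic_polys_nonzero)
    let ?S = "(\<Union>m\<in>{1..n}. monic_irreducibles m) :: 'a poly set"
    have "n = prime_weight_sum degree f" using prime_weight_sum_degree[OF f] by simp
    also have "\<dots> = (\<Sum>p\<in>?S. poly_multiplicity p f * degree p)"
    proof (rule prime_weight_sum_superset)
      show "{p. lead_coeff p = 1 \<and> irreducible p \<and> p dvd f} \<subseteq> ?S"
      proof safe
        fix p assume p: "lead_coeff p = 1" "irreducible p" "p dvd f"
        have "degree p \<le> n" using dvd_imp_degree_le[OF p(3) f0] f by (simp add: monic_polys_def)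
        moreover have "degree p \<ge> 1" using irreducible_degree_pos[OF p(2)] by simp
        ultimately show "p \<in> ?S" using p by (auto simp: monic_irreducibles_def monic_polys_def)
      qed
    next
      show "finite ?S" by simp
    qed (use f0 in \<open>auto simp: monic_irreducibles_def monic_polys_def\<close>)
    also have "\<dots> = (\<Sum>m=1..n. \<Sum>p\<in>monic_irreducibles m. poly_multiplicity p f * degree p)"
      by (rule sum.UNION_disjoint) (simp, simp, auto simp: monic_irreducibles_def monic_polys_def)
    also have "\<dots> = (\<Sum>m=1..n. \<Sum>p\<in>monic_irreducibles m. \<Sum>i=1..n. if p ^ i dvd f then m else 0)"
    proof (intro sum.cong refl)
      fix m and p :: "'a poly" assume "p \<in> monic_irreducibles m"
      then have p: "irreducible p" "degree p = m"
        by (auto simp: monic_irreducibles_def monic_polys_def)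
      show "poly_multiplicity p f * degree p = (\<Sum>i=1..n. if p ^ i dvd f then m else 0)"
        unfolding poly_multiplicity_eq_sum[OF p(1) f] sum_distrib_right by (auto simp: p intro!: sum.cong)
    qed
    finally show ?thesis .
  qed
  have "of_nat n * monic_sum \<psi> n = (\<Sum>f\<in>monic_polys n. of_nat n * \<psi> f)"
    by (simp add: monic_sum_def sum_distrib_left)
  also have "\<dots> = (\<Sum>f\<in>monic_polys n.
      \<Sum>m=1..n. \<Sum>p\<in>monic_irreducibles m. \<Sum>i=1..n. if p ^ i dvd f then of_nat m * \<psi> f else 0)"
  proof (rule sum.cong[OF refl])
    fix f :: "'a poly" assume "f \<in> monic_polys n"
    then have "of_nat n * \<psi> f = of_nat (\<Sum>m=1..n. \<Sum>p\<in>monic_irreducibles m.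
      \<Sum>i=1..n. if p ^ i dvd f then m else 0) * \<psi> f"
      using deg[of f] by presburger
    also have "\<dots> = (\<Sum>m=1..n. \<Sum>p\<in>monic_irreducibles m.
      \<Sum>i=1..n. if p ^ i dvd f then of_nat m * \<psi> f else 0)"
      by (simp add: sum_distrib_right if_distrib[where f=of_nat] if_distrib[where f="\<lambda>x. x * \<psi> f"] cong: if_cong)
    finally show "of_nat n * \<psi> f = \<dots>" .
  qed
  also have "\<dots> = (\<Sum>m=1..n. \<Sum>f\<in>monic_polys n.
      \<Sum>p\<in>monic_irreducibles m. \<Sum>i=1..n. if p ^ i dvd f then of_nat m * \<psi> f else 0)"
    by (rule sum.swap)
  also have "\<dots> = (\<Sum>m=1..n. \<Sum>p\<in>monic_irreducibles m. \<Sum>i=1..n. \<Sum>f\<in>monic_polys n.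
      if p ^ i dvd f then of_nat m * \<psi> f else 0)"
    by (subst sum.swap, subst (2) sum.swap, rule refl)
  also have "\<dots> = (\<Sum>m=1..n. \<Sum>p\<in>monic_irreducibles m. \<Sum>i=1..n.
      if i * m \<le> n then of_nat m * (\<psi> p ^ i * monic_sum \<psi> (n - i * m)) else 0)"
  proof (intro sum.cong refl)
    fix m i and p :: "'a poly" assume "p \<in> monic_irreducibles m"
    then have p: "p \<in> monic_polys m" by (simp add: monic_irreducibles_def)
    have "(\<Sum>f\<in>monic_polys n. if p ^ i dvd f then of_nat m * \<psi> f else 0) =
       of_nat m * (\<Sum>f | f \<in> monic_polys n \<and> p ^ i dvd f. \<psi> f)"
      by (simp add: sum.If_cases Int_def sum_distrib_left)
    then show "(\<Sum>f\<in>monic_polys n. if p ^ i dvd f then of_nat m * \<psi> f else 0) =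
       (if i * m \<le> n then of_nat m * (\<psi> p ^ i * monic_sum \<psi> (n - i * m)) else 0)"
      by (simp add: sum_multiples_of_prime_power[OF \<psi> p])
  qed
  also have "\<dots> = (\<Sum>m=1..n. \<Sum>p\<in>monic_irreducibles m. \<Sum>j=1..n.
      if m dvd j then of_nat m * (\<psi> p ^ (j div m) * monic_sum \<psi> (n - j)) else 0)"
    by (intro sum.cong refl sum_multiples_reindex) auto
  also have "\<dots> = (\<Sum>m=1..n. \<Sum>j=1..n. \<Sum>p\<in>monic_irreducibles m.
      if m dvd j then of_nat m * (\<psi> p ^ (j div m) * monic_sum \<psi> (n - j)) else 0)"
    by (subst (2) sum.swap, rule refl)
  also have "\<dots> = (\<Sum>j=1..n. \<Sum>m=1..n. \<Sum>p\<in>monic_irreducibles m.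
      if m dvd j then of_nat m * (\<psi> p ^ (j div m) * monic_sum \<psi> (n - j)) else 0)"
    by (rule sum.swap)
  also have "\<dots> = (\<Sum>j=1..n. mangoldt_sum \<psi> j * monic_sum \<psi> (n - j))"
  proof (intro sum.cong refl)
    fix j assume j: "j \<in> {1..n}"
    have "mangoldt_sum \<psi> j =
      (\<Sum>m=1..n. if m dvd j then of_nat m * (\<Sum>p\<in>monic_irreducibles m. \<psi> p ^ (j div m)) else 0)"
      unfolding mangoldt_sum_def using j by (subst sum.If_cases) (auto intro!: sum.cong dest: dvd_imp_le)
    then show "(\<Sum>m=1..n. \<Sum>p\<in>monic_irreducibles m.
      if m dvd j then of_nat m * (\<psi> p ^ (j div m) * monic_sum \<psi> (n - j)) else 0) =
      mangoldt_sum \<psi> j * monic_sum \<psi> (n - j)"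
      by (auto simp: sum_distrib_right sum_distrib_left mult.assoc intro!: sum.cong)
  qed
  finally show ?thesis .
qed

section \<open>Exponentials of power series by their logarithmic derivative\<close>

text \<open>Coefficients of exp (sum over j >= 1 of l j * u^j / j). The recurrence is u F' = (u
  F'/F) F compared at u^n; it settles existence without convergence and makes bounds accessible to
  induction.\<close>

function exp_coeff :: "(nat \<Rightarrow> 'a::field_char_0) \<Rightarrow> nat \<Rightarrow> 'a" where
  "exp_coeff l n = (if n = 0 then 1 else (\<Sum>j=1..n. l j * exp_coeff l (n - j)) / of_nat n)"
  by auto
termination by (relation "inv_image less_than snd") auto

declare exp_coeff.simps [simp del]

lemma exp_coeff_0 [simp]: "exp_coeff l 0 = 1"
  by (simp add: exp_coeff.simps)

lemma exp_coeff_rec: "of_nat n * exp_coeff l n = (\<Sum>j=1..n. l j * exp_coeff l (n - j))"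
  by (cases "n = 0") (simp_all add: exp_coeff.simps[of l n])

lemma exp_coeff_unique:
  assumes "a 0 = 1" and rec: "\<And>n. of_nat n * a n = (\<Sum>j=1..n. l j * a (n - j))"
  shows "a n = exp_coeff l n"
proof (induction n rule: less_induct)
  case (less n)
  show ?case
  proof (cases "n = 0")
    case False
    have "of_nat n * a n = (\<Sum>j=1..n. l j * exp_coeff l (n - j))"
      unfolding rec by (intro sum.cong refl arg_cong2[of _ _ _ _ "(*)"] less) auto
    also have "\<dots> = of_nat n * exp_coeff l n" by (simp add: exp_coeff_rec)
    finally show ?thesis using False by simp
  qed (use assms in auto)
qed

lemma exp_coeff_cong:
  assumes "\<And>j. j \<ge> 1 \<Longrightarrow> l j = l' j"
  shows "exp_coeff l n = exp_coeff l' n"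
  by (rule exp_coeff_unique) (auto simp: exp_coeff_rec assms intro!: sum.cong)

text \<open>In the recurrence at n the value \<open>l n\<close> is multiplied by
  \<open>exp_coeff l 0\<close>, which is 1; all other terms involve \<open>l j\<close> with j <
  n.\<close>

lemma exp_coeff_determines:
  fixes l l' :: "nat \<Rightarrow> 'a::field_char_0"
  assumes eq: "\<And>n. exp_coeff l n = exp_coeff l' n" and "n \<ge> 1"
  shows "l n = l' n"
  using \<open>n \<ge> 1\<close>
proof (induction n rule: less_induct)
  case (less n)
  have split: "{1..n} = insert n {1..<n}" using less.prems by auto
  have "(\<Sum>j=1..n. l j * exp_coeff l (n - j)) = (\<Sum>j=1..n. l' j * exp_coeff l (n - j))"
    using exp_coeff_rec[of n l] exp_coeff_rec[of n l'] eq by simp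
  moreover have "(\<Sum>j=1..<n. l j * exp_coeff l (n - j)) = (\<Sum>j=1..<n. l' j * exp_coeff l (n - j))"
    by (rule sum.cong) (use less.IH in auto)
  ultimately show ?case unfolding split by simp
qed

definition exp_fps :: "(nat \<Rightarrow> 'a::field_char_0) \<Rightarrow> 'a fps" where
  "exp_fps l = Abs_fps (exp_coeff l)"

lemma exp_fps_nth [simp]: "fps_nth (exp_fps l) n = exp_coeff l n"
  by (simp add: exp_fps_def)

lemma exp_fps_eqI:
  assumes "fps_nth F 0 = 1" and "fps_X * fps_deriv F = Abs_fps (\<lambda>j. if j = 0 then 0 else l j) * F"
  shows "F = exp_fps l"
proof (rule fps_ext)
  fix n
  have "of_nat n * fps_nth F n = (\<Sum>j=1..n. l j * fps_nth F (n - j))" for n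
  proof -
    have "of_nat n * fps_nth F n = fps_nth (fps_X * fps_deriv F) n" by (cases n) auto
    also have "\<dots> = (\<Sum>j=0..n. (if j = 0 then 0 else l j) * fps_nth F (n - j))"
      unfolding assms(2) fps_mult_nth by simp
    also have "\<dots> = (\<Sum>j=1..n. l j * fps_nth F (n - j))"
      by (simp add: sum.atLeast_Suc_atMost)
    finally show ?thesis .
  qed
  from exp_coeff_unique[of "fps_nth F", OF assms(1) this]
  show "fps_nth F n = fps_nth (exp_fps l) n" by simp
qed

lemma exp_fps_deriv:
  "fps_X * fps_deriv (exp_fps l) = Abs_fps (\<lambda>j. if j = 0 then 0 else l j) * exp_fps l"
proof (rule fps_ext)
  fix n
  have "fps_nth (fps_X * fps_deriv (exp_fps l)) n = of_nat n * exp_coeff l n"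
    by (cases n) auto
  also have "\<dots> = (\<Sum>j=1..n. l j * exp_coeff l (n - j))" by (rule exp_coeff_rec)
  also have "\<dots> = (\<Sum>j=0..n. (if j = 0 then 0 else l j) * exp_coeff l (n - j))"
    by (simp add: sum.atLeast_Suc_atMost)
  finally show "fps_nth (fps_X * fps_deriv (exp_fps l)) n =
    fps_nth (Abs_fps (\<lambda>j. if j = 0 then 0 else l j) * exp_fps l) n" by (simp add: fps_mult_nth)
qed

lemma exp_fps_add: "exp_fps (\<lambda>j. l j + l' j) = exp_fps l * exp_fps l'"
proof (rule exp_fps_eqI[symmetric])
  let ?L = "\<lambda>l. Abs_fps (\<lambda>j. if j = 0 then 0 else l j) :: 'a fps"
  have "fps_X * fps_deriv (exp_fps l * exp_fps l') =
      (fps_X * fps_deriv (exp_fps l)) * exp_fps l' + exp_fps l * (fps_X * fps_deriv (exp_fps l'))"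
    by (simp add: algebra_simps)
  also have "\<dots> = (?L l + ?L l') * (exp_fps l * exp_fps l')"
    unfolding exp_fps_deriv by (simp add: algebra_simps)
  also have "?L l + ?L l' = ?L (\<lambda>j. l j + l' j)" by (rule fps_ext) auto
  finally show "fps_X * fps_deriv (exp_fps l * exp_fps l') =
    ?L (\<lambda>j. l j + l' j) * (exp_fps l * exp_fps l')" .
qed simp

lemma exp_fps_0: "exp_fps (\<lambda>_. 0) = 1"
  by (rule exp_fps_eqI[symmetric]) (auto simp: fps_eq_iff fps_mult_nth)

lemma exp_fps_sum:
  "exp_fps (\<lambda>j. \<Sum>a\<in>S. l a j) = (\<Prod>a\<in>S. exp_fps (l a))"
  by (induction S rule: infinite_finite_induct) (simp_all add: exp_fps_0 exp_fps_add)

lemma exp_fps_of_nat: "exp_fps (\<lambda>j. of_nat m * l j) = exp_fps l ^ m"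
  by (induction m) (simp_all add: exp_fps_0 exp_fps_add distrib_right)

text \<open>This is log (1 - c u) = - sum of c^j u^j / j, the bridge between factored polynomials
  and power sums of their reciprocal roots.\<close>

lemma exp_fps_linear: "exp_fps (\<lambda>j. - (c ^ j)) = fps_of_poly [:1, -c:]"
proof (rule exp_fps_eqI[symmetric])
  show "fps_X * fps_deriv (fps_of_poly [:1, - c:]) =
    Abs_fps (\<lambda>j. if j = 0 then 0 else - (c ^ j)) * fps_of_poly [:1, - c:]"
  proof (rule fps_ext)
    fix n
    show "fps_nth (fps_X * fps_deriv (fps_of_poly [:1, - c:])) n =
      fps_nth (Abs_fps (\<lambda>j. if j = 0 then 0 else - (c ^ j)) * fps_of_poly [:1, - c:]) n"
    proof (cases n)
      case (Suc k)
      then show ?thesis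
        by (cases k) (auto simp: fps_mult_nth coeff_pCons sum.atLeast_Suc_atMost
            sum.cl_ivl_Suc Suc_diff_le split: nat.splits intro!: sum.neutral)
    qed (auto simp: fps_mult_nth)
  qed
qed simp

text \<open>Substitution of c u for u.\<close>

lemma exp_coeff_scale: "exp_coeff (\<lambda>j. c ^ j * l j) n = c ^ n * exp_coeff l n"
proof (rule exp_coeff_unique[symmetric])
  fix n
  show "of_nat n * (c ^ n * exp_coeff l n) = (\<Sum>j=1..n. c ^ j * l j * (c ^ (n - j) * exp_coeff l (n - j)))"
  proof -
    have "of_nat n * (c ^ n * exp_coeff l n) = c ^ n * (of_nat n * exp_coeff l n)" by simp
    also have "\<dots> = (\<Sum>j=1..n. c ^ n * (l j * exp_coeff l (n - j)))"
      unfolding exp_coeff_rec sum_distrib_left ..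
    also have "\<dots> = (\<Sum>j=1..n. c ^ j * l j * (c ^ (n - j) * exp_coeff l (n - j)))"
    proof (rule sum.cong[OF refl])
      fix j assume "j \<in> {1..n}"
      then have "c ^ n = c ^ j * c ^ (n - j)" by (simp flip: power_add)
      then show "c ^ n * (l j * exp_coeff l (n - j)) = c ^ j * l j * (c ^ (n - j) * exp_coeff l (n - j))"
        by simp
    qed
    finally show ?thesis .
  qed
qed simp

text \<open>The recurrence combines its terms with positive weights only, so a majorant of the
  logarithmic derivative yields a majorant of the series.\<close>

lemma norm_exp_coeff_le:
  fixes l :: "nat \<Rightarrow> 'a::{real_normed_field}"
  assumes "\<And>j. j \<ge> 1 \<Longrightarrow> norm (l j) \<le> b j"
  shows "norm (exp_coeff l n) \<le> exp_coeff b n"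
proof (induction n rule: less_induct)
  case (less n)
  show ?case
  proof (cases "n = 0")
    case False
    have "real n * norm (exp_coeff l n) = norm (\<Sum>j=1..n. l j * exp_coeff l (n - j))"
      by (subst exp_coeff_rec[symmetric]) (simp add: norm_mult)
    also have "\<dots> \<le> (\<Sum>j=1..n. b j * exp_coeff b (n - j))"
    proof (rule order.trans[OF norm_sum], rule sum_mono)
      fix j assume j: "j \<in> {1..n}"
      have "0 \<le> b j" using assms[of j] j norm_ge_zero[of "l j"] by (simp del: norm_ge_zero)
      then show "norm (l j * exp_coeff l (n - j)) \<le> b j * exp_coeff b (n - j)"
        unfolding norm_mult using j by (intro mult_mono assms less) auto
    qed
    also have "\<dots> = real n * exp_coeff b n" by (simp add: exp_coeff_rec)
    finally show ?thesis using False by simp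
  qed simp
qed

text \<open>The bound is uniform in \<open>l\<close>; the exponent \<open>min n N\<close> records that the normalised coefficients
  can grow only while \<open>n\<close> is below \<open>K\<close>.\<close>

lemma exp_coeff_geometric_bound:
  fixes C t s :: real
  assumes C: "C \<ge> 0" and t: "0 < t" "t < s"
  shows "\<exists>D\<ge>0. \<forall>l :: nat \<Rightarrow> complex. (\<forall>j\<ge>1. norm (l j) \<le> C * t ^ j) \<longrightarrow>
    (\<forall>n. norm (exp_coeff l n) \<le> D * s ^ n)"
proof -
  define r where "r = t / s"
  have r: "0 < r" "r < 1" using t by (auto simp: r_def)
  \<comment> \<open>The sum over j >= 1 of C * (t / s)^j. One use of the recurrence multiplies the
    bound on the coefficients, normalised by s^n, by at most K / n.\<close>
  define K where "K = C * (r / (1 - r))"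
  have K: "K \<ge> 0" using r C by (simp add: K_def)
  define N where "N = nat \<lceil>K\<rceil>"
  have geo: "(\<Sum>j=1..n. r ^ j) \<le> r / (1 - r)" for n :: nat
  proof -
    have "(\<Sum>j=1..n. r ^ j) = (\<Sum>j<n. r * r ^ j)"
      by (rule sum.reindex_bij_witness[of _ Suc "\<lambda>j. j - 1"]) (auto simp flip: power_Suc)
    also have "\<dots> = r * ((1 - r ^ n) / (1 - r))"
      using r by (simp add: sum_gp_strict flip: sum_distrib_left)
    also have "\<dots> \<le> r * (1 / (1 - r))"
      using r by (intro mult_left_mono divide_right_mono) auto
    finally show ?thesis by simp
  qed
  have *: "norm (exp_coeff l n) \<le> (1 + K) ^ min n N * s ^ n"
    if l: "\<forall>j\<ge>1. norm (l j) \<le> C * t ^ j" for l :: "nat \<Rightarrow> complex" and n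
  proof (induction n rule: less_induct)
    case (less n)
    show ?case
    proof (cases "n = 0")
      case False
      have "real n * norm (exp_coeff l n) = norm (\<Sum>j=1..n. l j * exp_coeff l (n - j))"
        by (subst exp_coeff_rec[symmetric]) (simp add: norm_mult)
      also have "\<dots> \<le> (\<Sum>j=1..n. (C * t ^ j) * ((1 + K) ^ min (n - 1) N * s ^ (n - j)))"
      proof (rule order.trans[OF norm_sum], rule sum_mono)
        fix j assume j: "j \<in> {1..n}"
        have "norm (exp_coeff l (n - j)) \<le> (1 + K) ^ min (n - j) N * s ^ (n - j)"
          by (rule less) (use j in auto)
        also have "\<dots> \<le> (1 + K) ^ min (n - 1) N * s ^ (n - j)"
          using K t j by (intro mult_right_mono power_increasing) auto
        finally show "norm (l j * exp_coeff l (n - j)) \<le> (C * t ^ j) * ((1 + K) ^ min (n - 1) N * s ^ (n - j))"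
          unfolding norm_mult using l j C t by (intro mult_mono) auto
      qed
      also have "\<dots> = (\<Sum>j=1..n. (C * (1 + K) ^ min (n - 1) N * s ^ n) * r ^ j)"
      proof (rule sum.cong[OF refl])
        fix j assume j: "j \<in> {1..n}"
        have "s ^ n = s ^ j * s ^ (n - j)" using j by (simp flip: power_add)
        then show "(C * t ^ j) * ((1 + K) ^ min (n - 1) N * s ^ (n - j)) =
          (C * (1 + K) ^ min (n - 1) N * s ^ n) * r ^ j"
          using t by (simp add: r_def field_simps)
      qed
      also have "\<dots> = (C * (1 + K) ^ min (n - 1) N * s ^ n) * (\<Sum>j=1..n. r ^ j)"
        by (simp add: sum_distrib_left)
      also have "\<dots> \<le> (C * (1 + K) ^ min (n - 1) N * s ^ n) * (r / (1 - r))"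
        using C K t geo by (intro mult_left_mono) auto
      also have "\<dots> = K * (1 + K) ^ min (n - 1) N * s ^ n" by (simp add: K_def)
      also have "\<dots> \<le> real n * ((1 + K) ^ min n N * s ^ n)"
      proof (cases "n \<le> N")
        case True
        then have m: "min n N = Suc (min (n - 1) N)" using False by auto
        have "K * (1 + K) ^ min (n - 1) N \<le> real n * ((1 + K) * (1 + K) ^ min (n - 1) N)"
        proof -
          have "K * (1 + K) ^ min (n - 1) N \<le> 1 * ((1 + K) * (1 + K) ^ min (n - 1) N)"
            using K by (simp add: mult_right_mono)
          also have "\<dots> \<le> real n * ((1 + K) * (1 + K) ^ min (n - 1) N)"
            using K False by (intro mult_right_mono) auto
          finally show ?thesis .
        qed
        then show ?thesis unfolding m using t by (simp add: mult_right_mono flip: mult.assoc)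
      next
        case False
        then have m: "min n N = N" "min (n - 1) N = N" by auto
        have "K \<le> real n" using False by (simp add: N_def) linarith
        then show ?thesis unfolding m using t K by (simp add: mult_right_mono flip: mult.assoc)
      qed
      finally show ?thesis using False by simp
    qed simp
  qed
  show ?thesis
  proof (intro exI conjI allI impI)
    show "0 \<le> (1 + K) ^ N" using K by simp
    fix l :: "nat \<Rightarrow> complex" and n assume l: "\<forall>j\<ge>1. norm (l j) \<le> C * t ^ j"
    have "norm (exp_coeff l n) \<le> (1 + K) ^ min n N * s ^ n" by (rule *[OF l])
    also have "\<dots> \<le> (1 + K) ^ N * s ^ n" using K t by (intro mult_right_mono power_increasing) auto
    finally show "norm (exp_coeff l n) \<le> (1 + K) ^ N * s ^ n" .
  qed
qed

lemma exp_coeff_holomorphic: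
  assumes "\<And>j. j \<ge> 1 \<Longrightarrow> (\<lambda>z. l z j) holomorphic_on S"
  shows "(\<lambda>z. exp_coeff (l z) n) holomorphic_on S"
proof (induction n rule: less_induct)
  case (less n)
  show ?case
  proof (cases "n = 0")
    case False
    have "(\<lambda>z. (\<Sum>j=1..n. l z j * exp_coeff (l z) (n - j)) / of_nat n) holomorphic_on S"
      by (intro holomorphic_intros assms less) (use False in auto)
    then show ?thesis using False by (simp add: exp_coeff.simps[of _ n])
  qed simp
qed

section \<open>Nonvanishing for nonprincipal characters\<close>

text \<open>A nonzero element of least degree in the ideal generated by \<open>g\<close> and
  \<open>d\<close> divides both, by division with remainder, hence is a unit.\<close>

lemma bezout_poly:
  fixes g d :: "'a::field poly"
  assumes cop: "coprime g d" and d: "d \<noteq> 0"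
  obtains a b where "a * g + b * d = 1"
proof -
  define S where "S = {h. h \<noteq> 0 \<and> (\<exists>a b. h = a * g + b * d)}"
  have "d = 0 * g + 1 * d" by simp
  then have "d \<in> S" using d unfolding S_def by blast
  then obtain h where h: "h \<in> S" and least: "\<And>k. k \<in> S \<Longrightarrow> degree h \<le> degree k"
    using ex_has_least_nat[of "\<lambda>h. h \<in> S" _ degree] by blast
  from h obtain a b where h0: "h \<noteq> 0" and hab: "h = a * g + b * d" by (auto simp: S_def)
  have comb: "h dvd x" if x: "x = u * g + v * d" for x u v
  proof (rule ccontr)
    assume nd: "\<not> h dvd x"
    have "x mod h = (u - (x div h) * a) * g + (v - (x div h) * b) * d"
      using div_mult_mod_eq[of x h] unfolding x hab by (simp add: algebra_simps)
    moreover have "x mod h \<noteq> 0" using nd by (simp add: dvd_eq_mod_eq_0)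
    ultimately have "x mod h \<in> S" unfolding S_def by blast
    from least[OF this] degree_mod_less[OF h0, of x] \<open>x mod h \<noteq> 0\<close> show False by simp
  qed
  have "h dvd g" by (rule comb[of _ 1 0]) simp
  moreover have "h dvd d" by (rule comb[of _ 0 1]) simp
  ultimately have "is_unit h" using cop by (simp add: coprime_def)
  then obtain k where "1 = h * k" by (rule dvdE)
  then have "(k * a) * g + (k * b) * d = 1" unfolding hab by (simp add: algebra_simps)
  then show ?thesis using that by blast
qed

lemma coprime_dvd_mult_poly:
  fixes g d x :: "'a::field poly"
  assumes cop: "coprime g d" and d: "d \<noteq> 0" and dvd: "d dvd g * x"
  shows "d dvd x"
proof -
  obtain a b where "a * g + b * d = 1" using bezout_poly[OF cop d] .
  then have "x = a * (g * x) + (b * x) * d" by (metis (no_types, lifting) distrib_right mult.assoc mult.commute mult_1)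
  with dvd show ?thesis by (metis dvd_add dvd_mult dvd_triv_right)
qed

lemma card_field_ge_2: "CARD('a::{field,finite}) \<ge> 2"
proof -
  have "card {0, 1 :: 'a} \<le> CARD('a)" by (rule card_mono) auto
  then show ?thesis by simp
qed

section \<open>Logarithmic derivatives and the count of irreducibles\<close>

lemma monic_sum_eq_exp_coeff:
  assumes "completely_multiplicative \<psi>"
  shows "monic_sum \<psi> n = exp_coeff (mangoldt_sum \<psi>) n"
proof (rule exp_coeff_unique)
  show "monic_sum \<psi> 0 = 1"
    using assms by (simp add: monic_sum_def monic_polys_0 completely_multiplicative_def)
qed (rule monic_sum_recurrence[OF assms])

lemma exp_coeff_power: "exp_coeff (\<lambda>j. c ^ j) n = c ^ n"
proof (rule exp_coeff_unique[symmetric])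
  fix n
  have "(\<Sum>j=1..n. c ^ j * c ^ (n - j)) = (\<Sum>j=1..n. c ^ n)"
    by (rule sum.cong) (auto simp flip: power_add)
  then show "of_nat n * c ^ n = (\<Sum>j=1..n. c ^ j * c ^ (n - j))" by simp
qed simp

text \<open>There are q^n monic polynomials of degree n, so their series is 1 / (1 - q u), with
  logarithmic derivative q^j. This is the exact count of irreducibles: m times their number in
  degree m, summed over m | j, is q^j.\<close>

lemma mangoldt_sum_trivial:
  assumes "j \<ge> 1"
  shows "mangoldt_sum (\<lambda>_ :: 'a::{field,finite} poly. 1) j = of_nat CARD('a) ^ j"
proof (rule exp_coeff_determines[OF _ assms])
  fix n
  have "exp_coeff (mangoldt_sum (\<lambda>_ :: 'a poly. 1)) n = monic_sum (\<lambda>_ :: 'a poly. 1) n"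
    by (rule monic_sum_eq_exp_coeff[symmetric]) (simp add: completely_multiplicative_def)
  then show "exp_coeff (mangoldt_sum (\<lambda>_ :: 'a poly. 1)) n =
      exp_coeff (\<lambda>j. of_nat CARD('a) ^ j) n"
    by (simp add: monic_sum_def card_monic_polys exp_coeff_power)
qed

lemma sum_monic_irreducibles_le:
  assumes "j \<ge> 1"
  shows "(\<Sum>m | m \<in> {1..j} \<and> m dvd j.
      real m * card (monic_irreducibles m :: 'a::{field,finite} poly set)) = real CARD('a) ^ j"
proof -
  have "complex_of_real (\<Sum>m | m \<in> {1..j} \<and> m dvd j.
      real m * card (monic_irreducibles m :: 'a poly set)) = mangoldt_sum (\<lambda>_ :: 'a poly. 1) j"
    by (simp add: mangoldt_sum_def)
  also have "\<dots> = complex_of_real (real CARD('a) ^ j)" by (simp add: mangoldt_sum_trivial[OF assms])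
  finally show ?thesis by (simp only: of_real_eq_iff)
qed

lemma card_monic_irreducibles_le:
  assumes "m \<ge> 1"
  shows "real m * card (monic_irreducibles m :: 'a::{field,finite} poly set) \<le> real CARD('a) ^ m"
  unfolding sum_monic_irreducibles_le[OF assms, symmetric]
  by (rule member_le_sum) (use assms in auto)

lemma norm_mangoldt_sum_le:
  fixes \<psi> :: "'a::{field,finite} poly \<Rightarrow> complex"
  assumes "\<And>f. norm (\<psi> f) \<le> 1" and j: "j \<ge> 1"
  shows "norm (mangoldt_sum \<psi> j) \<le> real CARD('a) ^ j"
proof -
  have "norm (mangoldt_sum \<psi> j) \<le> (\<Sum>m | m \<in> {1..j} \<and> m dvd j.
      real m * card (monic_irreducibles m :: 'a poly set))"
    unfolding mangoldt_sum_def
  proof (rule order.trans[OF norm_sum], rule sum_mono)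
    fix m assume "m \<in> {m. m \<in> {1..j} \<and> m dvd j}"
    have "norm (\<Sum>p\<in>monic_irreducibles m. \<psi> p ^ (j div m)) \<le>
        of_nat (card (monic_irreducibles m :: 'a poly set)) * 1"
      by (rule sum_norm_bound) (simp add: norm_power power_le_one assms)
    then show "norm (of_nat m * (\<Sum>p\<in>monic_irreducibles m. \<psi> p ^ (j div m))) \<le>
        real m * card (monic_irreducibles m :: 'a poly set)"
      by (simp add: norm_mult mult_left_mono)
  qed
  then show ?thesis unfolding sum_monic_irreducibles_le[OF j] .
qed

section \<open>Dirichlet characters: bounded values and vanishing sums\<close>

context
  fixes d :: "'a::{field,finite} poly" and \<psi> :: "'a poly \<Rightarrow> complex"
  assumes \<psi>: "dirichlet_character d \<psi>"
begin

lemma modulus_nonzero: "d \<noteq> 0"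
  and dirichlet_character_mult: "\<psi> (f * g) = \<psi> f * \<psi> g"
  and dirichlet_character_cong: "f mod d = g mod d \<Longrightarrow> \<psi> f = \<psi> g"
  and dirichlet_character_nonzero_iff: "\<psi> f \<noteq> 0 \<longleftrightarrow> coprime f d"
  using \<psi> unfolding dirichlet_character_def by blast+

lemma dirichlet_character_completely_multiplicative: "completely_multiplicative \<psi>"
proof -
  have "\<psi> 1 \<noteq> 0" "\<psi> 1 = \<psi> 1 * \<psi> 1"
    using dirichlet_character_mult[of 1 1] by (simp_all add: dirichlet_character_nonzero_iff)
  then show ?thesis by (simp add: completely_multiplicative_def dirichlet_character_mult)
qed

text \<open>Values depend on the residue modulo \<open>d\<close> only, so there are finitely many,
  whereas a value of modulus above 1 would have unboundedly large powers among them.\<close>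

lemma norm_dirichlet_character_le: "norm (\<psi> f) \<le> 1"
proof (rule ccontr)
  assume gt: "\<not> norm (\<psi> f) \<le> 1"
  note d0 = modulus_nonzero
  have "range \<psi> \<subseteq> \<psi> ` {r. degree r \<le> degree d}"
  proof safe
    fix g
    have "\<psi> g = \<psi> (g mod d)" by (rule dirichlet_character_cong) simp
    moreover have "degree (g mod d) \<le> degree d" using degree_mod_less[OF d0, of g] by auto
    ultimately show "\<psi> g \<in> \<psi> ` {r. degree r \<le> degree d}" by auto
  qed
  then have "finite (range \<psi>)" by (rule finite_subset) (intro finite_imageI finite_degree_le)
  then have "finite (norm ` range \<psi>)" by (rule finite_imageI)
  then obtain B where B: "\<And>g. norm (\<psi> g) \<le> B" by (meson bdd_above_finite bdd_above_def imageI rangeI)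
  obtain n where n: "B < norm (\<psi> f) ^ n" using real_arch_pow[of "norm (\<psi> f)" B] gt by auto
  have "\<psi> (f ^ n) = \<psi> f ^ n"
  proof (cases "f = 0")
    case False
    then show ?thesis
      by (intro completely_multiplicative_power dirichlet_character_completely_multiplicative)
  next
    \<comment> \<open>The power rule covers nonzero polynomials; at 0 the value is idempotent, hence
      0 or 1.\<close>
    case True
    have "\<psi> 0 = 0 \<or> \<psi> 0 = 1" using dirichlet_character_mult[of 0 0] by simp
    with gt True show ?thesis by auto
  qed
  then show False using B[of "f ^ n"] n by (simp add: norm_power)
qed

lemma nonprincipal_degree_pos:
  assumes "\<psi> \<noteq> principal_character d"
  shows "degree d > 0"
proof (rule ccontr)
  assume "\<not> ?thesis"
  then have u: "is_unit d" by (simp add: is_unit_iff_degree modulus_nonzero)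
  have "\<psi> f = principal_character d f" for f
  proof -
    have "f mod d = 1 mod d" using u by (metis mod_eq_0_iff_dvd unit_imp_dvd)
    then have "\<psi> f = \<psi> 1" by (rule dirichlet_character_cong)
    then show ?thesis
      using dirichlet_character_completely_multiplicative u
      by (simp add: completely_multiplicative_def principal_character_def is_unit_right_imp_coprime)
  qed
  with assms show False by auto
qed

text \<open>A nonprincipal character has some \<open>g\<close> coprime to \<open>d\<close> with
  \<open>\<psi> g\<close> different from 1. Multiplication by \<open>g\<close> permutes all
  residues, so the sum equals \<open>\<psi> g\<close> times itself.\<close>

lemma sum_residues_eq_0:
  assumes np: "\<psi> \<noteq> principal_character d"
  shows "(\<Sum>r | degree r < degree d. \<psi> r) = 0"
proof -
  define S where "S = {r :: 'a poly. degree r < degree d}"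
  have fin: "finite S" unfolding S_def
    by (rule finite_subset[OF _ finite_degree_le[of "degree d"]]) auto
  note d0 = modulus_nonzero
  note dpos = nonprincipal_degree_pos[OF np]
  obtain g where g: "\<psi> g \<noteq> principal_character d g" using np by (meson ext)
  then have cop: "coprime g d" and g1: "\<psi> g \<noteq> 1"
    using dirichlet_character_nonzero_iff[of g] by (auto simp: principal_character_def split: if_splits)
  have inj: "inj_on (\<lambda>r. (g * r) mod d) S"
  proof (rule inj_onI)
    fix r s assume rs: "r \<in> S" "s \<in> S" and eq: "(g * r) mod d = (g * s) mod d"
    then have "d dvd g * (r - s)" by (simp add: mod_eq_dvd_iff right_diff_distrib)
    with cop modulus_nonzero have dvd: "d dvd r - s" by (rule coprime_dvd_mult_poly)
    have "degree (r - s) < degree d" using rs by (auto simp: S_def intro: degree_diff_less)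
    then have "r - s = 0" using dvd_imp_degree_le[OF dvd] by (meson not_le)
    then show "r = s" by simp
  qed
  have sub: "(\<lambda>r. (g * r) mod d) ` S \<subseteq> S"
  proof safe
    fix r
    show "(g * r) mod d \<in> S" using degree_mod_less[OF d0, of "g * r"] dpos by (auto simp: S_def)
  qed
  have "(\<Sum>r\<in>S. \<psi> r) = (\<Sum>r\<in>(\<lambda>r. (g * r) mod d) ` S. \<psi> r)"
    using endo_inj_surj[OF fin sub inj] by simp
  also have "\<dots> = (\<Sum>r\<in>S. \<psi> ((g * r) mod d))" by (simp add: sum.reindex[OF inj])
  also have "\<dots> = (\<Sum>r\<in>S. \<psi> g * \<psi> r)"
  proof (rule sum.cong[OF refl])
    fix r
    have "\<psi> ((g * r) mod d) = \<psi> (g * r)" by (rule dirichlet_character_cong) simp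
    then show "\<psi> ((g * r) mod d) = \<psi> g * \<psi> r" by (simp add: dirichlet_character_mult)
  qed
  also have "\<dots> = \<psi> g * (\<Sum>r\<in>S. \<psi> r)" by (simp add: sum_distrib_left)
  finally have "(1 - \<psi> g) * (\<Sum>r\<in>S. \<psi> r) = 0" by (simp add: algebra_simps)
  then show ?thesis using g1 by (simp add: S_def)
qed

text \<open>Grouped by their quotient modulo \<open>d\<close>, the monic polynomials of degree n >=
  degree d fall into complete residue systems. Hence the L-series is a polynomial.\<close>

lemma monic_sum_eq_0:
  assumes np: "\<psi> \<noteq> principal_character d" and n: "n \<ge> degree d"
  shows "monic_sum \<psi> n = 0"
proof -
  note d0 = modulus_nonzero
  note dpos = nonprincipal_degree_pos[OF np]
  have "monic_sum \<psi> n = (\<Sum>h\<in>(\<lambda>f. f div d) ` monic_polys n. \<Sum>f | f \<in> monic_polys n \<and> f div d = h. \<psi> f)"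
    unfolding monic_sum_def by (rule sum.image_gen) simp
  also have "\<dots> = 0"
  proof (rule sum.neutral, safe)
    fix f0 :: "'a poly" assume f0: "f0 \<in> monic_polys n"
    define h where "h = f0 div d"
    have "{f \<in> monic_polys n. f div d = h} = (\<lambda>r. h * d + r) ` {r. degree r < degree d}"
    proof (intro equalityI subsetI)
      fix f assume f: "f \<in> {f \<in> monic_polys n. f div d = h}"
      have "f = h * d + f mod d" using f div_mult_mod_eq[of f d] by simp
      moreover have "degree (f mod d) < degree d" using degree_mod_less[OF d0, of f] dpos by auto
      ultimately show "f \<in> (\<lambda>r. h * d + r) ` {r. degree r < degree d}" by blast
    next
      fix f assume "f \<in> (\<lambda>r. h * d + r) ` {r. degree r < degree d}"
      then obtain r where r: "degree r < degree d" "f = h * d + r" by auto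
      define s where "s = r - f0 mod d"
      have "degree (f0 mod d) < degree d" using degree_mod_less[OF d0, of f0] dpos by auto
      then have s: "degree s < n" using r n unfolding s_def by (meson degree_diff_less less_le_trans)
      have "f = s + f0" unfolding r s_def h_def using div_mult_mod_eq[of f0 d] by (simp add: algebra_simps)
      then have "f \<in> monic_polys n"
        using s f0 by (auto simp: monic_polys_def degree_add_eq_right coeff_eq_0)
      moreover have "f div d = h" using r d0 by (simp add: div_poly_less)
      ultimately show "f \<in> {f \<in> monic_polys n. f div d = h}" by simp
    qed
    then have "(\<Sum>f | f \<in> monic_polys n \<and> f div d = h. \<psi> f) = (\<Sum>r | degree r < degree d. \<psi> (h * d + r))"
      by (simp add: sum.reindex inj_on_def)
    also have "\<dots> = (\<Sum>r | degree r < degree d. \<psi> r)"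
    proof (rule sum.cong[OF refl])
      fix r
      show "\<psi> (h * d + r) = \<psi> r" by (rule dirichlet_character_cong) simp
    qed
    also have "\<dots> = 0" by (rule sum_residues_eq_0[OF np])
    finally show "(\<Sum>f | f \<in> monic_polys n \<and> f div d = f0 div d. \<psi> f) = 0" by (simp add: h_def)
  qed
  finally show ?thesis .
qed

end

section \<open>Reciprocal roots of a polynomial L-series\<close>

lemma complex_poly_factor_linear:
  fixes P :: "complex poly"
  assumes "coeff P 0 = 1"
  shows "\<exists>xs. P = (\<Prod>\<rho>\<leftarrow>xs. [:1, -\<rho>:])"
  using assms
proof (induction "degree P" arbitrary: P)
  case 0
  obtain a where "P = [:a:]" using 0(1) degree_eq_zeroE[of P] by metis
  with 0(2) have "P = 1" by (simp add: one_pCons)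
  then show ?case by (intro exI[of _ "[]"]) simp
next
  case (Suc n)
  then have "\<not> constant (poly P)" by (simp add: constant_degree)
  then obtain r where r: "poly P r = 0" using Fundamental_Theorem_Algebra.fundamental_theorem_of_algebra[of P] by auto
  have r0: "r \<noteq> 0" using r Suc.prems by (metis poly_0_coeff_0 zero_neq_one)
  from r have "[:-r, 1:] dvd P" by (simp only: poly_eq_0_iff_dvd)
  then obtain Q where Q: "P = [:-r, 1:] * Q" by (rule dvdE)
  define Q' where "Q' = smult (-r) Q"
  have P: "P = [:1, - (1/r):] * Q'"
  proof -
    have "[:-r, 1:] = smult (-r) [:1, - (1/r):]" using r0 by simp
    then show ?thesis unfolding Q Q'_def by (simp only: mult_smult_left mult_smult_right)
  qed
  have "coeff Q' 0 = 1" using Suc.prems unfolding P by (simp add: coeff_mult)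
  moreover have "Q' \<noteq> 0" using Suc.prems P by auto
  then have "degree P = degree [:1, - (1/r):] + degree Q'" unfolding P using r0 by (subst degree_mult_eq) auto
  then have "n = degree Q'" using Suc.hyps(2) r0 by simp
  ultimately obtain xs where "Q' = (\<Prod>\<rho>\<leftarrow>xs. [:1, -\<rho>:])" using Suc.hyps(1) by blast
  then show ?case by (intro exI[of _ "(1/r) # xs"]) (simp add: P)
qed

lemma exp_fps_sum_list:
  "exp_fps (\<lambda>j. - (\<Sum>\<rho>\<leftarrow>xs. \<rho> ^ j)) = fps_of_poly (\<Prod>\<rho>\<leftarrow>xs. [:1, -\<rho>:])"
proof (induction xs)
  case Nil
  then show ?case by (simp add: exp_fps_0)
next
  case (Cons a xs)
  have "exp_fps (\<lambda>j. - (\<Sum>\<rho>\<leftarrow>a # xs. \<rho> ^ j)) = exp_fps (\<lambda>j. - (a ^ j) + - (\<Sum>\<rho>\<leftarrow>xs. \<rho> ^ j))"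
    by (rule arg_cong[of _ _ exp_fps]) auto
  then show ?case by (simp only: exp_fps_add Cons exp_fps_linear list.map prod_list.Cons fps_of_poly_mult)
qed

lemma exp_fps_determines: "exp_fps l = exp_fps l' \<Longrightarrow> j \<ge> 1 \<Longrightarrow> l j = l' j"
  by (rule exp_coeff_determines) (metis exp_fps_nth)+

lemma norm_le_of_power_bound:
  fixes x y C :: real
  assumes "x \<ge> 0" "y > 0" "\<And>n. x ^ n \<le> C * y ^ n"
  shows "x \<le> y"
proof (rule ccontr)
  assume "\<not> ?thesis"
  then have "x / y > 1" using assms by simp
  then obtain n where "C < (x / y) ^ n" using real_arch_pow by blast
  then show False using assms(3)[of n] assms(2) by (simp add: power_divide field_simps)
qed

lemma exp_coeff_nonneg:
  fixes l :: "nat \<Rightarrow> real"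
  assumes "\<And>j. j \<ge> 1 \<Longrightarrow> l j \<ge> 0"
  shows "exp_coeff l n \<ge> 0"
  using norm_exp_coeff_le[of l l n] assms norm_ge_zero[of "exp_coeff l n"] by (force simp del: norm_ge_zero)

lemma exp_coeff_of_real: "exp_coeff (\<lambda>j. of_real (c j)) n = (of_real (exp_coeff c n) :: complex)"
proof (rule exp_coeff_unique[symmetric])
  fix n
  have "complex_of_real (real n * exp_coeff c n) = of_real (\<Sum>j=1..n. c j * exp_coeff c (n - j))"
    by (simp only: exp_coeff_rec of_nat_id flip: exp_coeff_rec)
  then show "of_nat n * complex_of_real (exp_coeff c n) =
    (\<Sum>j=1..n. complex_of_real (c j) * complex_of_real (exp_coeff c (n - j)))" by simp
qed simp

text \<open>Let D be the index of the last nonzero coefficient. The coefficient at D + j vanishes,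
  yet its recurrence is a sum of nonnegative terms, one of which is c j times the positive
  coefficient at D.\<close>

lemma exp_coeff_eventually_0_imp:
  fixes c :: "nat \<Rightarrow> real"
  assumes nonneg: "\<And>j. j \<ge> 1 \<Longrightarrow> c j \<ge> 0" and ev: "\<And>n. n > N \<Longrightarrow> exp_coeff c n = 0" and j: "j \<ge> 1"
  shows "c j = 0"
proof -
  define D where "D = Max {n. exp_coeff c n \<noteq> 0}"
  have fin: "finite {n. exp_coeff c n \<noteq> 0}"
    by (rule finite_subset[of _ "{..N}"]) (use ev in \<open>auto simp: not_less[symmetric]\<close>)
  have ne: "{n. exp_coeff c n \<noteq> 0} \<noteq> {}" by (auto intro: exI[of _ 0])
  have D: "exp_coeff c D \<noteq> 0" using Max_in[OF fin ne] by (simp add: D_def)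
  then have Dpos: "exp_coeff c D > 0" using exp_coeff_nonneg[of c D, OF nonneg] by simp
  have "exp_coeff c (D + j) = 0"
    using Max_ge[OF fin, of "D + j"] j unfolding D_def[symmetric] by fastforce
  then have "0 = (\<Sum>i=1..D + j. c i * exp_coeff c (D + j - i))"
    by (metis exp_coeff_rec mult_zero_right)
  also have "\<dots> \<ge> c j * exp_coeff c (D + j - j)"
    by (rule member_le_sum) (use j nonneg exp_coeff_nonneg[of c] in auto)
  finally have "c j * exp_coeff c D \<le> 0" by simp
  then have "c j \<le> 0" using Dpos by (simp add: mult_le_0_iff)
  with nonneg[OF j] show ?thesis by simp
qed

text \<open>Write L = (1 - \<open>\<rho>0\<close> u) P. The geometric series 1 / (1 -
  \<open>\<rho>0\<close> u) is then P / L, and 1 / L is majorised by 1 / (1 - q u); so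
  \<open>\<rho>0 ^ n\<close> is O(q^n).\<close>

lemma reciprocal_root_norm_le:
  fixes \<psi> :: "'a::{field,finite} poly \<Rightarrow> complex"
  assumes \<psi>: "\<And>f. norm (\<psi> f) \<le> 1"
    and xs: "\<And>j. j \<ge> 1 \<Longrightarrow> mangoldt_sum \<psi> j = - (\<Sum>\<rho>\<leftarrow>\<rho>0 # ys. \<rho> ^ j)"
  shows "norm \<rho>0 \<le> real CARD('a)"
proof -
  define q where "q = real CARD('a)"
  have q: "q \<ge> 2" unfolding q_def using card_field_ge_2[where 'a='a] by simp
  define P where "P = (\<Prod>\<rho>\<leftarrow>ys. [:1, -\<rho>:])"
  have eq: "\<rho>0 ^ n = fps_nth (exp_fps (\<lambda>j. - mangoldt_sum \<psi> j) * fps_of_poly P) n" for n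
  proof -
    have "\<rho>0 ^ n = exp_coeff (\<lambda>j. - mangoldt_sum \<psi> j + - (\<Sum>\<rho>\<leftarrow>ys. \<rho> ^ j)) n"
      by (rule trans[OF exp_coeff_power[symmetric]], rule exp_coeff_cong) (use xs in simp)
    also have "\<dots> = fps_nth (exp_fps (\<lambda>j. - mangoldt_sum \<psi> j + - (\<Sum>\<rho>\<leftarrow>ys. \<rho> ^ j))) n" by simp
    finally show ?thesis by (simp only: exp_fps_add exp_fps_sum_list P_def)
  qed
  have G: "norm (exp_coeff (\<lambda>j. - mangoldt_sum \<psi> j) n) \<le> q ^ n" for n
  proof -
    have "norm (exp_coeff (\<lambda>j. - mangoldt_sum \<psi> j) n) \<le> exp_coeff (\<lambda>j. q ^ j) n"
      by (rule norm_exp_coeff_le) (simp add: q_def norm_mangoldt_sum_le \<psi>)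
    then show ?thesis by (simp add: exp_coeff_power)
  qed
  have "norm \<rho>0 ^ n \<le> (\<Sum>i\<le>degree P. norm (coeff P i)) * q ^ n" for n
  proof -
    have "norm \<rho>0 ^ n = norm (\<Sum>i=0..n. coeff P i * exp_coeff (\<lambda>j. - mangoldt_sum \<psi> j) (n - i))"
      by (subst norm_power[symmetric], subst eq, subst mult.commute) (simp add: fps_mult_nth)
    also have "\<dots> \<le> (\<Sum>i=0..n. norm (exp_coeff (\<lambda>j. - mangoldt_sum \<psi> j) (n - i)) * norm (coeff P i))"
      by (rule order.trans[OF norm_sum]) (simp add: norm_mult mult.commute)
    also have "\<dots> \<le> (\<Sum>i=0..n. q ^ n * norm (coeff P i))"
    proof (intro sum_mono mult_right_mono norm_ge_zero)
      fix i assume "i \<in> {0..n}"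
      have "norm (exp_coeff (\<lambda>j. - mangoldt_sum \<psi> j) (n - i)) \<le> q ^ (n - i)" by (rule G)
      also have "\<dots> \<le> q ^ n" using q by (intro power_increasing) auto
      finally show "norm (exp_coeff (\<lambda>j. - mangoldt_sum \<psi> j) (n - i)) \<le> q ^ n" .
    qed
    also have "\<dots> \<le> (\<Sum>i\<in>{0..n} \<union> {..degree P}. q ^ n * norm (coeff P i))"
      using q by (intro sum_mono2) auto
    also have "\<dots> = (\<Sum>i\<le>degree P. q ^ n * norm (coeff P i))"
      by (rule sum.mono_neutral_right) (auto intro: coeff_eq_0)
    finally show ?thesis by (simp add: sum_distrib_left mult.commute)
  qed
  from norm_le_of_power_bound[OF _ _ this] show ?thesis using q by (simp add: q_def)
qed

lemma X_monic_irreducible: "[:0, 1:] \<in> monic_irreducibles 1"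
  by (simp add: monic_irreducibles_def monic_polys_def irreducible_linear_field_poly)

text \<open>If \<open>\<rho>0 = q / w\<close> with \<open>w\<close> unimodular, then \<open>L(w u, \<psi>)\<close> and its complex conjugate both cancel a pole
  of \<open>(1 - q u) powr (-2)\<close>.  The product of the three is a polynomial whose logarithmic derivative has
  nonnegative coefficients \<open>c j\<close>; its positive top coefficient forces all of them to vanish, which
  the prime \<open>X\<close> contradicts in degree 1 or 2.\<close>

lemma reciprocal_root_norm_neq:
  fixes \<psi> :: "'a::{field,finite} poly \<Rightarrow> complex"
  assumes \<psi>: "\<And>f. norm (\<psi> f) \<le> 1"
    and xs: "\<And>j. j \<ge> 1 \<Longrightarrow> mangoldt_sum \<psi> j = - (\<Sum>\<rho>\<leftarrow>\<rho>0 # ys. \<rho> ^ j)"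
  shows "norm \<rho>0 \<noteq> real CARD('a)"
proof
  assume norm: "norm \<rho>0 = real CARD('a)"
  define q where "q = real CARD('a)"
  have q: "q \<ge> 2" unfolding q_def using card_field_ge_2[where 'a='a] by simp
  \<comment> \<open>Rotating u by this unimodular number moves the root to the positive axis:
    \<open>\<rho>0 * w\<close> is q.\<close>
  define w where "w = cnj \<rho>0 / of_real q"
  have w: "norm w = 1" using norm q by (simp add: w_def norm_divide flip: q_def)
  have \<rho>w: "\<rho>0 * w = of_real q"
    using norm q by (simp add: w_def complex_norm_square[symmetric] power2_eq_square flip: q_def)
  define c where "c = (\<lambda>j. 2 * q ^ j + 2 * Re (w ^ j * mangoldt_sum \<psi> j))"
  define D where "D = (\<lambda>j :: nat. {m. m \<in> {1..j} \<and> m dvd j})"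
  \<comment> \<open>The term 2 q^j is spread over the same prime powers as the other term, by the
    exact count of irreducibles. Each prime then contributes 2 + 2 Re of a number in the unit
    disc.\<close>
  have c_eq: "c j = (\<Sum>m\<in>D j. real m * (\<Sum>p\<in>(monic_irreducibles m :: 'a poly set).
      2 + 2 * Re (w ^ j * \<psi> p ^ (j div m))))" if j: "j \<ge> 1" for j
  proof -
    have "c j = 2 * (\<Sum>m\<in>D j. real m * card (monic_irreducibles m :: 'a poly set)) +
       2 * Re (\<Sum>m\<in>D j. of_nat m * (\<Sum>p\<in>monic_irreducibles m. w ^ j * \<psi> p ^ (j div m)))"
      unfolding c_def q_def sum_monic_irreducibles_le[OF j, symmetric] mangoldt_sum_def D_def
      by (simp add: sum_distrib_left mult.left_commute)
    also have "\<dots> = (\<Sum>m\<in>D j. 2 * (real m * card (monic_irreducibles m :: 'a poly set)) +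
       2 * (real m * (\<Sum>p\<in>monic_irreducibles m. Re (w ^ j * \<psi> p ^ (j div m)))))"
      by (simp add: sum.distrib sum_distrib_left)
    also have "\<dots> = (\<Sum>m\<in>D j. real m * (\<Sum>p\<in>(monic_irreducibles m :: 'a poly set).
      2 + 2 * Re (w ^ j * \<psi> p ^ (j div m))))"
    proof (rule sum.cong[OF refl])
      fix m
      have *: "(\<Sum>p\<in>A. 2 + 2 * R p) = 2 * real (card A) + 2 * (\<Sum>p\<in>A. R p)"
        for A :: "'a poly set" and R by (simp add: sum.distrib sum_distrib_left)
      show "2 * (real m * card (monic_irreducibles m :: 'a poly set)) +
          2 * (real m * (\<Sum>p\<in>monic_irreducibles m. Re (w ^ j * \<psi> p ^ (j div m)))) =
        real m * (\<Sum>p\<in>(monic_irreducibles m :: 'a poly set). 2 + 2 * Re (w ^ j * \<psi> p ^ (j div m)))"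
        unfolding * by (simp only: distrib_left mult.left_commute)
    qed
    finally show ?thesis .
  qed
  have term_nonneg: "2 + 2 * Re (w ^ j * \<psi> p ^ i) \<ge> 0" for j i p
  proof -
    have "norm (w ^ j * \<psi> p ^ i) \<le> 1" using w \<psi> by (simp add: norm_mult norm_power power_le_one)
    then show ?thesis using abs_Re_le_cmod[of "w ^ j * \<psi> p ^ i"] by linarith
  qed
  have c_nonneg: "c j \<ge> 0" if "j \<ge> 1" for j
    unfolding c_eq[OF that] by (intro sum_nonneg mult_nonneg_nonneg term_nonneg) auto
  have c_ge: "c j \<ge> 2 + 2 * Re ((w * \<psi> [:0, 1:]) ^ j)" if j: "j \<ge> 1" for j
  proof -
    have "2 + 2 * Re (w ^ j * \<psi> [:0, 1:] ^ (j div 1)) \<le>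
        (\<Sum>p\<in>(monic_irreducibles 1 :: 'a poly set). 2 + 2 * Re (w ^ j * \<psi> p ^ (j div 1)))"
      by (rule member_le_sum) (use X_monic_irreducible term_nonneg in auto)
    also have "\<dots> = real 1 * (\<Sum>p\<in>(monic_irreducibles 1 :: 'a poly set). 2 + 2 * Re (w ^ j * \<psi> p ^ (j div 1)))"
      by simp
    also have "\<dots> \<le> c j" unfolding c_eq[OF j]
      by (rule member_le_sum; (intro sum_nonneg mult_nonneg_nonneg term_nonneg)?) (use j in \<open>auto simp: D_def\<close>)
    finally show ?thesis by (simp add: power_mult_distrib)
  qed
  \<comment> \<open>What remains of the two polynomials after each has lost a factor 1 - q
    u.\<close>
  define zs where "zs = map (\<lambda>\<rho>. w * \<rho>) ys @ map (\<lambda>\<rho>. cnj (w * \<rho>)) ys"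
  have sum_w: "(\<Sum>\<rho>\<leftarrow>map (\<lambda>\<rho>. w * \<rho>) us. \<rho> ^ j) = w ^ j * (\<Sum>\<rho>\<leftarrow>us. \<rho> ^ j)" for us j
    by (induction us) (auto simp: power_mult_distrib algebra_simps)
  have sum_cnj: "(\<Sum>\<rho>\<leftarrow>map cnj us. \<rho> ^ j) = cnj (\<Sum>\<rho>\<leftarrow>us. \<rho> ^ j)" for us j
    by (induction us) auto
  have c_zs: "complex_of_real (c j) = - (\<Sum>\<rho>\<leftarrow>zs. \<rho> ^ j)" if j: "j \<ge> 1" for j
  proof -
    define T where "T = w ^ j * (\<Sum>\<rho>\<leftarrow>ys. \<rho> ^ j)"
    have "(\<Sum>\<rho>\<leftarrow>zs. \<rho> ^ j) = T + cnj T"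
    proof -
      have "map (\<lambda>\<rho>. cnj (w * \<rho>)) ys = map cnj (map (\<lambda>\<rho>. w * \<rho>) ys)" by simp
      then show ?thesis unfolding zs_def by (simp only: map_append sum_list_append sum_cnj sum_w T_def)
    qed
    also have "\<dots> = of_real (2 * Re T)" by (rule complex_add_cnj)
    finally have 1: "(\<Sum>\<rho>\<leftarrow>zs. \<rho> ^ j) = of_real (2 * Re T)" .
    have "w ^ j * mangoldt_sum \<psi> j = - (of_real q ^ j) - T"
      unfolding xs[OF j] T_def using \<rho>w by (simp add: algebra_simps flip: power_mult_distrib)
    then have "Re (w ^ j * mangoldt_sum \<psi> j) = - (q ^ j) - Re T" by (simp flip: of_real_power)
    then have "c j = - (2 * Re T)" by (simp add: c_def)
    then show ?thesis unfolding 1 by simp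
  qed
  have "exp_coeff c n = 0" if "n > degree (\<Prod>\<rho>\<leftarrow>zs. [:1, -\<rho>:])" for n
  proof -
    have "complex_of_real (exp_coeff c n) = exp_coeff (\<lambda>j. - (\<Sum>\<rho>\<leftarrow>zs. \<rho> ^ j)) n"
      unfolding exp_coeff_of_real[symmetric] by (rule exp_coeff_cong) (rule c_zs)
    also have "\<dots> = fps_nth (exp_fps (\<lambda>j. - (\<Sum>\<rho>\<leftarrow>zs. \<rho> ^ j))) n" by simp
    also have "\<dots> = coeff (\<Prod>\<rho>\<leftarrow>zs. [:1, -\<rho>:]) n" unfolding exp_fps_sum_list by simp
    also have "\<dots> = 0" using that by (rule coeff_eq_0)
    finally show ?thesis by simp
  qed
  then have c0: "c j = 0" if "j \<ge> 1" for j
    using exp_coeff_eventually_0_imp[of c] c_nonneg that by blast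
  define s where "s = w * \<psi> [:0, 1:]"
  have "norm s \<le> 1" using w \<psi> by (simp add: s_def norm_mult)
  \<comment> \<open>Together with modulus at most 1 this leaves only s = -1, so s^2 is near 1 and
    not near -1, as \<open>c 2\<close> = 0 would demand.\<close>
  have "Re s \<le> -1" using c_ge[of 1] c0[of 1] by (simp add: s_def)
  moreover have "norm s ^ 2 \<le> 1" using \<open>norm s \<le> 1\<close> by (simp add: power_le_one)
  moreover have "(Re s)\<^sup>2 \<ge> 1" using \<open>Re s \<le> -1\<close> by (smt (verit) one_le_power power2_minus)
  ultimately have "Re s ^ 2 - Im s ^ 2 > -1" by (simp add: cmod_power2)
  then have "Re (s ^ 2) > -1" by (simp add: power2_eq_square)
  then show False using c_ge[of 2] c0[of 2] by (simp add: s_def)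
qed

text \<open>The coefficients are minus the power sums of finitely many reciprocal roots, each of
  modulus strictly below q; finiteness makes the gap uniform.\<close>

lemma nonprincipal_mangoldt_sum_bound:
  fixes d :: "'a::{field,finite} poly"
  assumes \<psi>: "dirichlet_character d \<psi>" and np: "\<psi> \<noteq> principal_character d"
  shows "\<exists>C \<sigma>. C \<ge> 0 \<and> 1 \<le> \<sigma> \<and> \<sigma> < real CARD('a) \<and> (\<forall>j\<ge>1. norm (mangoldt_sum \<psi> j) \<le> C * \<sigma> ^ j)"
proof -
  note cm = dirichlet_character_completely_multiplicative[OF \<psi>]
  note le1 = norm_dirichlet_character_le[OF \<psi>]
  define P where "P = Poly (map (monic_sum \<psi>) [0..<degree d])"
  have P: "exp_fps (mangoldt_sum \<psi>) = fps_of_poly P"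
    by (rule fps_ext) (auto simp: P_def nth_default_def monic_sum_eq_exp_coeff[OF cm, symmetric]
        monic_sum_eq_0[OF \<psi> np] not_less)
  then have "coeff P 0 = 1" by (metis exp_coeff_0 exp_fps_nth fps_of_poly_nth)
  then obtain xs where xs: "P = (\<Prod>\<rho>\<leftarrow>xs. [:1, -\<rho>:])" using complex_poly_factor_linear by blast
  have eq: "mangoldt_sum \<psi> j = - (\<Sum>\<rho>\<leftarrow>xs. \<rho> ^ j)" if "j \<ge> 1" for j
    by (rule exp_fps_determines[OF _ that]) (simp only: exp_fps_sum_list P xs)
  have lt: "norm \<rho> < real CARD('a)" if \<rho>: "\<rho> \<in> set xs" for \<rho>
  proof -
    have "mangoldt_sum \<psi> j = - (\<Sum>\<rho>\<leftarrow>\<rho> # remove1 \<rho> xs. \<rho> ^ j)" if "j \<ge> 1" for j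
      unfolding eq[OF that] using \<rho> by (simp add: sum_list_map_remove1)
    from reciprocal_root_norm_le[OF le1 this] reciprocal_root_norm_neq[OF le1 this]
    show ?thesis by fastforce
  qed
  \<comment> \<open>The 1 keeps the maximum meaningful when there are no roots and gives
    \<open>\<sigma>\<close> >= 1.\<close>
  define \<sigma> where "\<sigma> = Max (insert 1 (norm ` set xs))"
  have \<sigma>: "1 \<le> \<sigma>" "\<sigma> < real CARD('a)" "\<And>\<rho>. \<rho> \<in> set xs \<Longrightarrow> norm \<rho> \<le> \<sigma>"
    using lt card_field_ge_2[where 'a='a] by (auto simp: \<sigma>_def)
  have "norm (mangoldt_sum \<psi> j) \<le> real (length xs) * \<sigma> ^ j" if "j \<ge> 1" for j
  proof -
    have "norm (\<Sum>\<rho>\<leftarrow>us. \<rho> ^ j) \<le> real (length us) * \<sigma> ^ j" if "set us \<subseteq> set xs" for us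
      using that
    proof (induction us)
      case (Cons a us)
      have "norm (a ^ j) \<le> \<sigma> ^ j" using Cons.prems \<sigma>(3) by (simp add: norm_power power_mono)
      then show ?case using Cons norm_triangle_ineq[of "a ^ j" "\<Sum>\<rho>\<leftarrow>us. \<rho> ^ j"] by (simp add: algebra_simps)
    qed simp
    then show ?thesis unfolding eq[OF that] by simp
  qed
  then show ?thesis using \<sigma> by (intro exI[of _ "real (length xs)"] exI[of _ \<sigma>]) auto
qed

section \<open>Twisting by the number of prime factors\<close>

text \<open>Bernoulli's inequality for (s / t)^n. It serves to absorb a number of divisors into a
  slightly larger base.\<close>

lemma of_nat_mult_power_le:
  fixes t s :: real
  assumes "0 < t" "t < s"
  shows "real n * t ^ n \<le> t / (s - t) * s ^ n"
proof -
  have "1 + real n * (s / t - 1) \<le> (1 + (s / t - 1)) ^ n"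
    by (rule Bernoulli_inequality) (use assms in auto)
  then have "real n * (s / t - 1) \<le> (s / t) ^ n" by simp
  then have "real n * (s / t - 1) * t ^ n \<le> (s / t) ^ n * t ^ n"
    using assms by (intro mult_right_mono) auto
  then have "real n * t ^ n * ((s - t) / t) \<le> s ^ n"
    using assms by (simp add: power_divide field_simps)
  then show ?thesis using assms by (simp add: field_simps)
qed

lemma completely_multiplicative_twist:
  fixes chi :: "'a::{field,finite} poly \<Rightarrow> complex"
  assumes "completely_multiplicative chi"
  shows "completely_multiplicative (\<lambda>f. chi f * z ^ big_omega f)"
  using assms unfolding completely_multiplicative_def big_omega_eq_prime_weight_sum
  by (auto simp: prime_weight_sum_mult power_add)

text \<open>The part of the coefficient at u^(i m) that comes from the i-th powers of primes of
  degree m. Keeping i and m apart is what allows a weight z^i.\<close>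

definition prime_power_sum :: "('a::{field,finite} poly \<Rightarrow> complex) \<Rightarrow> nat \<Rightarrow> nat \<Rightarrow> complex" where
  "prime_power_sum chi i m = of_nat m * (\<Sum>p\<in>monic_irreducibles m. chi p ^ i)"

lemma mangoldt_sum_eq_prime_power_sum:
  "mangoldt_sum chi j = (\<Sum>m | m \<in> {1..j} \<and> m dvd j. prime_power_sum chi (j div m) m)"
  by (simp add: mangoldt_sum_def prime_power_sum_def)

lemma mangoldt_sum_twist:
  "mangoldt_sum (\<lambda>f :: 'a::{field,finite} poly. chi f * z ^ big_omega f) j =
     (\<Sum>m | m \<in> {1..j} \<and> m dvd j. z ^ (j div m) * prime_power_sum chi (j div m) m)"
proof -
  have "big_omega p = 1" if "p \<in> monic_irreducibles m" for p :: "'a poly" and m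
  proof -
    have "lead_coeff p = 1" "irreducible p"
      using that by (auto simp: monic_irreducibles_def monic_polys_def)
    then show ?thesis
      using prime_weight_sum_irreducible[of p "\<lambda>_. 1"] by (simp add: big_omega_eq_prime_weight_sum)
  qed
  then show ?thesis
    unfolding mangoldt_sum_def prime_power_sum_def
    by (intro sum.cong refl) (simp add: power_mult_distrib sum_distrib_left mult_ac)
qed

lemma norm_prime_power_sum_le:
  fixes chi :: "'a::{field,finite} poly \<Rightarrow> complex"
  assumes "\<And>f. norm (chi f) \<le> 1" "m \<ge> 1"
  shows "norm (prime_power_sum chi i m) \<le> real CARD('a) ^ m"
proof -
  have "norm (\<Sum>p\<in>monic_irreducibles m. chi p ^ i) \<le>
      of_nat (card (monic_irreducibles m :: 'a poly set)) * 1"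
    by (rule sum_norm_bound) (simp add: norm_power power_le_one assms)
  then have "norm (prime_power_sum chi i m) \<le> real m * card (monic_irreducibles m :: 'a poly set)"
    by (simp add: prime_power_sum_def norm_mult mult_left_mono)
  also have "\<dots> \<le> real CARD('a) ^ m" by (rule card_monic_irreducibles_le[OF assms(2)])
  finally show ?thesis .
qed

lemma dirichlet_character_square:
  fixes d :: "'a::{field,finite} poly"
  assumes "dirichlet_character d chi"
  shows "dirichlet_character d (\<lambda>f. chi f ^ 2)"
  unfolding dirichlet_character_def
proof (intro conjI allI impI)
  show "chi f ^ 2 = chi g ^ 2" if "f mod d = g mod d" for f g :: "'a poly"
    using dirichlet_character_cong[OF assms that] by simp
qed (auto simp: modulus_nonzero[OF assms] dirichlet_character_mult[OF assms] power_mult_distrib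
      dirichlet_character_nonzero_iff[OF assms])

text \<open>In \<open>mangoldt_sum\<close> for chi^2, degree m, the primes of degree m contribute
  exactly this sum. The rest comes from primes of degree k <= m / 2, at most q^(m/2) for each
  k.\<close>

lemma prime_power_sum_2_bound:
  fixes d :: "'a::{field,finite} poly"
  assumes chi: "dirichlet_character d chi" and np: "(\<lambda>f. chi f ^ 2) \<noteq> principal_character d"
  shows "\<exists>C s. C \<ge> 0 \<and> 1 \<le> s \<and> s < real CARD('a) \<and> (\<forall>m\<ge>1. norm (prime_power_sum chi 2 m) \<le> C * s ^ m)"
proof -
  define q where "q = real CARD('a)"
  have q: "q \<ge> 2" unfolding q_def using card_field_ge_2[where 'a='a] by simp
  obtain C \<sigma> where C: "C \<ge> 0" "1 \<le> \<sigma>" "\<sigma> < q"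
    and bound: "\<And>j. j \<ge> 1 \<Longrightarrow> norm (mangoldt_sum (\<lambda>f. chi f ^ 2) j) \<le> C * \<sigma> ^ j"
    using nonprincipal_mangoldt_sum_bound[OF dirichlet_character_square[OF chi] np]
    unfolding q_def by blast
  \<comment> \<open>Dominates both the bound for chi^2 and the sqrt q from the proper prime powers,
    while still below q.\<close>
  define t where "t = max \<sigma> (sqrt q)"
  have sq: "sqrt q < q" using q by (simp add: real_less_lsqrt power2_eq_square)
  have t: "1 \<le> t" "t < q" "\<sigma> \<le> t" "sqrt q \<le> t" using C sq by (auto simp: t_def)
  define s where "s = (t + q) / 2"
  have s: "t < s" "s < q" using t by (auto simp: s_def)
  have "norm (prime_power_sum chi 2 m) \<le> (C + t / (s - t)) * s ^ m" if m: "m \<ge> 1" for m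
  proof -
    let ?D = "{k. k \<in> {1..m} \<and> k dvd m}"
    have "mangoldt_sum (\<lambda>f. chi f ^ 2) m = (\<Sum>k\<in>?D. prime_power_sum chi (2 * (m div k)) k)"
      unfolding mangoldt_sum_eq_prime_power_sum by (simp add: prime_power_sum_def power_mult)
    also have "\<dots> = prime_power_sum chi 2 m + (\<Sum>k\<in>?D - {m}. prime_power_sum chi (2 * (m div k)) k)"
      using m by (subst sum.remove[of _ m]) auto
    finally have "prime_power_sum chi 2 m = mangoldt_sum (\<lambda>f. chi f ^ 2) m -
       (\<Sum>k\<in>?D - {m}. prime_power_sum chi (2 * (m div k)) k)" by simp
    then have "norm (prime_power_sum chi 2 m) \<le> norm (mangoldt_sum (\<lambda>f. chi f ^ 2) m) +
       norm (\<Sum>k\<in>?D - {m}. prime_power_sum chi (2 * (m div k)) k)"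
      by (simp add: norm_triangle_ineq4)
    also have "norm (\<Sum>k\<in>?D - {m}. prime_power_sum chi (2 * (m div k)) k) \<le>
       real (card (?D - {m})) * t ^ m"
    proof (rule sum_norm_bound)
      fix k assume k: "k \<in> ?D - {m}"
      then obtain i where i: "m = k * i" by auto
      have "i \<noteq> 0" "i \<noteq> 1" using k i by auto
      then have "2 \<le> i" by simp
      then have k2: "k * 2 \<le> m" unfolding i by (rule mult_le_mono2)
      have "norm (prime_power_sum chi (2 * (m div k)) k) \<le> q ^ k"
        unfolding q_def by (rule norm_prime_power_sum_le[OF norm_dirichlet_character_le[OF chi]]) (use k in auto)
      also have "q ^ k = sqrt q ^ (k * 2)" using q by (simp add: power_mult mult.commute[of k])
      also have "\<dots> \<le> sqrt q ^ m" using q k2 by (intro power_increasing) auto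
      also have "\<dots> \<le> t ^ m" using t q by (intro power_mono) auto
      finally show "norm (prime_power_sum chi (2 * (m div k)) k) \<le> t ^ m" .
    qed
    also have "real (card (?D - {m})) * t ^ m \<le> real m * t ^ m"
    proof -
      have "card (?D - {m}) \<le> card {1..m}" by (rule card_mono) auto
      then show ?thesis using t by (intro mult_right_mono) auto
    qed
    also have "real m * t ^ m \<le> t / (s - t) * s ^ m" by (rule of_nat_mult_power_le) (use t s in auto)
    also have "norm (mangoldt_sum (\<lambda>f. chi f ^ 2) m) \<le> C * s ^ m"
      by (rule order.trans[OF bound[OF m]]) (use C t s in \<open>auto intro!: mult_left_mono power_mono\<close>)
    finally show ?thesis by (simp add: algebra_simps)
  qed
  then show ?thesis using C t s q
    by (intro exI[of _ "C + t / (s - t)"] exI[of _ s]) (auto simp flip: q_def)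
qed

text \<open>Compares R^i q^m with one factor q times (q powr (1/2 - \<open>\<delta>'\<close>))^(i
  m), where R = q powr (1/2 - \<open>\<delta>\<close>). For m = 1 it reads \<open>\<delta>'\<close>
  <= \<open>\<delta>\<close>; the growth in m is most restrictive at i = 3, which gives 1/6.\<close>

lemma twist_exponent_ineq:
  fixes i m \<delta> \<delta>' :: real
  assumes "i \<ge> 3" "m \<ge> 1" "\<delta>' \<le> \<delta>" "\<delta>' \<le> 1 / 6" "\<delta>' \<ge> 0"
  shows "(1/2 - \<delta>) * i + m \<le> 1 + (1/2 - \<delta>') * (i * m)"
proof -
  have "\<delta>' * (i * (m - 1)) \<le> 1 / 6 * (i * (m - 1))" using assms by (intro mult_right_mono) auto
  also have "\<dots> \<le> 1 / 2 * ((i - 2) * (m - 1))"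
  proof -
    have "(i / 3) * (m - 1) \<le> (i - 2) * (m - 1)" using assms by (intro mult_right_mono) auto
    then show ?thesis by simp
  qed
  finally have 1: "\<delta>' * (i * (m - 1)) \<le> 1 / 2 * ((i - 2) * (m - 1))" .
  have "\<delta>' * i \<le> \<delta> * i" using assms by (intro mult_right_mono) auto
  with 1 show ?thesis by (simp add: algebra_simps)
qed

text \<open>With i = j / m the difference carries the factor z^i - z, so the primes themselves
  cancel and only i >= 2 remains.\<close>

lemma twisted_mangoldt_sum_bound:
  fixes d :: "'a::{field,finite} poly"
  assumes chi: "dirichlet_character d chi" and np: "(\<lambda>f. chi f ^ 2) \<noteq> principal_character d"
    and \<delta>: "0 < \<delta>" "\<delta> \<le> 1 / 2"
  shows "\<exists>C s. C \<ge> 0 \<and> 1 \<le> s \<and> s < sqrt (real CARD('a)) \<and>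
    (\<forall>z j. norm z \<le> real CARD('a) powr (1/2 - \<delta>) \<longrightarrow> j \<ge> 1 \<longrightarrow>
      norm (mangoldt_sum (\<lambda>f. chi f * z ^ big_omega f) j - z * mangoldt_sum chi j) \<le> C * s ^ j)"
proof -
  define q where "q = real CARD('a)"
  have q: "q \<ge> 2" unfolding q_def using card_field_ge_2[where 'a='a] by simp
  define R where "R = q powr (1/2 - \<delta>)"
  have R: "R \<ge> 1" using q \<delta> by (simp add: R_def ge_one_powr_ge_zero)
  note le1 = norm_dirichlet_character_le[OF chi]
  obtain C2 \<sigma> where C2: "C2 \<ge> 0" and \<sigma>: "1 \<le> \<sigma>" "\<sigma> < q"
    and b2: "\<And>m. m \<ge> 1 \<Longrightarrow> norm (prime_power_sum chi 2 m) \<le> C2 * \<sigma> ^ m"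
    using prime_power_sum_2_bound[OF chi np] unfolding q_def by blast
  define \<delta>' where "\<delta>' = min \<delta> (1/6)"
  have \<delta>': "\<delta>' > 0" "\<delta>' \<le> \<delta>" "\<delta>' \<le> 1/6" using \<delta> by (auto simp: \<delta>'_def)
  define t where "t = max (sqrt \<sigma>) (q powr (1/2 - \<delta>'))"
  have "q powr (1/2 - \<delta>') < q powr (1/2)" using q \<delta>' by (intro powr_less_mono) auto
  then have t: "1 \<le> t" "t < sqrt q" using \<sigma> q by (auto simp: t_def powr_half_sqrt le_max_iff_disj)
  \<comment> \<open>The two summands serve i = 2 and i >= 3; the factor 2 in each comes from |z^i -
    z| <= 2 R^i, valid as R >= 1.\<close>
  define C1 where "C1 = 2 * R\<^sup>2 * C2 + 2 * q"
  have C1: "C1 \<ge> 0" using C2 q by (simp add: C1_def)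
  have zi: "norm (z ^ i - z) \<le> 2 * R ^ i" if z: "norm z \<le> R" and i: "i \<ge> 1" for z :: complex and i
  proof -
    have "norm (z ^ i - z) \<le> norm z ^ i + norm z" by (metis norm_power norm_triangle_ineq4)
    also have "norm z ^ i \<le> R ^ i" using z by (intro power_mono) auto
    also have "norm z \<le> R ^ i" using z R i power_increasing[of 1 i R] by simp
    finally show ?thesis by simp
  qed
  have main: "norm ((z ^ i - z) * prime_power_sum chi i m) \<le> C1 * t ^ (i * m)"
    if z: "norm z \<le> R" and i: "i \<ge> 1" and m: "m \<ge> 1" for z i m
  proof -
    consider "i = 1" | "i = 2" | "i \<ge> 3" using i by linarith
    then show ?thesis
    proof cases
      case 1
      then show ?thesis using C1 t by simp
    next
      case 2
      have "norm ((z ^ i - z) * prime_power_sum chi i m) \<le> (2 * R\<^sup>2) * (C2 * \<sigma> ^ m)"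
        unfolding norm_mult using zi[OF z i] b2[OF m] 2 by (intro mult_mono) auto
      also have "\<sigma> ^ m = sqrt \<sigma> ^ (i * m)" using \<sigma> 2 by (simp add: power_mult)
      also have "(2 * R\<^sup>2) * (C2 * sqrt \<sigma> ^ (i * m)) \<le> (2 * R\<^sup>2) * (C2 * t ^ (i * m))"
        using C2 \<sigma> by (intro mult_left_mono power_mono) (auto simp: t_def)
      also have "\<dots> \<le> C1 * t ^ (i * m)" using q t unfolding C1_def by (simp add: distrib_right)
      finally show ?thesis .
    next
      case 3
      have "norm ((z ^ i - z) * prime_power_sum chi i m) \<le> (2 * R ^ i) * q ^ m"
        unfolding norm_mult q_def using zi[OF z i] norm_prime_power_sum_le[OF le1 m, where i = i] R
        by (intro mult_mono) auto
      also have "R ^ i * q ^ m = q powr ((1/2 - \<delta>) * i + m)"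
        using q by (simp add: R_def powr_add powr_powr powr_realpow[symmetric])
      then have "(2 * R ^ i) * q ^ m = 2 * q powr ((1/2 - \<delta>) * i + m)" by simp
      also have "\<dots> \<le> 2 * q powr (1 + (1/2 - \<delta>') * (real i * real m))"
        using q 3 m \<delta>' by (intro mult_left_mono powr_mono twist_exponent_ineq) auto
      also have "\<dots> = 2 * q * (q powr (1/2 - \<delta>')) ^ (i * m)"
        using q by (simp add: powr_add powr_powr powr_realpow[symmetric])
      also have "\<dots> \<le> 2 * q * t ^ (i * m)"
        using q by (intro mult_left_mono power_mono) (auto simp: t_def)
      also have "\<dots> \<le> C1 * t ^ (i * m)" using C2 t unfolding C1_def by (simp add: distrib_right)
      finally show ?thesis .
    qed
  qed
  \<comment> \<open>The midpoint leaves room for the number of divisors of j.\<close>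
  define s where "s = (t + sqrt q) / 2"
  have s: "t < s" "s < sqrt q" using t by (auto simp: s_def)
  have "norm (mangoldt_sum (\<lambda>f. chi f * z ^ big_omega f) j - z * mangoldt_sum chi j) \<le>
      C1 * (t / (s - t)) * s ^ j" if z: "norm z \<le> R" and j: "j \<ge> 1" for z j
  proof -
    let ?D = "{m. m \<in> {1..j} \<and> m dvd j}"
    have "mangoldt_sum (\<lambda>f. chi f * z ^ big_omega f) j - z * mangoldt_sum chi j =
       (\<Sum>m\<in>?D. (z ^ (j div m) - z) * prime_power_sum chi (j div m) m)"
      unfolding mangoldt_sum_twist unfolding mangoldt_sum_eq_prime_power_sum
      by (simp add: sum_distrib_left sum_subtractf left_diff_distrib)
    also have "norm \<dots> \<le> real (card ?D) * (C1 * t ^ j)"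
    proof (rule sum_norm_bound)
      fix m assume m: "m \<in> ?D"
      then have "j = (j div m) * m" by simp
      moreover have "j div m \<ge> 1" using m j by (auto simp: Suc_le_eq div_greater_zero_iff)
      ultimately show "norm ((z ^ (j div m) - z) * prime_power_sum chi (j div m) m) \<le> C1 * t ^ j"
        using main[OF z, of "j div m" m] m by auto
    qed
    also have "\<dots> \<le> real j * (C1 * t ^ j)"
    proof -
      have "card ?D \<le> card {1..j}" by (rule card_mono) auto
      then show ?thesis using t C1 by (intro mult_right_mono) auto
    qed
    also have "\<dots> = C1 * (real j * t ^ j)" by simp
    also have "\<dots> \<le> C1 * (t / (s - t) * s ^ j)"
      using C1 t s by (intro mult_left_mono of_nat_mult_power_le) auto
    finally show ?thesis by simp
  qed
  then show ?thesis using C1 t s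
    by (intro exI[of _ "C1 * (t / (s - t))"] exI[of _ s]) (auto simp: q_def R_def)
qed

section \<open>Coefficients of binomial series\<close>

text \<open>Coefficients of (1 - x)^w, that is, (-1)^n times the binomial coefficient w over n, in
  the form in which these powers arise from logarithmic derivatives.\<close>

definition binomial_coeff :: "complex \<Rightarrow> nat \<Rightarrow> complex" where
  "binomial_coeff w n = exp_coeff (\<lambda>_. - w) n"

lemma exp_coeff_binomial: "exp_coeff (\<lambda>j. - w * e ^ j) n = e ^ n * binomial_coeff w n"
  unfolding binomial_coeff_def exp_coeff_scale[symmetric] by (simp add: mult.commute)

lemma binomial_coeff_0 [simp]: "binomial_coeff w 0 = 1"
  by (simp add: binomial_coeff_def)

text \<open>With a constant logarithmic derivative the recurrence involves just the sum of all
  earlier coefficients; subtracting consecutive instances leaves two terms.\<close>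

lemma binomial_coeff_Suc: "of_nat (Suc n) * binomial_coeff w (Suc n) = (of_nat n - w) * binomial_coeff w n"
proof -
  have *: "of_nat n * binomial_coeff w n = - w * (\<Sum>i<n. binomial_coeff w i)" for n
  proof -
    have "of_nat n * binomial_coeff w n = (\<Sum>j=1..n. - w * binomial_coeff w (n - j))"
      unfolding binomial_coeff_def by (rule exp_coeff_rec)
    also have "\<dots> = (\<Sum>i<n. - w * binomial_coeff w i)"
      by (rule sum.reindex_bij_witness[of _ "\<lambda>i. n - i" "\<lambda>j. n - j"]) auto
    finally show ?thesis by (simp add: sum_distrib_left)
  qed
  show ?thesis unfolding * using *[of n] by (simp add: algebra_simps)
qed

lemma binomial_coeff_eq_prod:
  "binomial_coeff w (Suc n) = - (w / of_nat (Suc n)) * (\<Prod>j=1..n. 1 - w / of_nat j)"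
proof (induction n)
  case 0
  then show ?case using binomial_coeff_Suc[of 0 w] by simp
next
  case (Suc n)
  have "binomial_coeff w (Suc (Suc n)) = (of_nat (Suc n) - w) * binomial_coeff w (Suc n) / of_nat (Suc (Suc n))"
    using binomial_coeff_Suc[of "Suc n" w] by (simp add: field_simps del: of_nat_Suc)
  also have "\<dots> = - (w / of_nat (Suc (Suc n))) * ((\<Prod>j=1..n. 1 - w / of_nat j) * (1 - w / of_nat (Suc n)))"
    unfolding Suc by (simp add: field_simps del: of_nat_Suc)
  finally show ?case by simp
qed

text \<open>The factor of \<open>binomial_coeff w n\<close> that stays bounded in \<open>n\<close>; it tends to \<open>1 / Gamma (1 - w)\<close>.\<close>

definition gamma_factor :: "nat \<Rightarrow> complex \<Rightarrow> complex" where
  "gamma_factor n w = exp (w * of_real (ln (real n))) * (\<Prod>j=1..n - 1. 1 - w / of_nat j)"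

text \<open>Separates the growth n^(-w-1) from a bounded factor. The explicit \<open>w\<close> makes
  the main term divisible by z, the origin of (k - 1)! and of the exponent k - 1 of ln n.\<close>

lemma binomial_coeff_eq_gamma_factor:
  assumes "n \<ge> 1"
  shows "binomial_coeff w n = - (w / of_nat n) * exp (- w * of_real (ln (real n))) * gamma_factor n w"
proof -
  obtain k where n: "n = Suc k" using assms by (cases n) auto
  have "exp (- (w * of_real (ln (real n)))) * exp (w * of_real (ln (real n))) = 1"
    by (simp flip: exp_add)
  then show ?thesis unfolding gamma_factor_def n binomial_coeff_eq_prod
    by (simp add: mult.assoc mult.left_commute mult.commute[of "exp (w * _)"] del: of_nat_Suc)
qed

lemma gamma_factor_0 [simp]: "gamma_factor n 0 = 1"
  by (simp add: gamma_factor_def)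

lemma gamma_factor_holomorphic: "gamma_factor n holomorphic_on S"
  unfolding gamma_factor_def by (intro holomorphic_intros) auto

text \<open>From |1 - t|^2 = 1 - 2 Re t + |t|^2 and 1 + x <= exp x. It holds for all t, so small j
  in the product get no special treatment.\<close>

lemma norm_one_minus_le_exp: "norm (1 - t) \<le> exp (- Re t + norm t ^ 2 / 2)"
proof -
  have "(norm (1 - t))\<^sup>2 = 1 + (- 2 * Re t + norm t ^ 2)"
    unfolding cmod_power2 by (simp add: power2_eq_square algebra_simps)
  also have "\<dots> \<le> exp (- 2 * Re t + norm t ^ 2)" by (rule exp_ge_add_one_self)
  also have "\<dots> = (exp (- Re t + norm t ^ 2 / 2))\<^sup>2" by (simp flip: exp_double)
  finally show ?thesis by (rule power2_le_imp_le) simp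
qed

text \<open>Telescoping with 1/n - 1/(n+1). At n = 0 the bound reads 2, since 1 / 0 is 0.\<close>

lemma sum_inverse_squares_le: "(\<Sum>j=1..n. 1 / real j ^ 2) \<le> 2 - 1 / real n"
proof (induction n)
  case (Suc n)
  show ?case
  proof (cases "n = 0")
    case False
    then have "1 / real n - 1 / real (Suc n) = 1 / (real n * real (Suc n))"
      by (simp add: field_simps)
    moreover have "1 / real (Suc n) ^ 2 \<le> 1 / (real n * real (Suc n))"
      using False unfolding power2_eq_square by (intro divide_left_mono mult_right_mono) auto
    ultimately have "1 / real (Suc n) ^ 2 \<le> 1 / real n - 1 / real (Suc n)" by simp
    with Suc show ?thesis by simp
  qed simp
qed simp

lemma abs_ln_minus_harm_le:
  assumes "n \<ge> 1"
  shows "\<bar>ln (real n) - harm (n - 1)\<bar> \<le> 1"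
proof -
  obtain k where n: "n = Suc k" using assms by (cases n) auto
  have "ln (real n) \<le> harm (n - 1)" using ln_le_harm[of k] by (simp add: n add.commute)
  moreover have "harm (Suc k) - ln (real (Suc k)) \<le> harm (Suc 0) - ln (real (Suc 0))"
    using decseqD[OF decseq_harm_diff_ln, of 0 k] by simp
  then have "harm (Suc k) \<le> ln (real n) + 1" by (simp add: n harm_expand)
  moreover have "harm (n - 1) \<le> (harm (Suc k) :: real)" by (rule harm_mono) (simp add: n)
  ultimately show ?thesis by simp
qed

text \<open>To first order the product is exp (- w * harm (n - 1)), and harm (n - 1) is within 1 of
  ln n, so this cancels the prefactor up to exp W. The quadratic terms cost W^2, as the inverse
  squares sum to at most 2.\<close>

lemma norm_gamma_factor_le:
  assumes n: "n \<ge> 1" and w: "norm w \<le> W"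
  shows "norm (gamma_factor n w) \<le> exp (W + W\<^sup>2)"
proof -
  have W: "W \<ge> 0" using w norm_ge_zero[of w] by linarith
  have "norm (\<Prod>j=1..n - 1. 1 - w / of_nat j) \<le> (\<Prod>j=1..n - 1. exp (- Re w * inverse (real j) + (norm w)\<^sup>2 / 2 * (1 / real j ^ 2)))"
    unfolding prod_norm[symmetric]
  proof (rule prod_mono, intro conjI norm_ge_zero)
    fix j
    show "norm (1 - w / of_nat j) \<le> exp (- Re w * inverse (real j) + (norm w)\<^sup>2 / 2 * (1 / real j ^ 2))"
      by (rule order.trans[OF norm_one_minus_le_exp]) (simp add: norm_divide power_divide field_simps)
  qed
  also have "\<dots> = exp (- Re w * harm (n - 1) + (norm w)\<^sup>2 / 2 * (\<Sum>j=1..n - 1. 1 / real j ^ 2))"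
    unfolding exp_sum[OF finite_atLeastAtMost, symmetric] sum.distrib sum_distrib_left[symmetric] harm_def by simp
  finally have "norm (gamma_factor n w) \<le> exp (Re w * ln (real n)) *
      exp (- Re w * harm (n - 1) + (norm w)\<^sup>2 / 2 * (\<Sum>j=1..n - 1. 1 / real j ^ 2))"
    unfolding gamma_factor_def norm_mult norm_exp_eq_Re by (simp add: mult_left_mono)
  also have "\<dots> = exp (Re w * (ln (real n) - harm (n - 1)) + (norm w)\<^sup>2 / 2 * (\<Sum>j=1..n - 1. 1 / real j ^ 2))"
    by (simp add: algebra_simps flip: exp_add)
  also have "\<dots> \<le> exp (W + W\<^sup>2)"
  proof -
    have "Re w * (ln (real n) - harm (n - 1)) \<le> \<bar>Re w\<bar> * \<bar>ln (real n) - harm (n - 1)\<bar>"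
      by (metis abs_ge_self abs_mult)
    also have "\<dots> \<le> W * 1"
      using W abs_ln_minus_harm_le[OF n] abs_Re_le_cmod[of w] w by (intro mult_mono) auto
    finally have 1: "Re w * (ln (real n) - harm (n - 1)) \<le> W" by simp
    have "(\<Sum>j=1..n - 1. 1 / real j ^ 2) \<le> 2"
      using sum_inverse_squares_le[of "n - 1"] by (rule order.trans) simp
    then have "(norm w)\<^sup>2 / 2 * (\<Sum>j=1..n - 1. 1 / real j ^ 2) \<le> W\<^sup>2 / 2 * 2"
      using w by (intro mult_mono divide_right_mono power_mono) (auto intro!: sum_nonneg)
    with 1 show ?thesis by simp
  qed
  finally show ?thesis .
qed

lemma norm_binomial_coeff_le:
  assumes n: "n \<ge> 1" and w: "norm w \<le> W"
  shows "norm (binomial_coeff w n) \<le> W * exp (W + W\<^sup>2) * (exp (- Re w * ln (real n)) / real n)"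
proof -
  have W: "W \<ge> 0" using w norm_ge_zero[of w] by linarith
  have "norm (binomial_coeff w n) = norm w * norm (gamma_factor n w) * (exp (- Re w * ln (real n)) / real n)"
    unfolding binomial_coeff_eq_gamma_factor[OF n] norm_mult norm_exp_eq_Re norm_minus_cancel norm_divide
    by simp
  also have "\<dots> \<le> W * exp (W + W\<^sup>2) * (exp (- Re w * ln (real n)) / real n)"
    using norm_gamma_factor_le[OF n w] w W by (intro mult_right_mono mult_mono) auto
  finally show ?thesis .
qed

lemma norm_binomial_coeff_le_powr:
  assumes n: "n \<ge> 1" and w: "norm w \<le> \<tau>" "\<tau> \<le> W"
  shows "norm (binomial_coeff w n) \<le> W * exp (W + W\<^sup>2) * real n powr (\<tau> - 1)"
proof -
  have W: "W \<ge> 0" using w norm_ge_zero[of w] by linarith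
  have "norm (binomial_coeff w n) \<le> W * exp (W + W\<^sup>2) * (exp (- Re w * ln (real n)) / real n)"
    by (rule norm_binomial_coeff_le) (use assms in auto)
  also have "exp (- Re w * ln (real n)) \<le> exp (\<tau> * ln (real n))"
  proof -
    have "- Re w \<le> \<tau>" using abs_Re_le_cmod[of w] w by linarith
    then have "- Re w * ln (real n) \<le> \<tau> * ln (real n)" using n by (intro mult_right_mono) auto
    then show ?thesis by simp
  qed
  also have "exp (\<tau> * ln (real n)) / real n = real n powr (\<tau> - 1)"
    using n by (simp add: powr_def exp_diff left_diff_distrib)
  finally show ?thesis using W by (simp add: mult_left_mono divide_right_mono)
qed

text \<open>The two-term recursion makes the difference -(w + 1) / (n + 1) times the coefficient
  itself; this gain of 1 / n is the saving in the error term.\<close>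

lemma norm_binomial_coeff_diff_le:
  assumes n: "n \<ge> 1" and w: "norm w \<le> \<tau>" "\<tau> \<le> W"
  shows "norm (binomial_coeff w (Suc n) - binomial_coeff w n) \<le>
    (W + 1) * (W * exp (W + W\<^sup>2)) * real n powr (\<tau> - 2)"
proof -
  have W: "W \<ge> 0" using w norm_ge_zero[of w] by linarith
  have "binomial_coeff w (Suc n) - binomial_coeff w n = - (w + 1) / of_nat (Suc n) * binomial_coeff w n"
    using binomial_coeff_Suc[of n w] by (simp add: field_simps del: of_nat_Suc) (simp add: field_simps)
  then have "norm (binomial_coeff w (Suc n) - binomial_coeff w n) =
      norm (w + 1) / real (Suc n) * norm (binomial_coeff w n)"
    by (simp add: norm_mult norm_divide del: of_nat_Suc) (metis norm_minus_cancel minus_diff_eq minus_add_distrib uminus_add_conv_diff add.commute)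
  also have "\<dots> \<le> (W + 1) / real n * (W * exp (W + W\<^sup>2) * real n powr (\<tau> - 1))"
  proof (intro mult_mono norm_binomial_coeff_le_powr[OF n w] frac_le)
    show "norm (w + 1) \<le> W + 1" using norm_triangle_ineq[of w 1] w by simp
  qed (use n W in auto)
  also have "\<dots> = (W + 1) * (W * exp (W + W\<^sup>2)) * (real n powr (\<tau> - 1) / real n)" by simp
  also have "real n powr (\<tau> - 1) / real n = real n powr (\<tau> - 2)"
    using n by (simp add: powr_diff power2_eq_square)
  finally show ?thesis .
qed

lemma norm_diff_le_telescope:
  fixes f :: "nat \<Rightarrow> complex"
  assumes "\<And>i. a \<le> i \<Longrightarrow> i < a + m \<Longrightarrow> norm (f (Suc i) - f i) \<le> B"
  shows "norm (f a - f (a + m)) \<le> real m * B"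
  using assms
proof (induction m)
  case (Suc m)
  have "norm (f a - f (a + Suc m)) \<le> norm (f a - f (a + m)) + norm (f (Suc (a + m)) - f (a + m))"
    using norm_triangle_ineq4[of "f a - f (a + m)" "f (Suc (a + m)) - f (a + m)"] by simp
  also have "\<dots> \<le> real m * B + B" using Suc.prems by (intro add_mono Suc.IH) auto
  finally show ?case by (simp add: algebra_simps)
qed simp

text \<open>With \<open>binomial_coeff w i\<close> read as 0 for negative \<open>i\<close>.\<close>

lemma binomial_coeff_shift_bound:
  fixes W :: real
  defines "K \<equiv> 8 * (1 + (W + 1) * (W * exp (W + W\<^sup>2)))"
  assumes n: "n \<ge> 1" and w: "norm w \<le> \<tau>" "\<tau> \<le> W"
  shows "norm ((if j \<le> n then binomial_coeff w (n - j) else 0) - binomial_coeff w n) \<le>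
    K * real (Suc j) ^ 2 * real n powr (\<tau> - 2)"
proof -
  have W: "W \<ge> 0" and \<tau>: "\<tau> \<ge> 0" using w norm_ge_zero[of w] by linarith+
  define B where "B = W * exp (W + W\<^sup>2)"
  have B0: "B \<ge> 0" using W by (simp add: B_def)
  then have B: "B \<ge> 0" "B \<le> (W + 1) * B" using W mult_right_mono[of 1 "W + 1" B] by simp_all
  have K: "K = 8 * (1 + (W + 1) * B)" by (simp add: K_def B_def)
  have npos: "real n > 0" using n by simp
  show ?thesis
  \<comment> \<open>For j at most n / 2 the differences are summed over j steps, all at indices >= n
    / 2, where they are comparable to those at n.\<close>
  proof (cases "2 * j \<le> n")
    case True
    then have j: "j \<le> n" by simp
    have "norm (binomial_coeff w (n - j) - binomial_coeff w (n - j + j)) \<le>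
        real j * ((W + 1) * B * (4 * real n powr (\<tau> - 2)))"
    proof (rule norm_diff_le_telescope)
      fix i assume i: "n - j \<le> i" "i < n - j + j"
      then have i1: "i \<ge> 1" and i2: "real n / 2 \<le> real i" and i3: "i \<le> n" using True n by linarith+
      have "norm (binomial_coeff w (Suc i) - binomial_coeff w i) \<le> (W + 1) * B * real i powr (\<tau> - 2)"
        unfolding B_def by (rule norm_binomial_coeff_diff_le[OF i1 w])
      also have "real i powr (\<tau> - 2) = real i powr \<tau> * (1 / real i ^ 2)"
        using i1 by (simp add: powr_diff)
      also have "\<dots> \<le> real n powr \<tau> * (1 / (real n / 2) ^ 2)"
        using i1 i2 i3 n \<tau> by (intro mult_mono powr_mono2 divide_left_mono power_mono) auto
      also have "\<dots> = 4 * real n powr (\<tau> - 2)"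
        using n by (simp add: powr_diff power_divide)
      finally show "norm (binomial_coeff w (Suc i) - binomial_coeff w i) \<le> (W + 1) * B * (4 * real n powr (\<tau> - 2))"
        using B W by (simp add: mult_left_mono)
    qed
    also have "\<dots> = (4 * (real j * ((W + 1) * B))) * real n powr (\<tau> - 2)" by simp
    also have "\<dots> \<le> (K * real (Suc j) ^ 2) * real n powr (\<tau> - 2)"
    proof (rule mult_right_mono)
      have "real j \<le> real (Suc j) ^ 2" by (simp add: power2_eq_square algebra_simps)
      then have "real j * (4 * ((W + 1) * B)) \<le> real (Suc j) ^ 2 * K"
        using B W by (intro mult_mono) (auto simp: K)
      then show "4 * (real j * ((W + 1) * B)) \<le> K * real (Suc j) ^ 2" by (simp add: mult_ac)
    qed simp
    finally show ?thesis using j by simp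
  next
    \<comment> \<open>Here (j + 1)^2 is at least n^2 / 4, so bounding both coefficients separately
      is enough; 8 is 2 terms times 4.\<close>
    case False
    have b: "norm (binomial_coeff w i) \<le> (1 + B) * real n powr \<tau>" if i: "i \<le> n" for i
    proof (cases "i = 0")
      case True
      have "1 * 1 \<le> (1 + B) * real n powr \<tau>"
        using B n \<tau> by (intro mult_mono ge_one_powr_ge_zero) auto
      then show ?thesis using True by simp
    next
      case False
      then have i1: "i \<ge> 1" by simp
      have "norm (binomial_coeff w i) \<le> B * real i powr (\<tau> - 1)"
        unfolding B_def by (rule norm_binomial_coeff_le_powr[OF i1 w])
      also have "\<dots> \<le> B * real i powr \<tau>" using i1 B by (intro mult_left_mono powr_mono) auto
      also have "\<dots> \<le> (1 + B) * real n powr \<tau>"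
        using i1 B i \<tau> by (intro mult_mono powr_mono2) auto
      finally show ?thesis .
    qed
    have "norm ((if j \<le> n then binomial_coeff w (n - j) else 0) - binomial_coeff w n) \<le>
       norm (if j \<le> n then binomial_coeff w (n - j) else 0) + norm (binomial_coeff w n)"
      by (rule norm_triangle_ineq4)
    also have "\<dots> \<le> (1 + B) * real n powr \<tau> + (1 + B) * real n powr \<tau>"
      using b B by (intro add_mono) auto
    also have "\<dots> = 2 * (1 + B) * real n ^ 2 * real n powr (\<tau> - 2)"
      using n by (simp add: powr_diff)
    also have "\<dots> \<le> 2 * (1 + B) * (4 * real (Suc j) ^ 2) * real n powr (\<tau> - 2)"
    proof (intro mult_right_mono mult_left_mono)
      have "real n \<le> 2 * real (Suc j)" using False by simp
      then have "real n ^ 2 \<le> (2 * real (Suc j)) ^ 2" by (rule power_mono) simp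
      then show "real n ^ 2 \<le> 4 * real (Suc j) ^ 2" by (simp add: power_mult_distrib del: of_nat_Suc)
    qed (use B in auto)
    also have "\<dots> = (8 * (1 + B)) * real (Suc j) ^ 2 * real n powr (\<tau> - 2)" by simp
    also have "\<dots> \<le> K * real (Suc j) ^ 2 * real n powr (\<tau> - 2)"
      using B by (intro mult_right_mono) (auto simp: K)
    finally show ?thesis .
  qed
qed

section \<open>Sequences with decaying coefficients\<close>

lemma summable_inverse_Suc_square: "summable (\<lambda>j. 1 / real (Suc j) ^ 2)"
  using inverse_power_summable[of 2, where 'a = real] unfolding summable_Suc_iff[of "\<lambda>j. 1 / real j ^ 2"]
  by (simp add: inverse_eq_divide)

lemma suminf_inverse_Suc_square_le: "(\<Sum>j. 1 / real (Suc j) ^ 2) \<le> 2"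
proof (rule suminf_le_const[OF summable_inverse_Suc_square])
  fix n
  have "(\<Sum>j<n. 1 / real (Suc j) ^ 2) = (\<Sum>j=1..n. 1 / real j ^ 2)"
    by (rule sum.reindex_bij_witness[of _ "\<lambda>j. j - 1" Suc]) auto
  also have "\<dots> \<le> 2" using sum_inverse_squares_le[of n] by (rule order.trans) simp
  finally show "(\<Sum>j<n. 1 / real (Suc j) ^ 2) \<le> 2" .
qed

text \<open>The shift bound costs a factor (j + 1)^2, and exponent 4 still leaves the summable 1 /
  (j + 1)^2. The explicit constant \<open>A\<close> expresses uniformity in z.\<close>

definition quartic_decay :: "real \<Rightarrow> (nat \<Rightarrow> complex) \<Rightarrow> bool" where
  "quartic_decay A g \<longleftrightarrow> (\<forall>n. norm (g n) \<le> A / real (Suc n) ^ 4)"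

lemma quartic_decay_nonneg: "quartic_decay A g \<Longrightarrow> A \<ge> 0"
  unfolding quartic_decay_def by (drule spec[of _ 0]) (auto intro: order.trans[OF norm_ge_zero])

lemma quartic_decay_mono: "quartic_decay A g \<Longrightarrow> A \<le> B \<Longrightarrow> quartic_decay B g"
  unfolding quartic_decay_def
  by (intro allI, erule allE, erule order.trans, rule divide_right_mono) auto

lemma quartic_decay_le_square:
  assumes "quartic_decay A g"
  shows "norm (g n) \<le> A * (1 / real (Suc n) ^ 2)"
proof -
  have "norm (g n) \<le> A / real (Suc n) ^ 4" using assms by (simp add: quartic_decay_def)
  also have "\<dots> \<le> A / real (Suc n) ^ 2"
    using quartic_decay_nonneg[OF assms] by (intro divide_left_mono power_increasing) auto
  finally show ?thesis by simp
qed

lemma quartic_decay_summable: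
  assumes "quartic_decay A g"
  shows "summable g"
proof (rule summable_comparison_test')
  show "summable (\<lambda>j. A * (1 / real (Suc j) ^ 2))"
    by (intro summable_mult summable_inverse_Suc_square)
  show "norm (g n) \<le> A * (1 / real (Suc n) ^ 2)" if "n \<ge> 0" for n
    by (rule quartic_decay_le_square[OF assms])
qed

text \<open>One of j and n - j is at least n / 2, so its factor is at most 16 times the value at n,
  while the other factor sums to at most 2. Hence 64 = 16 * (2 + 2).\<close>

lemma quartic_decay_mult:
  assumes "quartic_decay A (fps_nth F)" "quartic_decay B (fps_nth G)"
  shows "quartic_decay (64 * A * B) (fps_nth (F * G))"
  unfolding quartic_decay_def
proof
  fix n
  have A: "A \<ge> 0" and B: "B \<ge> 0" using assms quartic_decay_nonneg by auto
  define x where "x = (\<lambda>j. 1 / real (Suc j) ^ 4)"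
  have xpos: "x j \<ge> 0" for j by (simp add: x_def)
  have half: "x j \<le> 16 * x n" if "n \<le> 2 * j" for j
  proof -
    have "real (Suc n) ^ 4 \<le> (2 * real (Suc j)) ^ 4" using that by (intro power_mono) auto
    then show ?thesis unfolding x_def by (simp add: power_mult_distrib field_simps del: of_nat_Suc)
  qed
  have sum_x: "(\<Sum>j\<le>n. x j) \<le> 2"
  proof -
    have "(\<Sum>j\<le>n. x j) \<le> (\<Sum>j\<le>n. 1 / real (Suc j) ^ 2)"
      unfolding x_def by (intro sum_mono divide_left_mono power_increasing) auto
    also have "\<dots> \<le> (\<Sum>j. 1 / real (Suc j) ^ 2)"
      by (rule sum_le_suminf[OF summable_inverse_Suc_square]) auto
    finally show ?thesis using suminf_inverse_Suc_square_le by simp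
  qed
  have "norm (fps_nth (F * G) n) \<le> (\<Sum>j=0..n. norm (fps_nth F j) * norm (fps_nth G (n - j)))"
    unfolding fps_mult_nth by (rule order.trans[OF norm_sum]) (simp add: norm_mult)
  also have "\<dots> \<le> (\<Sum>j=0..n. (A * x j) * (B * x (n - j)))"
    using assms A by (intro sum_mono mult_mono) (auto simp: quartic_decay_def x_def simp del: of_nat_Suc)
  also have "\<dots> \<le> (\<Sum>j=0..n. A * B * (16 * x n) * (x j + x (n - j)))"
  proof (rule sum_mono)
    fix j assume j: "j \<in> {0..n}"
    have "x j * x (n - j) \<le> (16 * x n) * (x j + x (n - j))"
    proof (cases "n \<le> 2 * j")
      case True
      have "x j * x (n - j) \<le> (16 * x n) * x (n - j)" by (intro mult_right_mono half True xpos)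
      also have "\<dots> \<le> (16 * x n) * (x j + x (n - j))" using xpos by (intro mult_left_mono) auto
      finally show ?thesis .
    next
      case False
      have "x (n - j) * x j \<le> (16 * x n) * x j" by (intro mult_right_mono half xpos) (use False in auto)
      also have "\<dots> \<le> (16 * x n) * (x j + x (n - j))" using xpos by (intro mult_left_mono) auto
      finally show ?thesis by (simp add: mult.commute)
    qed
    then have "(A * B) * (x j * x (n - j)) \<le> (A * B) * ((16 * x n) * (x j + x (n - j)))"
      using A B by (intro mult_left_mono) auto
    then show "(A * x j) * (B * x (n - j)) \<le> A * B * (16 * x n) * (x j + x (n - j))"
      by (simp add: mult_ac)
  qed
  also have "\<dots> = A * B * (16 * x n) * ((\<Sum>j\<le>n. x j) + (\<Sum>j\<le>n. x (n - j)))"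
    by (simp add: sum.distrib atLeast0AtMost flip: sum_distrib_left)
  also have "(\<Sum>j\<le>n. x (n - j)) = (\<Sum>j\<le>n. x j)"
    by (rule sum.reindex_bij_witness[of _ "\<lambda>i. n - i" "\<lambda>i. n - i"]) auto
  also have "A * B * (16 * x n) * ((\<Sum>j\<le>n. x j) + (\<Sum>j\<le>n. x j)) \<le> A * B * (16 * x n) * (2 + 2)"
    using A B xpos sum_x by (intro mult_left_mono add_mono) auto
  finally show "norm (fps_nth (F * G) n) \<le> 64 * A * B / real (Suc n) ^ 4" by (simp add: x_def)
qed

lemma quartic_decay_1: "quartic_decay 1 (fps_nth 1)"
  by (simp add: quartic_decay_def)

lemma quartic_decay_prod:
  assumes "finite S" "\<And>a. a \<in> S \<Longrightarrow> \<exists>A. \<forall>z\<in>Z. quartic_decay A (fps_nth (F a z))"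
  shows "\<exists>A. \<forall>z\<in>Z. quartic_decay A (fps_nth (\<Prod>a\<in>S. F a z))"
  using assms
proof (induction S rule: finite_induct)
  case empty
  show ?case by (intro exI[of _ 1] ballI) (simp only: prod.empty quartic_decay_1)
next
  case (insert a S)
  then obtain A B where "\<forall>z\<in>Z. quartic_decay A (fps_nth (F a z))"
    "\<forall>z\<in>Z. quartic_decay B (fps_nth (\<Prod>a\<in>S. F a z))" by fastforce
  then have "\<forall>z\<in>Z. quartic_decay (64 * A * B) (fps_nth (\<Prod>a\<in>insert a S. F a z))"
    using insert.hyps quartic_decay_mult by simp
  then show ?case by blast
qed

lemma quartic_decay_poly: "\<exists>A. quartic_decay A (fps_nth (fps_of_poly p))"
proof -
  define A where "A = (\<Sum>i\<le>degree p. norm (coeff p i) * real (Suc i) ^ 4)"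
  have "norm (coeff p n) \<le> A / real (Suc n) ^ 4" for n
  proof (cases "n \<le> degree p")
    case True
    have "norm (coeff p n) * real (Suc n) ^ 4 \<le> A"
      unfolding A_def by (rule member_le_sum) (use True in auto)
    then show ?thesis by (simp add: field_simps del: of_nat_Suc)
  next
    case False
    then show ?thesis by (auto simp: coeff_eq_0 A_def intro!: divide_nonneg_nonneg sum_nonneg)
  qed
  then show ?thesis by (auto simp: quartic_decay_def)
qed

lemma quartic_decay_geometric:
  fixes s :: real
  assumes s: "0 < s" "s < 1" and D: "D \<ge> 0"
  shows "\<exists>A. \<forall>g. (\<forall>n. norm (g n) \<le> D * s ^ n) \<longrightarrow> quartic_decay A g"
proof -
  have "(\<lambda>n. real (Suc n) ^ 4 * s ^ n) \<longlonglongrightarrow> 0" using s by real_asymp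
  then have "Bseq (\<lambda>n. real (Suc n) ^ 4 * s ^ n)" by (rule convergent_imp_Bseq[OF convergentI])
  then obtain K where K: "\<And>n. norm (real (Suc n) ^ 4 * s ^ n) \<le> K" by (auto simp: Bseq_def)
  have "quartic_decay (D * K) g" if g: "\<forall>n. norm (g n) \<le> D * s ^ n" for g
    unfolding quartic_decay_def
  proof
    fix n
    have "norm (g n) * real (Suc n) ^ 4 \<le> D * s ^ n * real (Suc n) ^ 4"
      using g by (intro mult_right_mono) auto
    also have "\<dots> \<le> D * K"
      using K[of n] s D by (auto simp: mult.assoc mult.commute[of "s ^ n"] abs_mult intro!: mult_left_mono simp del: of_nat_Suc)
    finally show "norm (g n) \<le> D * K / real (Suc n) ^ 4" by (simp add: field_simps del: of_nat_Suc)
  qed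
  then show ?thesis by blast
qed

text \<open>The coefficients of (1 - e x)^w are O(n^(- Re w - 1)), so real part 4 is ample. The
  summand 1 covers n = 0, and 16 = 2^4 passes from n to n + 1.\<close>

lemma quartic_decay_binomial:
  assumes W: "norm w \<le> W" and Re: "Re w \<ge> 4" and e: "norm e = 1"
  shows "quartic_decay (1 + 16 * W * exp (W + W\<^sup>2)) (exp_coeff (\<lambda>j. - w * e ^ j))"
  unfolding quartic_decay_def
proof
  fix n
  have W0: "W \<ge> 0" using W norm_ge_zero[of w] by linarith
  define B where "B = W * exp (W + W\<^sup>2)"
  have B: "B \<ge> 0" using W0 by (simp add: B_def)
  show "norm (exp_coeff (\<lambda>j. - w * e ^ j) n) \<le> (1 + 16 * W * exp (W + W\<^sup>2)) / real (Suc n) ^ 4"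
  proof (cases "n = 0")
    case True
    then show ?thesis using W0 by simp
  next
    case False
    then have n: "n \<ge> 1" by simp
    have "norm (exp_coeff (\<lambda>j. - w * e ^ j) n) = norm (binomial_coeff w n)"
      unfolding exp_coeff_binomial by (simp add: norm_mult norm_power e)
    also have "\<dots> \<le> B * (exp (- Re w * ln (real n)) / real n)"
      unfolding B_def by (rule norm_binomial_coeff_le[OF n W])
    also have "\<dots> \<le> B * (exp (- 4 * ln (real n)) / 1)"
      using n Re B by (intro mult_left_mono frac_le) (auto intro!: mult_right_mono)
    also have "exp (- 4 * ln (real n)) = 1 / real n ^ 4"
      using n exp_of_nat_mult[of 4 "ln (real n)"] by (simp add: exp_minus inverse_eq_divide)
    also have "1 / real n ^ 4 / 1 \<le> 16 / real (Suc n) ^ 4"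
    proof -
      have "real (Suc n) ^ 4 \<le> (2 * real n) ^ 4" using n by (intro power_mono) auto
      then show ?thesis using n by (simp add: power_mult_distrib field_simps del: of_nat_Suc)
    qed
    finally have "norm (exp_coeff (\<lambda>j. - w * e ^ j) n) \<le> B * (16 / real (Suc n) ^ 4)"
      using B by (simp add: mult_left_mono)
    also have "\<dots> \<le> (1 + 16 * B) / real (Suc n) ^ 4" by (simp add: field_simps del: of_nat_Suc)
    finally show ?thesis by (simp add: B_def mult.assoc)
  qed
qed

text \<open>To leading order the series of \<open>g\<close> may be replaced by its value at the
  singular point 1. The terms with j > n are included with coefficient 0, so that the full sum of
  \<open>g\<close> appears; 2 bounds the sum of the inverse squares.\<close>

lemma binomial_convolution_estimate:
  fixes W :: real
  defines "K \<equiv> 8 * (1 + (W + 1) * (W * exp (W + W\<^sup>2)))"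
  assumes n: "n \<ge> 1" and w: "norm w \<le> \<tau>" "\<tau> \<le> W" and g: "quartic_decay A g"
  shows "norm ((\<Sum>j=0..n. g j * binomial_coeff w (n - j)) - binomial_coeff w n * (\<Sum>j. g j)) \<le>
    2 * A * K * real n powr (\<tau> - 2)"
proof -
  define b where "b = (\<lambda>j. if j \<le> n then binomial_coeff w (n - j) else 0)"
  have A: "A \<ge> 0" using quartic_decay_nonneg[OF g] .
  have K: "K \<ge> 0" using w norm_ge_zero[of w] unfolding K_def by (auto intro!: mult_nonneg_nonneg add_nonneg_nonneg simp del: norm_ge_zero)
  note sg = quartic_decay_summable[OF g]
  have b_sums: "(\<lambda>j. g j * b j) sums (\<Sum>j=0..n. g j * binomial_coeff w (n - j))"
  proof -
    have "(\<lambda>j. g j * b j) sums (\<Sum>j=0..n. g j * b j)"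
      by (rule sums_finite) (auto simp: b_def)
    then show ?thesis by (simp add: b_def)
  qed
  have "(\<lambda>j. g j * binomial_coeff w n) sums ((\<Sum>j. g j) * binomial_coeff w n)"
    using sg by (intro sums_mult2 summable_sums)
  from sums_diff[OF b_sums this]
  have sums: "(\<lambda>j. g j * (b j - binomial_coeff w n)) sums
     ((\<Sum>j=0..n. g j * binomial_coeff w (n - j)) - binomial_coeff w n * (\<Sum>j. g j))"
    by (simp add: algebra_simps)
  have le: "norm (g j * (b j - binomial_coeff w n)) \<le> A * K * real n powr (\<tau> - 2) * (1 / real (Suc j) ^ 2)" for j
  proof -
    have "norm (g j * (b j - binomial_coeff w n)) \<le> (A / real (Suc j) ^ 4) * (K * real (Suc j) ^ 2 * real n powr (\<tau> - 2))"
      unfolding norm_mult b_def K_def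
      using binomial_coeff_shift_bound[OF n w, of j] g A
      by (intro mult_mono) (auto simp: quartic_decay_def)
    also have "\<dots> = A * K * real n powr (\<tau> - 2) * (real (Suc j) ^ 2 / real (Suc j) ^ 4)" by simp
    also have "real (Suc j) ^ 2 / real (Suc j) ^ 4 = 1 / real (Suc j) ^ 2"
      by (simp add: power2_eq_square power4_eq_xxxx del: of_nat_Suc)
    finally show ?thesis .
  qed
  have summ: "summable (\<lambda>j. A * K * real n powr (\<tau> - 2) * (1 / real (Suc j) ^ 2))"
    by (intro summable_mult summable_inverse_Suc_square)
  have "norm (\<Sum>j. g j * (b j - binomial_coeff w n)) \<le> (\<Sum>j. A * K * real n powr (\<tau> - 2) * (1 / real (Suc j) ^ 2))"
    by (rule norm_suminf_le[OF le summ])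
  also have "\<dots> = A * K * real n powr (\<tau> - 2) * (\<Sum>j. 1 / real (Suc j) ^ 2)"
    by (rule suminf_mult[OF summable_inverse_Suc_square])
  also have "\<dots> \<le> A * K * real n powr (\<tau> - 2) * 2"
    using A K suminf_inverse_Suc_square_le by (intro mult_left_mono) auto
  finally show ?thesis using sums_unique[OF sums] by (simp add: mult_ac)
qed

section \<open>Separating the singularities\<close>

lemma coprime_complex_polyI:
  fixes p q :: "complex poly"
  assumes "p \<noteq> 0" "\<And>x. poly p x = 0 \<Longrightarrow> poly q x = 0 \<Longrightarrow> False"
  shows "coprime p q"
proof (rule coprimeI)
  fix h assume h: "h dvd p" "h dvd q"
  have h0: "h \<noteq> 0" using h(1) assms(1) by auto
  show "is_unit h"
  proof (rule ccontr)
    assume "\<not> is_unit h"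
    then have "degree h \<noteq> 0" using h0 by (simp add: is_unit_iff_degree)
    then have "\<not> constant (poly h)" by (simp add: constant_degree)
    then obtain x where x: "poly h x = 0"
      using Fundamental_Theorem_Algebra.fundamental_theorem_of_algebra[of h] by auto
    from h obtain u v where "p = h * u" "q = h * v" by (elim dvdE)
    with x assms(2)[of x] show False by simp
  qed
qed

text \<open>For a new point a, D = (1 - a x)^N is coprime to the product T of the old powers. A
  relation x D + y T = 1 gives a the cofactor y, and the old cofactors are multiplied by x.\<close>

lemma sum_complementary_powers_eq_1:
  fixes S :: "complex set"
  assumes "finite S" "S \<noteq> {}"
  shows "\<exists>Q. (\<Sum>e\<in>S. (\<Prod>e'\<in>S - {e}. [:1, -e':] ^ N) * Q e) = 1"
  using assms
proof (induction S rule: finite_ne_induct)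
  case (singleton e)
  show ?case by (rule exI[of _ "\<lambda>_. 1"]) simp
next
  case (insert a S)
  then obtain Q where Q: "(\<Sum>e\<in>S. (\<Prod>e'\<in>S - {e}. [:1, -e':] ^ N) * Q e) = 1" by blast
  define D where "D = [:1, -a:] ^ N"
  define T where "T = (\<Prod>e\<in>S. [:1, -e:] ^ N)"
  have T0: "T \<noteq> 0" using insert.hyps by (auto simp: T_def)
  have "coprime D T"
  proof (rule coprime_complex_polyI)
    show "D \<noteq> 0" by (simp add: D_def)
    fix x assume x: "poly D x = 0" "poly T x = 0"
    from x(1) have ax: "a * x = 1" by (auto simp: D_def poly_power algebra_simps)
    from x(2) insert.hyps(1) obtain e where "e \<in> S" "e * x = 1"
      by (auto simp: T_def poly_prod poly_power algebra_simps)
    moreover from ax have "x \<noteq> 0" by auto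
    ultimately have "e = a" using ax by (metis mult_right_cancel)
    with \<open>e \<in> S\<close> insert.hyps show False by simp
  qed
  then obtain x y where xy: "x * D + y * T = 1" using bezout_poly[OF _ T0] by blast
  define Q' where "Q' = (\<lambda>e. if e = a then y else Q e * x)"
  have "(\<Sum>e\<in>insert a S. (\<Prod>e'\<in>insert a S - {e}. [:1, -e':] ^ N) * Q' e) =
      T * y + (\<Sum>e\<in>S. (\<Prod>e'\<in>insert a S - {e}. [:1, -e':] ^ N) * Q' e)"
  proof -
    have "insert a S - {a} = S" using insert.hyps by auto
    then show ?thesis using insert.hyps by (simp add: T_def Q'_def del: insert_Diff_single)
  qed
  also have "(\<Sum>e\<in>S. (\<Prod>e'\<in>insert a S - {e}. [:1, -e':] ^ N) * Q' e) =
      (\<Sum>e\<in>S. D * ((\<Prod>e'\<in>S - {e}. [:1, -e':] ^ N) * Q e) * x)"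
  proof (rule sum.cong[OF refl])
    fix e assume e: "e \<in> S"
    then have "e \<noteq> a" using insert.hyps by auto
    then have "insert a S - {e} = insert a (S - {e})" by auto
    moreover have "(\<Prod>e'\<in>insert a (S - {e}). [:1, -e':] ^ N) = D * (\<Prod>e'\<in>S - {e}. [:1, -e':] ^ N)"
      unfolding D_def using insert.hyps by (intro prod.insert) auto
    ultimately show "(\<Prod>e'\<in>insert a S - {e}. [:1, -e':] ^ N) * Q' e =
        D * ((\<Prod>e'\<in>S - {e}. [:1, -e':] ^ N) * Q e) * x"
      using \<open>e \<noteq> a\<close> by (simp add: Q'_def mult.assoc)
  qed
  also have "\<dots> = D * x" using Q by (simp flip: sum_distrib_left sum_distrib_right)
  finally show ?case using xy by (intro exI[of _ Q']) (simp add: algebra_simps)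
qed

lemma fps_mult_coeffs_holomorphic:
  assumes "\<And>n. (\<lambda>z. fps_nth (F z) n) holomorphic_on S" "\<And>n. (\<lambda>z. fps_nth (G z) n) holomorphic_on S"
  shows "(\<lambda>z. fps_nth (F z * G z) n) holomorphic_on S"
  unfolding fps_mult_nth by (intro holomorphic_intros assms)

lemma fps_prod_coeffs_holomorphic:
  assumes "\<And>a n. a \<in> A \<Longrightarrow> (\<lambda>z. fps_nth (F a z) n) holomorphic_on S"
  shows "(\<lambda>z. fps_nth (\<Prod>a\<in>A. F a z) n) holomorphic_on S"
  using assms
proof (induction A arbitrary: n rule: infinite_finite_induct)
  case (insert a A)
  then show ?case
    using fps_mult_coeffs_holomorphic[of "F a" S "\<lambda>z. \<Prod>a\<in>A. F a z" n] by simp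
qed auto

text \<open>Multiplying by a partition of unity made of complementary high powers of the linear factors
  isolates one singularity at a time: the other factors then contribute rapidly decaying
  coefficients.\<close>

lemma singularity_expansion:
  fixes E :: "complex set" and \<mu> :: "complex \<Rightarrow> nat" and h :: "complex \<Rightarrow> nat \<Rightarrow> complex"
    and R C \<theta> M :: real
  assumes E: "finite E" "E \<noteq> {}" "\<And>e. e \<in> E \<Longrightarrow> norm e = 1"
    and M: "\<And>e. e \<in> E \<Longrightarrow> real (\<mu> e) \<le> M"
    and R: "R > 0" and \<theta>: "0 < \<theta>" "\<theta> < 1" and C: "C \<ge> 0"
    and hol: "\<And>j. j \<ge> 1 \<Longrightarrow> (\<lambda>z. h z j) holomorphic_on ball 0 R"
    and h0: "\<And>j. j \<ge> 1 \<Longrightarrow> h 0 j = 0"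
    and h_le: "\<And>z j. norm z \<le> R \<Longrightarrow> j \<ge> 1 \<Longrightarrow> norm (h z j) \<le> C * \<theta> ^ j"
  shows "\<exists>K B. (\<forall>e\<in>E. K e holomorphic_on ball 0 R \<and> K e 0 = 1 \<and> (\<forall>z\<in>ball 0 R. norm (K e z) \<le> B)) \<and>
    (\<forall>z\<in>ball 0 R. \<forall>n\<ge>1.
       norm (exp_coeff (\<lambda>j. h z j - z * (\<Sum>e\<in>E. of_nat (\<mu> e) * e ^ j)) n -
         (\<Sum>e\<in>E. e ^ n * binomial_coeff (of_nat (\<mu> e) * z) n * K e z)) \<le> B * real n powr (M * norm z - 2))"
proof -
  have M0: "M \<ge> 0" using E(2) M by (meson all_not_in_conv of_nat_0_le_iff order.trans)
  \<comment> \<open>Large enough that the exponent \<open>\<mu> e * z + N\<close> has real part at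
    least 4 for all |z| <= R.\<close>
  define N where "N = nat \<lceil>M * R\<rceil> + 4"
  have N: "real N \<ge> M * R + 4" unfolding N_def by simp linarith
  obtain Q where Q: "(\<Sum>e\<in>E. (\<Prod>e'\<in>E - {e}. [:1, -e':] ^ N) * Q e) = 1"
    using sum_complementary_powers_eq_1[OF E(1,2)] by blast
  define P where "P = (\<lambda>e. \<Prod>e'\<in>E - {e}. [:1, -e':] ^ N)"
  \<comment> \<open>In the summand of the partition of unity that belongs to e, every other point
    gains the power N and turns from \<open>L\<close> into \<open>T\<close>; \<open>G e\<close> is
    everything but the singular factor \<open>L e\<close>.\<close>
  define L where "L = (\<lambda>e z. exp_fps (\<lambda>j. - (of_nat (\<mu> e) * z) * e ^ j))"
  define T where "T = (\<lambda>e z. exp_fps (\<lambda>j. - (of_nat (\<mu> e) * z + of_nat N) * e ^ j))"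
  define G where "G = (\<lambda>e z. fps_of_poly (Q e) * (\<Prod>e'\<in>E - {e}. T e' z) * exp_fps (h z))"
  have T_eq: "T e z = L e z * fps_of_poly ([:1, -e:] ^ N)" for e z
  proof -
    have "T e z = exp_fps (\<lambda>j. - (of_nat (\<mu> e) * z) * e ^ j + of_nat N * - (e ^ j))"
      unfolding T_def by (rule arg_cong[of _ _ exp_fps]) (simp add: algebra_simps)
    then show ?thesis
      by (simp only: exp_fps_add exp_fps_of_nat exp_fps_linear L_def fps_of_poly_power)
  qed
  have decomp: "exp_fps (\<lambda>j. h z j - z * (\<Sum>e\<in>E. of_nat (\<mu> e) * e ^ j)) = (\<Sum>e\<in>E. L e z * G e z)" for z
  proof -
    let ?F = "(\<Prod>e\<in>E. L e z) * exp_fps (h z)"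
    have "exp_fps (\<lambda>j. h z j - z * (\<Sum>e\<in>E. of_nat (\<mu> e) * e ^ j)) =
        exp_fps (\<lambda>j. (\<Sum>e\<in>E. - (of_nat (\<mu> e) * z) * e ^ j) + h z j)"
      by (rule arg_cong[of _ _ exp_fps]) (simp add: sum_distrib_left sum_negf algebra_simps)
    also have "\<dots> = ?F" unfolding exp_fps_add exp_fps_sum L_def ..
    also have "\<dots> = ?F * fps_of_poly (\<Sum>e\<in>E. P e * Q e)" using Q by (simp add: P_def)
    also have "\<dots> = (\<Sum>e\<in>E. ?F * fps_of_poly (P e * Q e))"
      by (simp add: fps_of_poly_sum sum_distrib_left)
    also have "\<dots> = (\<Sum>e\<in>E. L e z * G e z)"
    proof (rule sum.cong[OF refl])
      fix e assume e: "e \<in> E"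
      have "(\<Prod>e\<in>E. L e z) = L e z * (\<Prod>e'\<in>E - {e}. L e' z)"
        using E(1) e by (rule prod.remove)
      then show "?F * fps_of_poly (P e * Q e) = L e z * G e z"
        unfolding G_def P_def T_eq by (simp add: fps_of_poly_mult fps_of_poly_prod prod.distrib mult_ac)
    qed
    finally show ?thesis .
  qed
  define Z where "Z = cball (0::complex) R"
  have decay: "\<exists>A. \<forall>z\<in>Z. quartic_decay A (fps_nth (G e z))" if e: "e \<in> E" for e
  proof -
    obtain A1 where A1: "quartic_decay A1 (fps_nth (fps_of_poly (Q e)))"
      using quartic_decay_poly by blast
    have "\<exists>A. \<forall>z\<in>Z. quartic_decay A (fps_nth (T e' z))" if e': "e' \<in> E - {e}" for e'
    proof -
      let ?W = "M * R + real N"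
      have "quartic_decay (1 + 16 * ?W * exp (?W + ?W\<^sup>2)) (fps_nth (T e' z))" if z: "z \<in> Z" for z
      proof -
        let ?w = "of_nat (\<mu> e') * z + of_nat N"
        have *: "norm (of_nat (\<mu> e') * z) \<le> M * R"
          using z e' M M0 by (simp add: norm_mult Z_def mult_mono)
        have "norm ?w \<le> ?W" using norm_triangle_ineq[of "of_nat (\<mu> e') * z" "of_nat N"] * by simp
        moreover have "Re ?w \<ge> 4"
          using abs_Re_le_cmod[of "of_nat (\<mu> e') * z"] * N unfolding plus_complex.sel by simp
        moreover have "norm e' = 1" using E(3) e' by simp
        moreover have "fps_nth (T e' z) = exp_coeff (\<lambda>j. - ?w * e' ^ j)" by (rule ext) (simp add: T_def)
        ultimately show ?thesis using quartic_decay_binomial[of ?w ?W e'] by (simp only:)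
      qed
      then show ?thesis by blast
    qed
    then have "\<exists>A. \<forall>z\<in>Z. quartic_decay A (fps_nth (\<Prod>e'\<in>E - {e}. T e' z))"
      using E(1) by (intro quartic_decay_prod) auto
    then obtain A2 where A2: "\<And>z. z \<in> Z \<Longrightarrow> quartic_decay A2 (fps_nth (\<Prod>e'\<in>E - {e}. T e' z))"
      by blast
    define s where "s = (\<theta> + 1) / 2"
    have s: "\<theta> < s" "0 < s" "s < 1" using \<theta> by (auto simp: s_def)
    obtain D where D: "D \<ge> 0" and D_le: "\<And>l n. (\<forall>j\<ge>1. norm (l j) \<le> C * \<theta> ^ j) \<Longrightarrow> norm (exp_coeff l n :: complex) \<le> D * s ^ n"
      using exp_coeff_geometric_bound[OF C \<theta>(1) s(1)] by blast
    obtain A3 where A3: "\<And>g. \<forall>n. norm (g n) \<le> D * s ^ n \<Longrightarrow> quartic_decay A3 g"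
      using quartic_decay_geometric[OF s(2,3) D] by blast
    have "quartic_decay A3 (fps_nth (exp_fps (h z)))" if "z \<in> Z" for z
      by (rule A3) (use that h_le D_le[of "h z"] in \<open>auto simp: Z_def\<close>)
    then have "\<forall>z\<in>Z. quartic_decay (64 * (64 * A1 * A2) * A3) (fps_nth (G e z))"
      unfolding G_def using A1 A2 by (intro ballI quartic_decay_mult) auto
    then show ?thesis by blast
  qed
  then have "\<forall>e\<in>E. \<exists>A. \<forall>z\<in>Z. quartic_decay A (fps_nth (G e z))" by blast
  from bchoice[OF this] obtain A' where A': "\<And>e z. e \<in> E \<Longrightarrow> z \<in> Z \<Longrightarrow> quartic_decay (A' e) (fps_nth (G e z))"
    by blast
  define A where "A = (\<Sum>e\<in>E. A' e)"
  have zero_Z: "0 \<in> Z" using R by (simp add: Z_def)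
  have A'_nonneg: "A' e \<ge> 0" if "e \<in> E" for e using quartic_decay_nonneg[OF A'[OF that zero_Z]] .
  have A: "quartic_decay A (fps_nth (G e z))" if "e \<in> E" "z \<in> Z" for e z
    unfolding A_def by (rule quartic_decay_mono[OF A'[OF that]], rule member_le_sum) (use that E A'_nonneg in auto)
  have A0: "A \<ge> 0" unfolding A_def using A'_nonneg by (rule sum_nonneg)
  \<comment> \<open>Replacing x by x / e moves the singularity to 1, so \<open>K e z\<close> below
    is the value of \<open>G e z\<close> at 1 / e.\<close>
  define g where "g = (\<lambda>e z j. fps_nth (G e z) j * inverse e ^ j)"
  have g: "quartic_decay A (g e z)" if "e \<in> E" "z \<in> Z" for e z
    using A[OF that] E(3)[OF that(1)] by (simp add: quartic_decay_def g_def norm_mult norm_power norm_inverse)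
  define K where "K = (\<lambda>e z. \<Sum>j. g e z j)"
  have ballZ: "z \<in> Z" if "z \<in> ball 0 R" for z using that by (simp add: Z_def)
  have K_hol: "K e holomorphic_on ball 0 R" if e: "e \<in> E" for e
  proof (rule holomorphic_uniform_sequence)
    have T_hol: "(\<lambda>z. fps_nth (T e' z) n) holomorphic_on ball 0 R" for e' n
      unfolding T_def exp_fps_nth by (intro exp_coeff_holomorphic holomorphic_intros)
    have h_hol: "(\<lambda>z. fps_nth (exp_fps (h z)) n) holomorphic_on ball 0 R" for n
      unfolding exp_fps_nth by (intro exp_coeff_holomorphic hol)
    have "(\<lambda>z. fps_nth (G e z) j) holomorphic_on ball 0 R" for j
      unfolding G_def
      by (intro fps_mult_coeffs_holomorphic fps_prod_coeffs_holomorphic T_hol h_hol) auto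
    then show "(\<lambda>z. \<Sum>j<n. g e z j) holomorphic_on ball 0 R" for n
      unfolding g_def by (intro holomorphic_intros)
    fix x :: complex assume "x \<in> ball 0 R"
    then obtain r where r: "r > 0" "cball x r \<subseteq> ball 0 R"
    using open_contains_cball[of "ball (0::complex) R"] by (meson open_ball)
    have "uniform_limit (cball x r) (\<lambda>n z. \<Sum>j<n. g e z j) (\<lambda>z. \<Sum>j. g e z j) sequentially"
    proof (rule Weierstrass_m_test)
      show "norm (g e z n) \<le> A * (1 / real (Suc n) ^ 2)" if "z \<in> cball x r" for z n
        by (rule quartic_decay_le_square[OF g[OF e ballZ]]) (use that r in auto)
      show "summable (\<lambda>n. A * (1 / real (Suc n) ^ 2))"
        by (intro summable_mult summable_inverse_Suc_square)
    qed
    then show "\<exists>d>0. cball x d \<subseteq> ball 0 R \<and> uniform_limit (cball x d) (\<lambda>n z. \<Sum>j<n. g e z j) (K e) sequentially"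
      using r unfolding K_def by blast
  qed simp
  \<comment> \<open>At z = 0 only \<open>Q e * P e\<close> survives in \<open>G e\<close>. At 1 / e
    the other summands of the partition of unity vanish, as N > 0, so this one alone takes the value
    1.\<close>
  have K_0: "K e 0 = 1" if e: "e \<in> E" for e
  proof -
    have "exp_fps (h 0) = exp_fps (\<lambda>_. 0)"
      by (rule fps_ext) (simp, rule exp_coeff_cong, simp add: h0)
    then have "G e 0 = fps_of_poly (Q e * P e)"
      unfolding G_def T_eq by (simp add: L_def exp_fps_0 P_def fps_of_poly_mult fps_of_poly_prod)
    then have "g e 0 j = coeff (Q e * P e) j * inverse e ^ j" for j by (simp add: g_def)
    then have "K e 0 = (\<Sum>j. coeff (Q e * P e) j * inverse e ^ j)" unfolding K_def by presburger
    also have "\<dots> = (\<Sum>j\<le>degree (Q e * P e). coeff (Q e * P e) j * inverse e ^ j)"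
      by (rule suminf_finite) (auto simp: coeff_eq_0)
    also have "\<dots> = poly (Q e * P e) (inverse e)" by (simp add: poly_altdef)
    also have "\<dots> = (\<Sum>e'\<in>E. poly (Q e' * P e') (inverse e))"
    proof -
      have e0: "e \<noteq> 0" using E(3)[OF e] by auto
      have "poly (Q e' * P e') (inverse e) = 0" if e': "e' \<in> E - {e}" for e'
      proof -
        have "poly (P e') (inverse e) = (\<Prod>e''\<in>E - {e'}. (1 - e'' / e) ^ N)"
          by (simp add: P_def poly_prod poly_power field_simps)
        also have "\<dots> = 0"
          by (rule prod_zero) (use E(1) e e' e0 N_def in \<open>auto intro!: bexI[of _ e]\<close>)
        finally show ?thesis by simp
      qed
      then have "(\<Sum>e'\<in>E. poly (Q e' * P e') (inverse e)) = (\<Sum>e'\<in>{e}. poly (Q e' * P e') (inverse e))"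
        using E(1) e by (intro sum.mono_neutral_right) auto
      then show ?thesis by simp
    qed
    also have "\<dots> = poly (\<Sum>e'\<in>E. P e' * Q e') (inverse e)" by (simp add: poly_sum mult.commute)
    also have "\<dots> = 1" using Q by (simp add: P_def)
    finally show ?thesis .
  qed
  have K_le: "norm (K e z) \<le> 2 * A" if e: "e \<in> E" and z: "z \<in> ball 0 R" for e z
  proof -
    have "norm (K e z) \<le> (\<Sum>j. A * (1 / real (Suc j) ^ 2))" unfolding K_def
      by (rule norm_suminf_le[OF quartic_decay_le_square[OF g[OF e ballZ[OF z]]]])
         (intro summable_mult summable_inverse_Suc_square)
    also have "\<dots> = A * (\<Sum>j. 1 / real (Suc j) ^ 2)" by (rule suminf_mult[OF summable_inverse_Suc_square])
    also have "\<dots> \<le> A * 2" using A0 suminf_inverse_Suc_square_le by (intro mult_left_mono) auto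
    finally show ?thesis by simp
  qed
  define W where "W = M * R"
  define B1 where "B1 = 2 * A * (8 * (1 + (W + 1) * (W * exp (W + W\<^sup>2))))"
  have W: "W \<ge> 0" using M0 R by (simp add: W_def)
  have B1: "B1 \<ge> 0" using A0 W by (simp add: B1_def)
  define B where "B = 2 * A + real (card E) * B1"
  have main: "norm (exp_coeff (\<lambda>j. h z j - z * (\<Sum>e\<in>E. of_nat (\<mu> e) * e ^ j)) n -
     (\<Sum>e\<in>E. e ^ n * binomial_coeff (of_nat (\<mu> e) * z) n * K e z)) \<le> B * real n powr (M * norm z - 2)"
    if z: "z \<in> ball 0 R" and n: "n \<ge> 1" for z n
  proof -
    have "exp_coeff (\<lambda>j. h z j - z * (\<Sum>e\<in>E. of_nat (\<mu> e) * e ^ j)) n = (\<Sum>e\<in>E. fps_nth (L e z * G e z) n)"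
      using arg_cong[OF decomp[of z], of "\<lambda>F. fps_nth F n"] by (simp add: fps_sum_nth)
    also have "\<dots> = (\<Sum>e\<in>E. e ^ n * (\<Sum>j=0..n. g e z j * binomial_coeff (of_nat (\<mu> e) * z) (n - j)))"
    proof (rule sum.cong[OF refl])
      fix e assume e: "e \<in> E"
      have e0: "e \<noteq> 0" using E(3)[OF e] by auto
      have "fps_nth (L e z * G e z) n = (\<Sum>j=0..n. fps_nth (G e z) j * fps_nth (L e z) (n - j))"
        by (subst mult.commute) (rule fps_mult_nth)
      also have "\<dots> = (\<Sum>j=0..n. e ^ n * (g e z j * binomial_coeff (of_nat (\<mu> e) * z) (n - j)))"
      proof (rule sum.cong[OF refl])
        fix j assume "j \<in> {0..n}"
        then have "e ^ n = e ^ j * e ^ (n - j)" by (simp flip: power_add)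
        then show "fps_nth (G e z) j * fps_nth (L e z) (n - j) =
            e ^ n * (g e z j * binomial_coeff (of_nat (\<mu> e) * z) (n - j))"
          using e0 unfolding L_def exp_fps_nth exp_coeff_binomial by (simp add: g_def field_simps)
      qed
      finally show "fps_nth (L e z * G e z) n = e ^ n * (\<Sum>j=0..n. g e z j * binomial_coeff (of_nat (\<mu> e) * z) (n - j))"
        by (simp add: sum_distrib_left)
    qed
    finally have "exp_coeff (\<lambda>j. h z j - z * (\<Sum>e\<in>E. of_nat (\<mu> e) * e ^ j)) n -
      (\<Sum>e\<in>E. e ^ n * binomial_coeff (of_nat (\<mu> e) * z) n * K e z) =
      (\<Sum>e\<in>E. e ^ n * ((\<Sum>j=0..n. g e z j * binomial_coeff (of_nat (\<mu> e) * z) (n - j)) -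
         binomial_coeff (of_nat (\<mu> e) * z) n * K e z))"
      by (simp add: sum_subtractf algebra_simps)
    also have "norm \<dots> \<le> real (card E) * (B1 * real n powr (M * norm z - 2))"
    proof (rule sum_norm_bound)
      fix e assume e: "e \<in> E"
      have "norm (of_nat (\<mu> e) * z) \<le> M * norm z" using M[OF e] by (simp add: norm_mult mult_right_mono)
      moreover have "M * norm z \<le> W" unfolding W_def using z M0 by (intro mult_left_mono) auto
      ultimately have "norm ((\<Sum>j=0..n. g e z j * binomial_coeff (of_nat (\<mu> e) * z) (n - j)) -
         binomial_coeff (of_nat (\<mu> e) * z) n * K e z) \<le> B1 * real n powr (M * norm z - 2)"
        unfolding B1_def K_def by (rule binomial_convolution_estimate[OF n _ _ g[OF e ballZ[OF z]]])
      then show "norm (e ^ n * ((\<Sum>j=0..n. g e z j * binomial_coeff (of_nat (\<mu> e) * z) (n - j)) -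
         binomial_coeff (of_nat (\<mu> e) * z) n * K e z)) \<le> B1 * real n powr (M * norm z - 2)"
        using E(3)[OF e] by (simp add: norm_mult norm_power)
    qed
    also have "\<dots> \<le> B * real n powr (M * norm z - 2)"
      using A0 unfolding B_def by (simp add: distrib_right mult.assoc)
    finally show ?thesis .
  qed
  have "norm (K e z) \<le> B" if "e \<in> E" "z \<in> ball 0 R" for e z
    using K_le[OF that] B1 by (simp add: B_def add_increasing2)
  then show ?thesis using main K_hol K_0 by (intro exI[of _ K] exI[of _ B]) blast
qed

section \<open>Extracting the coefficients in z\<close>

lemma norm_fps_expansion_le:
  assumes f: "f holomorphic_on ball 0 R" and r: "0 < r" "r < R"
    and le: "\<And>z. norm z = r \<Longrightarrow> norm (f z) \<le> B"
  shows "norm (fps_nth (fps_expansion f 0) k) \<le> B / r ^ k"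
proof -
  have "norm ((deriv ^^ k) f 0) \<le> fact k * B / r ^ k"
  proof (rule Cauchy_inequality)
    show "f holomorphic_on ball 0 r" by (rule holomorphic_on_subset[OF f]) (use r in auto)
    show "continuous_on (cball 0 r) f"
      by (rule continuous_on_subset[OF holomorphic_on_imp_continuous_on[OF f]]) (use r in auto)
  qed (use r le in auto)
  then show ?thesis by (simp add: fps_expansion_def norm_divide field_simps)
qed

text \<open>The induction step is e <= (1 + 1/k)^(k+1), from 1 + x <= exp x at x = -1/(k+1). It
  serves to cancel the e^k / k^k that Cauchy's inequality produces.\<close>

lemma fact_le_Stirling: "k \<ge> 1 \<Longrightarrow> fact k * exp (real k) \<le> exp 1 * real k * real k ^ k"
proof (induction k rule: dec_induct)
  case (step k)
  have k: "real k > 0" using step.hyps by simp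
  have "exp 1 * real k ^ Suc k \<le> real (Suc k) ^ Suc k"
  proof -
    define x where "x = - 1 / real (Suc k)"
    have "1 + x \<le> exp x" by (rule exp_ge_add_one_self)
    moreover have x: "1 + x = real k / real (Suc k)" using k by (simp add: x_def field_simps)
    ultimately have "(real k / real (Suc k)) ^ Suc k \<le> exp x ^ Suc k" using k by (intro power_mono) auto
    also have "exp x ^ Suc k = exp (real (Suc k) * x)" by (rule exp_of_nat_mult[symmetric])
    also have "real (Suc k) * x = - 1" by (simp add: x_def del: of_nat_Suc)
    finally show ?thesis unfolding power_divide by (simp add: exp_minus field_simps del: power_Suc of_nat_Suc)
  qed
  then have *: "exp 1 * (real k * real k ^ k) \<le> real (Suc k) ^ Suc k" by simp
  have "fact (Suc k) * exp (real (Suc k)) = real (Suc k) * exp 1 * (fact k * exp (real k))"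
    by (simp add: exp_add algebra_simps)
  also have "\<dots> \<le> real (Suc k) * exp 1 * (exp 1 * real k * real k ^ k)"
    by (intro mult_left_mono step.IH) auto
  also have "\<dots> = real (Suc k) * exp 1 * (exp 1 * (real k * real k ^ k))" by (simp add: mult.assoc)
  also have "\<dots> \<le> real (Suc k) * exp 1 * real (Suc k) ^ Suc k"
    by (intro mult_left_mono *) auto
  finally show ?case by (simp only: mult_ac)
qed simp

text \<open>Coefficient k is the convolution, in degree k - 1, of the coefficients of G with those
  of the exponential. The term i = 0 is the main one; since (k-1)! / (k-1-i)! <= k^i, the i-th is
  relatively at most B (k / (r L))^i, a geometric sequence of ratio at most A / r < 1.\<close>

lemma main_term_coefficient_estimate:
  fixes G :: "complex \<Rightarrow> complex" and m L A r R B :: real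
  assumes G: "G holomorphic_on ball 0 R" and G0: "G 0 = 1"
    and B: "\<And>z. z \<in> ball 0 R \<Longrightarrow> norm (G z) \<le> B"
    and r: "0 < A" "A < r" "r < R" and m: "m \<ge> 1" and L: "L > 0" and k: "k \<ge> 1" "real k \<le> A * L"
  shows "norm (fps_nth (fps_expansion (\<lambda>z. z * exp (- (of_real (m * L) * z)) * G z) 0) k * of_real (fact (k - 1) / L ^ (k - 1))
      - of_real ((- m) ^ (k - 1))) \<le> B / (r - A) * (real k / L) * m ^ (k - 1)"
proof -
  have r0: "r > 0" "R > 0" using r by auto
  define F where "F = fps_expansion G 0"
  have GF: "G has_fps_expansion F" unfolding F_def
    by (rule has_fps_expansion_fps_expansion[OF open_ball _ G]) (use r0 in auto)
  have F0: "fps_nth F 0 = 1" using G0 by (simp add: F_def fps_expansion_def)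
  have B0: "B \<ge> 0" using B[of 0] r0 norm_ge_zero[of "G 0"] by (simp del: norm_ge_zero)
  have F_le: "norm (fps_nth F i) \<le> B / r ^ i" for i
    unfolding F_def by (rule norm_fps_expansion_le[OF G r0(1) r(3)]) (use B r in auto)
  define c where "c = - complex_of_real (m * L)"
  obtain K where K: "k = Suc K" using k by (cases k) auto
  have "(\<lambda>z. z * exp (c * z) * G z) has_fps_expansion fps_X * fps_exp c * F"
    by (intro has_fps_expansion_mult has_fps_expansion_fps_X has_fps_expansion_exp GF)
  then have "fps_expansion (\<lambda>z. z * exp (- (of_real (m * L) * z)) * G z) 0 = fps_X * (F * fps_exp c)"
    by (simp add: fps_expansion_eqI c_def mult_ac)
  then have "fps_nth (fps_expansion (\<lambda>z. z * exp (- (of_real (m * L) * z)) * G z) 0) k = fps_nth (F * fps_exp c) K"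
    by (simp add: K)
  also have "\<dots> = (\<Sum>i=0..K. fps_nth F i * (c ^ (K - i) / fact (K - i)))"
    by (simp add: fps_mult_nth)
  also have "\<dots> = c ^ K / fact K + (\<Sum>i=1..K. fps_nth F i * (c ^ (K - i) / fact (K - i)))"
    by (simp add: sum.atLeast_Suc_atMost F0)
  finally have eq: "fps_nth (fps_expansion (\<lambda>z. z * exp (- (of_real (m * L) * z)) * G z) 0) k =
    c ^ K / fact K + (\<Sum>i=1..K. fps_nth F i * (c ^ (K - i) / fact (K - i)))" .
  have main: "c ^ K / fact K * of_real (fact K / L ^ K) = of_real ((- m) ^ K)"
    using L by (simp add: c_def power_mult_distrib power_minus[of "_ * _"] power_minus[of "complex_of_real m"])
  define x where "x = real k / (r * L)"
  have x: "0 \<le> x" "x \<le> A / r" using k L r r0 by (auto simp: x_def field_simps)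
  have Ar: "A / r < 1" using r r0 by simp
  have x1: "x < 1" using x Ar by linarith
  have "norm ((\<Sum>i=1..K. fps_nth F i * (c ^ (K - i) / fact (K - i))) * of_real (fact K / L ^ K)) \<le>
     (\<Sum>i=1..K. B * m ^ K * x ^ i)"
    unfolding sum_distrib_right
  proof (rule order.trans[OF norm_sum], rule sum_mono)
    fix i assume i: "i \<in> {1..K}"
    have "fact K / fact (K - i) \<le> real k ^ i"
    proof -
      have "fact (K - i) dvd (fact K :: nat)" by (rule fact_dvd) simp
      then have "real (fact K div fact (K - i)) = fact K / fact (K - i)" by (simp add: real_of_nat_div)
      moreover have "real (fact K div fact (K - i)) \<le> real (K ^ i)"
        using fact_div_fact_le_pow[of i K] i by (simp only: of_nat_le_iff) auto
      moreover have "real (K ^ i) \<le> real k ^ i" by (simp add: K power_mono)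
      ultimately show ?thesis by linarith
    qed
    have "norm (fps_nth F i * (c ^ (K - i) / fact (K - i)) * of_real (fact K / L ^ K)) =
       norm (fps_nth F i) * ((m * L) ^ (K - i) / L ^ K) * (fact K / fact (K - i))"
      using m L by (simp add: norm_mult norm_divide norm_power c_def abs_mult)
    also have "(m * L) ^ (K - i) / L ^ K = m ^ (K - i) / L ^ i"
    proof -
      have "L ^ K = L ^ (K - i) * L ^ i" using i by (simp flip: power_add)
      then show ?thesis using L by (simp add: power_mult_distrib)
    qed
    also have "norm (fps_nth F i) * (m ^ (K - i) / L ^ i) * (fact K / fact (K - i)) \<le>
        (B / r ^ i) * (m ^ K / L ^ i) * real k ^ i"
      using F_le[of i] \<open>fact K / fact (K - i) \<le> real k ^ i\<close> m L B0 r0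
      by (intro mult_mono divide_right_mono power_increasing) auto
    also have "\<dots> = B * m ^ K * x ^ i" by (simp add: x_def power_divide power_mult_distrib)
    finally show "norm (fps_nth F i * (c ^ (K - i) / fact (K - i)) * of_real (fact K / L ^ K)) \<le> B * m ^ K * x ^ i" .
  qed
  also have "\<dots> = B * m ^ K * (\<Sum>i=1..K. x ^ i)" by (simp add: sum_distrib_left)
  also have "\<dots> \<le> B * m ^ K * (real k / L / (r - A))"
  proof (rule mult_left_mono)
    have "(\<Sum>i=1..K. x ^ i) = (\<Sum>i<K. x * x ^ i)"
      by (rule sum.reindex_bij_witness[of _ Suc "\<lambda>j. j - 1"]) (auto simp flip: power_Suc)
    also have "\<dots> = x * ((1 - x ^ K) / (1 - x))"
      using x1 by (simp add: sum_gp_strict flip: sum_distrib_left)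
    also have "\<dots> \<le> x * (1 / (1 - A / r))"
      using x x1 Ar by (intro mult_left_mono frac_le) auto
    also have "\<dots> = real k / L / (r - A)" using r r0 L by (simp add: x_def field_simps)
    finally show "(\<Sum>i=1..K. x ^ i) \<le> real k / L / (r - A)" .
  qed (use B0 m in auto)
  finally have "norm ((\<Sum>i=1..K. fps_nth F i * (c ^ (K - i) / fact (K - i))) * of_real (fact K / L ^ K)) \<le>
    B * m ^ K * (real k / L / (r - A))" .
  moreover have "fps_nth (fps_expansion (\<lambda>z. z * exp (- (of_real (m * L) * z)) * G z) 0) k * of_real (fact (k - 1) / L ^ (k - 1))
      - of_real ((- m) ^ (k - 1)) = (\<Sum>i=1..K. fps_nth F i * (c ^ (K - i) / fact (K - i))) * of_real (fact K / L ^ K)"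
    unfolding eq using main by (simp add: K distrib_right del: of_real_divide of_real_power of_real_mult)
  moreover have "B * m ^ K * (real k / L / (r - A)) = B / (r - A) * (real k / L) * m ^ (k - 1)"
    by (simp add: K mult_ac)
  ultimately show ?thesis by (simp only:)
qed

lemma ln_squared_div_bounded: "\<exists>C\<ge>0. \<forall>n::nat. n \<ge> 1 \<longrightarrow> ln (real n) ^ 2 / real n \<le> C"
proof -
  have "(\<lambda>n::nat. ln (real n) ^ 2 / real n) \<longlonglongrightarrow> 0" by real_asymp
  then have "Bseq (\<lambda>n::nat. ln (real n) ^ 2 / real n)" by (rule convergent_imp_Bseq[OF convergentI])
  then obtain K where "K > 0" "\<And>n::nat. norm (ln (real n) ^ 2 / real n) \<le> K" by (auto simp: Bseq_def)
  then show ?thesis by (intro exI[of _ K]) (auto intro: order.trans[OF abs_ge_self] simp: abs_mult)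
qed

text \<open>Cauchy's inequality on the circle of radius \<open>k / (M ln n)\<close>, which balances \<open>r ^ -k\<close> against
  \<open>n powr (M * r)\<close>.\<close>

lemma error_term_coefficient_estimate:
  fixes f :: "complex \<Rightarrow> complex" and M A R B :: real
  assumes f: "f holomorphic_on ball 0 R" and n: "n \<ge> 2"
    and B: "\<And>z. z \<in> ball 0 R \<Longrightarrow> norm (f z) \<le> B * real n powr (M * norm z - 2)"
    and AR: "0 < A" "A < R" and M: "M \<ge> 1" and k: "k \<ge> 1" "real k \<le> A * ln (real n)"
  shows "norm (fps_nth (fps_expansion f 0) k * of_real (real n * fact (k - 1) / ln (real n) ^ (k - 1))) \<le>
    B * exp 1 * M ^ k * (ln (real n) / real n)"
proof -
  define L where "L = ln (real n)"
  have L: "L > 0" using n by (simp add: L_def)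
  define r where "r = real k / (M * L)"
  have r0: "r > 0" using k L M by (simp add: r_def)
  \<comment> \<open>M >= 1 and the range of k place the circle inside the disc where the bound on f
    is available.\<close>
  have "r \<le> real k / L" unfolding r_def using L M k by (intro divide_left_mono) auto
  also have "\<dots> \<le> A" using k L by (simp add: L_def field_simps)
  finally have rR: "r < R" using AR by simp
  have B0: "B \<ge> 0"
  proof -
    have "0 \<le> B * real n powr (M * norm (0::complex) - 2)"
      using B[of 0] AR norm_ge_zero[of "f 0"] by (auto simp del: norm_ge_zero)
    then show ?thesis using n by (simp add: zero_le_mult_iff)
  qed
  have "norm (fps_nth (fps_expansion f 0) k) \<le> (B * real n powr (M * r - 2)) / r ^ k"
    by (rule norm_fps_expansion_le[OF f r0 rR]) (use B rR in auto)
  also have "real n powr (M * r - 2) = exp (real k) / real n ^ 2"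
  proof -
    have "M * r * L = real k" using M L by (simp add: r_def)
    then have "real n powr (M * r) = exp (real k)" using n by (simp add: powr_def L_def)
    then show ?thesis using n by (simp add: powr_diff)
  qed
  also have "(B * (exp (real k) / real n ^ 2)) / r ^ k = B * (M * L) ^ k * (exp (real k) / real k ^ k) / real n ^ 2"
    using k M L by (simp add: r_def power_divide field_simps)
  finally have "norm (fps_nth (fps_expansion f 0) k) * (real n * fact (k - 1) / L ^ (k - 1)) \<le>
     B * (M * L) ^ k * (exp (real k) / real k ^ k) / real n ^ 2 * (real n * fact (k - 1) / L ^ (k - 1))"
    using L by (intro mult_right_mono) auto
  also have "\<dots> = B * M ^ k * (fact (k - 1) * (exp (real k) / real k ^ k)) * (L / real n)"
  proof -
    have "L ^ k = L * L ^ (k - 1)" using k by (cases k) auto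
    then show ?thesis using L n by (simp add: power_mult_distrib power2_eq_square)
  qed
  also have "\<dots> \<le> B * M ^ k * exp 1 * (L / real n)"
  proof (intro mult_right_mono mult_left_mono)
    have "fact k = real k * fact (k - 1)" using k by (cases k) auto
    then have "real k * (fact (k - 1) * exp (real k)) \<le> real k * (exp 1 * real k ^ k)"
      using fact_le_Stirling[OF k(1)] by (simp add: mult_ac)
    then have "fact (k - 1) * exp (real k) \<le> exp 1 * real k ^ k" using k by simp
    then show "fact (k - 1) * (exp (real k) / real k ^ k) \<le> exp 1" using k by (simp add: field_simps)
  qed (use B0 M L n in auto)
  finally have "norm (fps_nth (fps_expansion f 0) k) * (real n * fact (k - 1) / L ^ (k - 1)) \<le>
     B * exp 1 * M ^ k * (L / real n)" by (simp add: mult_ac)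
  then show ?thesis using L unfolding norm_mult norm_of_real by (simp add: L_def abs_mult)
qed

text \<open>Each singularity contributes its own relative error k / ln n, whereas the remainder sees
  only the largest multiplicity M. As M is attained on \<open>E\<close>, its power is covered by the
  sum.\<close>

lemma coefficient_asymptotics:
  fixes E :: "complex set" and \<mu> :: "complex \<Rightarrow> nat" and h :: "complex \<Rightarrow> nat \<Rightarrow> complex"
    and A R C \<theta> :: real and M :: nat
  assumes E: "finite E" "E \<noteq> {}" "\<And>e. e \<in> E \<Longrightarrow> norm e = 1"
    and \<mu>: "\<And>e. e \<in> E \<Longrightarrow> \<mu> e \<le> M" "\<exists>e\<in>E. \<mu> e = M" "M \<ge> 1"
    and AR: "0 < A" "A < R" and \<theta>: "0 < \<theta>" "\<theta> < 1" and C: "C \<ge> 0"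
    and hol: "\<And>j. j \<ge> 1 \<Longrightarrow> (\<lambda>z. h z j) holomorphic_on ball 0 R"
    and h0: "\<And>j. j \<ge> 1 \<Longrightarrow> h 0 j = 0"
    and h_le: "\<And>z j. norm z \<le> R \<Longrightarrow> j \<ge> 1 \<Longrightarrow> norm (h z j) \<le> C * \<theta> ^ j"
  shows "\<exists>C'. \<forall>n k. 1 \<le> k \<and> real k \<le> A * ln (real n) \<longrightarrow>
    norm (fps_nth (fps_expansion (\<lambda>z. exp_coeff (\<lambda>j. h z j - z * (\<Sum>e\<in>E. of_nat (\<mu> e) * e ^ j)) n) 0) k *
        of_real (real n * fact (k - 1) * (- 1) ^ k / ln (real n) ^ (k - 1)) -
      (\<Sum>e\<in>E. of_nat (\<mu> e) ^ k * e ^ n)) \<le> C' * (real k / ln (real n) * (\<Sum>e\<in>E. real (\<mu> e) ^ k))"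
proof -
  have R: "R > 0" using AR by simp
  have \<mu>M: "real (\<mu> e) \<le> real M" if "e \<in> E" for e using \<mu>(1)[OF that] by simp
  obtain K B where K: "\<And>e. e \<in> E \<Longrightarrow> K e holomorphic_on ball 0 R" "\<And>e. e \<in> E \<Longrightarrow> K e 0 = 1"
      "\<And>e z. e \<in> E \<Longrightarrow> z \<in> ball 0 R \<Longrightarrow> norm (K e z) \<le> B"
    and expansion: "\<And>z n. z \<in> ball 0 R \<Longrightarrow> n \<ge> 1 \<Longrightarrow>
       norm (exp_coeff (\<lambda>j. h z j - z * (\<Sum>e\<in>E. of_nat (\<mu> e) * e ^ j)) n -
         (\<Sum>e\<in>E. e ^ n * binomial_coeff (of_nat (\<mu> e) * z) n * K e z)) \<le> B * real n powr (real M * norm z - 2)"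
  proof -
    have "\<exists>K B. (\<forall>e\<in>E. K e holomorphic_on ball 0 R \<and> K e 0 = 1 \<and> (\<forall>z\<in>ball 0 R. norm (K e z) \<le> B)) \<and>
      (\<forall>z\<in>ball 0 R. \<forall>n\<ge>1.
         norm (exp_coeff (\<lambda>j. h z j - z * (\<Sum>e\<in>E. of_nat (\<mu> e) * e ^ j)) n -
           (\<Sum>e\<in>E. e ^ n * binomial_coeff (of_nat (\<mu> e) * z) n * K e z)) \<le> B * real n powr (real M * norm z - 2))"
      by (rule singularity_expansion) (fact E \<mu>M R \<theta> C hol h0 h_le)+
    then show ?thesis using that by blast
  qed
  have B0: "B \<ge> 0" using E(2) K(3)[of _ 0] R norm_ge_zero order.trans by (metis all_not_in_conv centre_in_ball)
  obtain Cl where Cl: "Cl \<ge> 0" "\<And>n::nat. n \<ge> 1 \<Longrightarrow> ln (real n) ^ 2 / real n \<le> Cl"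
    using ln_squared_div_bounded by blast
  define r where "r = (A + R) / 2"
  have r: "A < r" "r < R" using AR by (auto simp: r_def)
  define W where "W = real M * R"
  define B1 where "B1 = exp (W + W\<^sup>2) * B"
  have B1: "B1 \<ge> 0" using B0 by (simp add: B1_def)
  define C' where "C' = B1 / (r - A) + B * exp 1 * Cl"
  show ?thesis
  proof (intro exI[of _ C'] allI impI)
    fix n k :: nat
    assume nk: "1 \<le> k \<and> real k \<le> A * ln (real n)"
    then have k: "k \<ge> 1" "real k \<le> A * ln (real n)" by auto
    define L where "L = ln (real n)"
    have "A * L > 0" using k by (simp add: L_def)
    then have L: "L > 0" using AR by (simp add: zero_less_mult_iff)
    \<comment> \<open>As k >= 1, the range of k forces ln n to be positive, which it is not for n =
      0 and n = 1.\<close>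
    have n: "n \<ge> 2"
    proof (rule ccontr)
      assume "\<not> n \<ge> 2"
      then have "n = 0 \<or> n = 1" by auto
      then show False using L by (auto simp: L_def)
    qed
    define S where "S = (\<lambda>z. exp_coeff (\<lambda>j. h z j - z * (\<Sum>e\<in>E. of_nat (\<mu> e) * e ^ j)) n)"
    define G where "G = (\<lambda>e z. gamma_factor n (of_nat (\<mu> e) * z) * K e z)"
    define X where "X = (\<lambda>e z. z * exp (- (of_real (real (\<mu> e) * L) * z)) * G e z)"
    \<comment> \<open>The factor -w / n of the binomial coefficient at w =
      \<open>\<mu> e * z\<close>, with z left to \<open>X e\<close>.\<close>
    define a where "a = (\<lambda>e. - (e ^ n * of_nat (\<mu> e) / of_nat n))"
    define Err where "Err = (\<lambda>z. S z - (\<Sum>e\<in>E. a e * X e z))"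
    have term_eq: "e ^ n * binomial_coeff (of_nat (\<mu> e) * z) n * K e z = a e * X e z" for e z
      using binomial_coeff_eq_gamma_factor[of n "of_nat (\<mu> e) * z"] n
      by (simp add: a_def X_def G_def L_def mult_ac)
    have G_hol: "G e holomorphic_on ball 0 R" if "e \<in> E" for e
    proof -
      have "gamma_factor n \<circ> (\<lambda>z. of_nat (\<mu> e) * z) holomorphic_on ball 0 R"
        by (rule holomorphic_on_compose_gen[OF _ gamma_factor_holomorphic[of _ UNIV]])
           (auto intro!: holomorphic_intros)
      then show ?thesis unfolding G_def comp_def by (intro holomorphic_intros K(1)[OF that])
    qed
    have X_hol: "X e holomorphic_on ball 0 R" if "e \<in> E" for e
      unfolding X_def by (intro holomorphic_intros G_hol that)
    have S_hol: "S holomorphic_on ball 0 R"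
      unfolding S_def by (intro exp_coeff_holomorphic holomorphic_intros hol)
    have Err_hol: "Err holomorphic_on ball 0 R"
      unfolding Err_def by (intro holomorphic_intros S_hol X_hol)
    define c where "c = (\<lambda>f. fps_nth (fps_expansion f 0) k)"
    have c_S: "c S = (\<Sum>e\<in>E. a e * c (X e)) + c Err"
    proof -
      have zero: "0 \<in> ball (0::complex) R" using R by simp
      have "(\<lambda>z. (\<Sum>e\<in>E. a e * X e z) + Err z) has_fps_expansion
          (\<Sum>e\<in>E. fps_const (a e) * fps_expansion (X e) 0) + fps_expansion Err 0"
        by (intro has_fps_expansion_add has_fps_expansion_sum has_fps_expansion_cmult_left
            has_fps_expansion_fps_expansion[OF open_ball zero] X_hol Err_hol)
      moreover have "(\<lambda>z. (\<Sum>e\<in>E. a e * X e z) + Err z) = S" by (simp add: Err_def fun_eq_iff)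
      ultimately have "fps_expansion S 0 = (\<Sum>e\<in>E. fps_const (a e) * fps_expansion (X e) 0) + fps_expansion Err 0"
        by (simp add: fps_expansion_eqI)
      then show ?thesis by (simp add: c_def fps_sum_nth)
    qed
    define \<kappa> where "\<kappa> = complex_of_real (fact (k - 1) / L ^ (k - 1))"
    define \<nu> where "\<nu> = complex_of_real (real n * fact (k - 1) * (- 1) ^ k / L ^ (k - 1))"
    have \<nu>: "\<nu> = of_nat n * (- 1) ^ k * \<kappa>" by (simp add: \<nu>_def \<kappa>_def mult_ac)
    have main: "norm (a e * c (X e) * \<nu> - of_nat (\<mu> e) ^ k * e ^ n) \<le> B1 / (r - A) * (real k / L) * real (\<mu> e) ^ k"
      if e: "e \<in> E" for e
    proof (cases "\<mu> e = 0")
      \<comment> \<open>The coefficient estimate requires multiplicity at least 1. For multiplicity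
        0 both terms vanish, because k >= 1.\<close>
      case True
      then show ?thesis using k by (simp add: a_def power_0_left)
    next
      case False
      obtain j where j: "k = Suc j" using k by (cases k) auto
      have bound: "norm (c (X e) * \<kappa> - of_real ((- real (\<mu> e)) ^ (k - 1))) \<le> B1 / (r - A) * (real k / L) * real (\<mu> e) ^ (k - 1)"
        unfolding c_def \<kappa>_def X_def
      proof (rule main_term_coefficient_estimate[OF G_hol[OF e]])
        show "G e 0 = 1" using K(2)[OF e] by (simp add: G_def)
        fix z :: complex assume z: "z \<in> ball 0 R"
        have "norm (of_nat (\<mu> e) * z) \<le> W"
          using z \<mu>M[OF e] unfolding W_def by (simp add: norm_mult mult_mono)
        then have "norm (gamma_factor n (of_nat (\<mu> e) * z)) \<le> exp (W + W\<^sup>2)"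
          using n by (intro norm_gamma_factor_le) auto
        then show "norm (G e z) \<le> B1"
          unfolding G_def B1_def norm_mult using K(3)[OF e z] by (intro mult_mono) auto
      qed (use AR r False L k in \<open>auto simp: L_def\<close>)
      \<comment> \<open>The minus sign in \<open>a e\<close> and the (-1)^k of the normalisation
        leave (-1)^(k-1), which cancels the sign of (- \<open>\<mu> e\<close>)^(k-1); the missing
        factor \<open>\<mu> e\<close> comes from \<open>a e\<close>.\<close>
      have eq: "a e * c (X e) * \<nu> - of_nat (\<mu> e) ^ k * e ^ n =
          e ^ n * of_nat (\<mu> e) * (- 1) ^ j * (c (X e) * \<kappa> - of_real ((- real (\<mu> e)) ^ (k - 1)))"
      proof -
        have "(- 1) ^ j * complex_of_real ((- real (\<mu> e)) ^ j) = of_nat (\<mu> e) ^ j"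
          by (simp flip: power_mult_distrib)
        then have "e ^ n * of_nat (\<mu> e) * (- 1) ^ j * of_real ((- real (\<mu> e)) ^ (k - 1)) = of_nat (\<mu> e) ^ k * e ^ n"
          by (simp add: j mult_ac)
        then show ?thesis using n unfolding \<nu> by (auto simp: a_def j right_diff_distrib mult_ac)
      qed
      have "norm (a e * c (X e) * \<nu> - of_nat (\<mu> e) ^ k * e ^ n) =
          real (\<mu> e) * norm (c (X e) * \<kappa> - of_real ((- real (\<mu> e)) ^ (k - 1)))"
        unfolding eq norm_mult norm_power using E(3)[OF e] by simp
      also have "\<dots> \<le> real (\<mu> e) * (B1 / (r - A) * (real k / L) * real (\<mu> e) ^ (k - 1))"
        by (intro mult_left_mono bound) auto
      finally have "norm (a e * c (X e) * \<nu> - of_nat (\<mu> e) ^ k * e ^ n) \<le> \<dots>" .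
      then show ?thesis by (simp add: j mult_ac)
    qed
    have error: "norm (c Err * \<nu>) \<le> B * exp 1 * Cl * (real k / L) * real M ^ k"
    proof -
      \<comment> \<open>Boundedness of (ln n)^2 / n gives ln n / n = O(1 / ln n), and k >= 1
        supplies the factor k.\<close>
      have Ln: "L / real n \<le> Cl * (real k / L)"
      proof -
        have "L / real n = (L ^ 2 / real n) / L" using L by (simp add: power2_eq_square)
        also have "\<dots> \<le> Cl / L" using Cl(2)[of n] n L by (intro divide_right_mono) (auto simp: L_def)
        also have "\<dots> \<le> Cl * (real k / L)" using Cl(1) k L by (simp add: divide_right_mono mult_le_cancel_left1)
        finally show ?thesis .
      qed
      have "norm (c Err * \<nu>) = norm (c Err * of_real (real n * fact (k - 1) / L ^ (k - 1)))"
        unfolding \<nu>_def by (simp add: norm_mult norm_divide norm_power)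
      also have "\<dots> \<le> B * exp 1 * real M ^ k * (L / real n)"
        unfolding c_def L_def
      proof (rule error_term_coefficient_estimate[OF Err_hol n _ AR _ k])
        show "norm (Err z) \<le> B * real n powr (real M * norm z - 2)" if "z \<in> ball 0 R" for z
          using expansion[OF that, of n] n unfolding Err_def S_def term_eq by simp
      qed (use \<mu>(3) in auto)
      also have "\<dots> \<le> B * exp 1 * real M ^ k * (Cl * (real k / L))"
        using B0 by (intro mult_left_mono Ln) auto
      finally show ?thesis by (simp add: mult_ac)
    qed
    have M_le: "real M ^ k \<le> (\<Sum>e\<in>E. real (\<mu> e) ^ k)"
    proof -
      obtain e where "e \<in> E" "\<mu> e = M" using \<mu>(2) by blast
      then show ?thesis using member_le_sum[of e E "\<lambda>e. real (\<mu> e) ^ k"] E(1) by auto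
    qed
    have "norm (c S * \<nu> - (\<Sum>e\<in>E. of_nat (\<mu> e) ^ k * e ^ n)) =
       norm ((\<Sum>e\<in>E. a e * c (X e) * \<nu> - of_nat (\<mu> e) ^ k * e ^ n) + c Err * \<nu>)"
      by (simp add: c_S sum_subtractf distrib_right sum_distrib_right add_diff_eq diff_add_eq)
    also have "\<dots> \<le> (\<Sum>e\<in>E. B1 / (r - A) * (real k / L) * real (\<mu> e) ^ k) + B * exp 1 * Cl * (real k / L) * real M ^ k"
      by (intro norm_triangle_mono error order.trans[OF norm_sum] sum_mono main)
    also have "\<dots> = B1 / (r - A) * (real k / L) * (\<Sum>e\<in>E. real (\<mu> e) ^ k) + B * exp 1 * Cl * (real k / L) * real M ^ k"
      by (simp add: sum_distrib_left)
    also have "\<dots> \<le> B1 / (r - A) * (real k / L) * (\<Sum>e\<in>E. real (\<mu> e) ^ k) +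
        B * exp 1 * Cl * (real k / L) * (\<Sum>e\<in>E. real (\<mu> e) ^ k)"
      using M_le B0 Cl L by (intro add_left_mono mult_left_mono) auto
    also have "\<dots> = C' * (real k / L * (\<Sum>e\<in>E. real (\<mu> e) ^ k))"
      by (simp only: C'_def distrib_right mult.assoc)
    finally show "norm (fps_nth (fps_expansion (\<lambda>z. exp_coeff (\<lambda>j. h z j - z * (\<Sum>e\<in>E. of_nat (\<mu> e) * e ^ j)) n) 0) k *
        of_real (real n * fact (k - 1) * (- 1) ^ k / ln (real n) ^ (k - 1)) -
      (\<Sum>e\<in>E. of_nat (\<mu> e) ^ k * e ^ n)) \<le> C' * (real k / ln (real n) * (\<Sum>e\<in>E. real (\<mu> e) ^ k))"
      by (simp add: c_def S_def \<nu>_def L_def)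
  qed
qed

section \<open>The asymptotic formula\<close>

text \<open>For fixed n the twisted sum is a polynomial in z that sorts the monic polynomials by
  \<open>big_omega\<close>.\<close>

lemma monic_sum_twist_coefficient:
  "fps_nth (fps_expansion (\<lambda>z. c * monic_sum (\<lambda>f. chi f * z ^ big_omega f) n) 0) k =
    c * prime_count k n (chi :: 'a::{field,finite} poly \<Rightarrow> complex)"
proof -
  have "(\<lambda>z. c * (\<Sum>f\<in>monic_polys n. chi f * z ^ big_omega f)) has_fps_expansion
     fps_const c * (\<Sum>f\<in>monic_polys n. fps_const (chi f) * fps_X ^ big_omega f)"
    by (intro has_fps_expansion_cmult_left has_fps_expansion_sum has_fps_expansion_fps_X_power)
  then have "fps_expansion (\<lambda>z. c * monic_sum (\<lambda>f. chi f * z ^ big_omega f) n) 0 =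
     fps_const c * (\<Sum>f\<in>monic_polys n. fps_const (chi f) * fps_X ^ big_omega f)"
    unfolding monic_sum_def by (rule fps_expansion_eqI)
  then have "fps_nth (fps_expansion (\<lambda>z. c * monic_sum (\<lambda>f. chi f * z ^ big_omega f) n) 0) k =
     c * (\<Sum>f\<in>monic_polys n. if big_omega f = k then chi f else 0)"
    by (auto simp: fps_sum_nth fps_X_power_nth intro!: sum.cong)
  also have "(\<Sum>f\<in>monic_polys n. if big_omega f = k then chi f else 0) = prime_count k n chi"
    unfolding prime_count_def by (simp add: sum.If_cases Int_def)
  finally show ?thesis .
qed

lemma mangoldt_sum_twist_holomorphic:
  "(\<lambda>z. mangoldt_sum (\<lambda>f :: 'a::{field,finite} poly. chi f * z ^ big_omega f) j) holomorphic_on S"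
  unfolding mangoldt_sum_twist by (intro holomorphic_intros)

lemma mangoldt_sum_twist_0:
  "mangoldt_sum (\<lambda>f :: 'a::{field,finite} poly. chi f * 0 ^ big_omega f) j = 0"
proof -
  have "j div m \<noteq> 0" if "m \<in> {1..j}" for m using that div_greater_zero_iff[of j m] by simp
  then show ?thesis unfolding mangoldt_sum_twist by (intro sum.neutral) (auto simp: power_0_left)
qed

lemma exp_fps_linear_power: "exp_fps (\<lambda>j. of_nat m * - (c ^ j)) = fps_of_poly ([:1, -c:] ^ m)"
  by (simp only: exp_fps_of_nat exp_fps_linear fps_of_poly_power)

theorem theorem1:
  fixes d :: "'a::{field,finite} poly"
    and chi :: "'a poly \<Rightarrow> complex"
    and \<epsilon> :: real
    and m_plus m_minus d_chi d_chi' :: nat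
    and m :: "nat \<Rightarrow> nat"
    and \<gamma> :: "nat \<Rightarrow> real"
    and \<alpha> \<beta> :: "nat \<Rightarrow> complex"
  assumes "dirichlet_character d chi"
    and "chi \<noteq> principal_character d"
    and "(\<lambda>f. chi f ^ 2) \<noteq> principal_character d"
    and "\<epsilon> > 0"
    and L_factorization:
      "L_series chi = fps_of_poly
         ([:1, - of_real (sqrt (real CARD('a))):] ^ m_plus *
          [:1, of_real (sqrt (real CARD('a))):] ^ m_minus *
          (\<Prod>j=1..d_chi. [:1, - \<alpha> j:] ^ m j) *
          (\<Prod>j=1..d_chi'. [:1, - \<beta> j:]))"
    and "\<forall>j\<in>{1..d_chi}. \<alpha> j = of_real (sqrt (real CARD('a))) * exp (\<i> * of_real (\<gamma> j))"
    and "\<forall>j\<in>{1..d_chi}. \<alpha> j \<notin> \<real>"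
    and "inj_on \<alpha> {1..d_chi}"
    and "\<forall>j\<in>{1..d_chi}. m j \<ge> 1"
    and "\<forall>j\<in>{1..d_chi'}. norm (\<beta> j) = 1"
    and some_zero_on_critical_circle: "m_plus > 0 \<or> m_minus > 0 \<or> d_chi > 0"
  shows "\<exists>C::real. \<forall>n k :: nat.
    1 \<le> k \<and> real k \<le> real CARD('a) powr (1/2 - \<epsilon>) * ln (real n) \<longrightarrow>
      norm (prime_count_normalized k n chi -
            ((\<Sum>j=1..d_chi. of_nat (m j) ^ k * exp (\<i> * of_nat n * of_real (\<gamma> j)))
             + of_nat m_plus ^ k + (-1) ^ n * of_nat m_minus ^ k))
      \<le> C * (real k / ln (real n) *
              ((\<Sum>j=1..d_chi. real (m j) ^ k) + real m_plus ^ k + real m_minus ^ k))"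
proof -
  define q where "q = real CARD('a)"
  have q: "q \<ge> 2" unfolding q_def using card_field_ge_2[where 'a='a] by simp
  define Q where "Q = complex_of_real (sqrt q)"
  have Q0: "Q \<noteq> 0" and normQ: "norm Q = sqrt q" using q by (auto simp: Q_def)
  note chi = assms(1)
  note cm = dirichlet_character_completely_multiplicative[OF chi]
  define J where "J = {1..d_chi}"
  define \<zeta> where "\<zeta> = (\<lambda>j. exp (\<i> * of_real (\<gamma> j)))"
  have \<alpha>: "\<alpha> j = Q * \<zeta> j" if "j \<in> J" for j
    using assms(6) that by (simp add: J_def Q_def q_def \<zeta>_def)
  have inj: "inj_on \<zeta> J"
  proof (rule inj_onI)
    fix i j assume ij: "i \<in> J" "j \<in> J" "\<zeta> i = \<zeta> j"
    then have "\<alpha> i = \<alpha> j" using \<alpha> by simp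
    then show "i = j" using inj_onD[OF assms(8)] ij by (simp add: J_def)
  qed
  have \<zeta>_real: "\<zeta> j \<notin> \<real>" if "j \<in> J" for j
  proof
    assume "\<zeta> j \<in> \<real>"
    then have "\<alpha> j \<in> \<real>" unfolding \<alpha>[OF that] Q_def by (intro Reals_mult Reals_of_real)
    then show False using assms(7) that by (simp add: J_def)
  qed
  have \<zeta>_neq: "\<zeta> j \<noteq> 1" "\<zeta> j \<noteq> - 1" if "j \<in> J" for j
    using \<zeta>_real[OF that] by auto
  \<comment> \<open>1 and -1 are always included, possibly with multiplicity 0, which adds nothing
    as k >= 1. Non-real \<open>\<alpha> j\<close> keep \<open>\<zeta> j\<close> away from both, so
    the multiplicities do not collide.\<close>
  define E where "E = insert 1 (insert (- 1) (\<zeta> ` J))"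
  define \<mu> where "\<mu> = (\<lambda>e. if e = 1 then m_plus else if e = - 1 then m_minus else m (the_inv_into J \<zeta> e))"
  have \<mu>_1: "\<mu> 1 = m_plus" "\<mu> (- 1) = m_minus" by (auto simp: \<mu>_def)
  have \<mu>_\<zeta>: "\<mu> (\<zeta> j) = m j" if "j \<in> J" for j
    using \<zeta>_neq[OF that] by (simp add: \<mu>_def the_inv_into_f_f[OF inj that])
  have finE: "finite E" by (simp add: E_def J_def)
  have sum_E: "(\<Sum>e\<in>E. g e (\<mu> e)) = (\<Sum>j\<in>J. g (\<zeta> j) (m j)) + g 1 m_plus + g (- 1) m_minus"
    for g :: "complex \<Rightarrow> nat \<Rightarrow> 'b::comm_monoid_add"
  proof -
    have fin: "finite (\<zeta> ` J)" by (simp add: J_def)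
    have neg: "(- 1 :: complex) \<notin> \<zeta> ` J" and one: "(1 :: complex) \<notin> insert (- 1) (\<zeta> ` J)"
      using \<zeta>_neq by fastforce+
    have "(\<Sum>e\<in>\<zeta> ` J. g e (\<mu> e)) = (\<Sum>j\<in>J. g (\<zeta> j) (m j))"
      by (simp add: sum.reindex[OF inj] \<mu>_\<zeta>)
    then show ?thesis using fin neg one by (simp add: E_def \<mu>_1 add_ac)
  qed
  define M where "M = Max (\<mu> ` E)"
  have M: "\<mu> e \<le> M" if "e \<in> E" for e using that finE by (simp add: M_def)
  have M_attained: "\<exists>e\<in>E. \<mu> e = M"
    using Max_in[of "\<mu> ` E"] finE by (auto simp: M_def E_def)
  \<comment> \<open>With no zero on the critical circle the bound to be proved would be 0, as k >=
    1, leaving nothing to absorb the remainder.\<close>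
  have M1: "M \<ge> 1"
  proof -
    consider "m_plus \<ge> 1" | "m_minus \<ge> 1" | "1 \<in> J"
      using some_zero_on_critical_circle by (auto simp: J_def)
    then show ?thesis
    proof cases
      case 1
      then show ?thesis using M[of 1] by (simp add: \<mu>_1 E_def)
    next
      case 2
      then show ?thesis using M[of "- 1"] by (simp add: \<mu>_1 E_def)
    next
      case 3
      then have "1 \<le> m 1" using assms(9) by (simp add: J_def)
      then show ?thesis using 3 M[of "\<zeta> 1"] by (simp add: \<mu>_\<zeta> E_def)
    qed
  qed
  have normE: "norm e = 1" if "e \<in> E" for e using that by (auto simp: E_def \<zeta>_def)
  \<comment> \<open>Shrinking \<open>\<epsilon>\<close> only widens the range of k; the cap keeps
    \<open>\<epsilon>' / 2\<close> admissible for the twisted bound. Halving it makes the disc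
    radius R exceed A, the gap needed for the geometric sums.\<close>
  define \<epsilon>' where "\<epsilon>' = min \<epsilon> (1/4)"
  have \<epsilon>': "0 < \<epsilon>'" "\<epsilon>' \<le> \<epsilon>" "\<epsilon>' \<le> 1/4" using assms(4) by (auto simp: \<epsilon>'_def)
  define A where "A = q powr (1/2 - \<epsilon>')"
  define R where "R = q powr (1/2 - \<epsilon>' / 2)"
  have AR: "0 < A" "A < R" using q \<epsilon>' by (auto simp: A_def R_def)
  obtain C s where C: "C \<ge> 0" and s: "1 \<le> s" "s < sqrt q" and twist:
    "\<And>z j. norm z \<le> R \<Longrightarrow> j \<ge> 1 \<Longrightarrow>
      norm (mangoldt_sum (\<lambda>f. chi f * z ^ big_omega f) j - z * mangoldt_sum chi j) \<le> C * s ^ j"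
    using twisted_mangoldt_sum_bound[OF chi assms(3), of "\<epsilon>' / 2"] \<epsilon>' unfolding q_def R_def by auto
  \<comment> \<open>Equal series have equal logarithmic derivatives, here minus power sums of
    reciprocal roots; those of modulus sqrt q are Q e with e in \<open>E\<close>.\<close>
  have mangoldt: "mangoldt_sum chi j = - (Q ^ j * (\<Sum>e\<in>E. of_nat (\<mu> e) * e ^ j) + (\<Sum>i=1..d_chi'. \<beta> i ^ j))"
    if j: "j \<ge> 1" for j
  proof -
    define l where "l = (\<lambda>j. of_nat m_plus * - (Q ^ j) + of_nat m_minus * - ((- Q) ^ j) +
      (\<Sum>i\<in>J. of_nat (m i) * - (\<alpha> i ^ j)) + (\<Sum>i=1..d_chi'. - (\<beta> i ^ j)))"
    have "exp_fps (mangoldt_sum chi) = L_series chi"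
      by (rule fps_ext) (simp add: L_series_def monic_sum_eq_exp_coeff[OF cm, symmetric] monic_sum_def)
    also have "\<dots> = exp_fps l"
      unfolding L_factorization l_def exp_fps_add exp_fps_sum exp_fps_linear_power exp_fps_linear
      by (simp add: fps_of_poly_mult fps_of_poly_prod Q_def q_def J_def)
    finally have "mangoldt_sum chi j = l j" using j by (rule exp_fps_determines)
    also have "\<dots> = - (Q ^ j * (\<Sum>e\<in>E. of_nat (\<mu> e) * e ^ j) + (\<Sum>i=1..d_chi'. \<beta> i ^ j))"
      unfolding l_def sum_E[of "\<lambda>e k. of_nat k * e ^ j"]
      by (simp add: \<alpha> power_mult_distrib power_minus[of Q] sum_distrib_left sum_negf algebra_simps)
    finally show ?thesis .
  qed
  \<comment> \<open>The logarithmic derivative in x = u sqrt q without its singular part. Proper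
    prime powers and the roots \<open>\<beta> i / Q\<close>, of modulus 1 / sqrt q, remain, and both
    are geometrically small.\<close>
  define h where "h = (\<lambda>z j. (1 / Q) ^ j * (mangoldt_sum (\<lambda>f. chi f * z ^ big_omega f) j - z * mangoldt_sum chi j)
      - z * (\<Sum>i=1..d_chi'. (\<beta> i / Q) ^ j))"
  have h_eq: "(1 / Q) ^ j * mangoldt_sum (\<lambda>f. chi f * z ^ big_omega f) j =
      h z j - z * (\<Sum>e\<in>E. of_nat (\<mu> e) * e ^ j)" if "j \<ge> 1" for z j
  proof -
    have QQ: "(1 / Q) ^ j * Q ^ j = 1" using Q0 by (simp flip: power_mult_distrib)
    have "(1 / Q) ^ j * mangoldt_sum chi j = - ((1 / Q) ^ j * Q ^ j * (\<Sum>e\<in>E. of_nat (\<mu> e) * e ^ j) +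
       (1 / Q) ^ j * (\<Sum>i=1..d_chi'. \<beta> i ^ j))"
      unfolding mangoldt[OF that] by (simp only: mult_minus_right distrib_left mult.assoc)
    also have "(1 / Q) ^ j * (\<Sum>i=1..d_chi'. \<beta> i ^ j) = (\<Sum>i=1..d_chi'. (\<beta> i / Q) ^ j)"
      by (simp add: sum_distrib_left power_divide)
    finally have eq: "(1 / Q) ^ j * mangoldt_sum chi j =
      - ((\<Sum>e\<in>E. of_nat (\<mu> e) * e ^ j) + (\<Sum>i=1..d_chi'. (\<beta> i / Q) ^ j))" by (simp only: QQ mult_1)
    have "h z j = (1 / Q) ^ j * mangoldt_sum (\<lambda>f. chi f * z ^ big_omega f) j -
      z * ((1 / Q) ^ j * mangoldt_sum chi j) - z * (\<Sum>i=1..d_chi'. (\<beta> i / Q) ^ j)"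
      by (simp add: h_def algebra_simps)
    then show ?thesis unfolding eq by (simp add: algebra_simps)
  qed
  have scaled: "(1 / Q) ^ n * monic_sum (\<lambda>f. chi f * z ^ big_omega f) n =
      exp_coeff (\<lambda>j. h z j - z * (\<Sum>e\<in>E. of_nat (\<mu> e) * e ^ j)) n" for z n
    unfolding monic_sum_eq_exp_coeff[OF completely_multiplicative_twist[OF cm]] exp_coeff_scale[symmetric]
    by (rule exp_coeff_cong) (rule h_eq)
  define \<theta> where "\<theta> = s / sqrt q"
  have \<theta>: "0 < \<theta>" "\<theta> < 1" using s q by (auto simp: \<theta>_def)
  have h_le: "norm (h z j) \<le> (C + R * real d_chi') * \<theta> ^ j" if z: "norm z \<le> R" and j: "j \<ge> 1" for z j
  proof -
    have "norm (h z j) \<le> norm ((1 / Q) ^ j * (mangoldt_sum (\<lambda>f. chi f * z ^ big_omega f) j - z * mangoldt_sum chi j)) +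
       norm (z * (\<Sum>i=1..d_chi'. (\<beta> i / Q) ^ j))"
      unfolding h_def by (rule norm_triangle_ineq4)
    also have "norm ((1 / Q) ^ j * (mangoldt_sum (\<lambda>f. chi f * z ^ big_omega f) j - z * mangoldt_sum chi j)) \<le>
       (1 / sqrt q) ^ j * (C * s ^ j)"
      unfolding norm_mult using twist[OF z j] q
      by (intro mult_mono) (auto simp: norm_power norm_divide normQ)
    also have "(1 / sqrt q) ^ j * (C * s ^ j) = C * \<theta> ^ j" by (simp add: \<theta>_def power_divide)
    also have "norm (z * (\<Sum>i=1..d_chi'. (\<beta> i / Q) ^ j)) \<le> R * (real (card {1..d_chi'}) * \<theta> ^ j)"
      unfolding norm_mult
    proof (intro mult_mono z sum_norm_bound)
      fix i assume "i \<in> {1..d_chi'}"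
      then have "norm ((\<beta> i / Q) ^ j) = (1 / sqrt q) ^ j"
        using assms(10) by (simp add: norm_power norm_divide normQ)
      also have "\<dots> \<le> \<theta> ^ j" unfolding \<theta>_def using s q by (intro power_mono divide_right_mono) auto
      finally show "norm ((\<beta> i / Q) ^ j) \<le> \<theta> ^ j" .
    qed (use AR in auto)
    finally show ?thesis by (simp add: algebra_simps)
  qed
  have "\<exists>C'. \<forall>n k. 1 \<le> k \<and> real k \<le> A * ln (real n) \<longrightarrow>
    norm (fps_nth (fps_expansion (\<lambda>z. exp_coeff (\<lambda>j. h z j - z * (\<Sum>e\<in>E. of_nat (\<mu> e) * e ^ j)) n) 0) k *
        of_real (real n * fact (k - 1) * (- 1) ^ k / ln (real n) ^ (k - 1)) -
      (\<Sum>e\<in>E. of_nat (\<mu> e) ^ k * e ^ n)) \<le> C' * (real k / ln (real n) * (\<Sum>e\<in>E. real (\<mu> e) ^ k))"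
  proof (rule coefficient_asymptotics)
    show "(\<lambda>z. h z j) holomorphic_on ball 0 R" for j
      unfolding h_def by (intro holomorphic_intros mangoldt_sum_twist_holomorphic)
    show "h 0 j = 0" for j by (simp add: h_def mangoldt_sum_twist_0)
    show "0 \<le> C + R * real d_chi'" using C AR by simp
    show "E \<noteq> {}" by (simp add: E_def)
  qed (fact finE normE M M_attained M1 AR \<theta> h_le)+
  then obtain C' where C': "\<And>n k. 1 \<le> k \<Longrightarrow> real k \<le> A * ln (real n) \<Longrightarrow>
    norm (fps_nth (fps_expansion (\<lambda>z. exp_coeff (\<lambda>j. h z j - z * (\<Sum>e\<in>E. of_nat (\<mu> e) * e ^ j)) n) 0) k *
        of_real (real n * fact (k - 1) * (- 1) ^ k / ln (real n) ^ (k - 1)) -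
      (\<Sum>e\<in>E. of_nat (\<mu> e) ^ k * e ^ n)) \<le> C' * (real k / ln (real n) * (\<Sum>e\<in>E. real (\<mu> e) ^ k))"
    by blast
  show ?thesis
  proof (intro exI[of _ C'] allI impI)
    fix n k :: nat
    assume "1 \<le> k \<and> real k \<le> real CARD('a) powr (1/2 - \<epsilon>) * ln (real n)"
    then have k: "k \<ge> 1" and kle: "real k \<le> q powr (1/2 - \<epsilon>) * ln (real n)" by (auto simp: q_def)
    have "0 < q powr (1/2 - \<epsilon>) * ln (real n)" using k kle by linarith
    then have "ln (real n) > 0" using q by (simp add: zero_less_mult_iff)
    then have "q powr (1/2 - \<epsilon>) * ln (real n) \<le> A * ln (real n)"
      unfolding A_def using q \<epsilon>' by (intro mult_right_mono powr_mono) auto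
    then have kA: "real k \<le> A * ln (real n)" using kle by simp
    have "(\<Sum>e\<in>E. of_nat (\<mu> e) ^ k * e ^ n) = (\<Sum>j=1..d_chi. of_nat (m j) ^ k * exp (\<i> * of_nat n * of_real (\<gamma> j)))
             + of_nat m_plus ^ k + (-1) ^ n * of_nat m_minus ^ k"
    proof -
      have "\<zeta> j ^ n = exp (\<i> * of_nat n * of_real (\<gamma> j))" for j
        unfolding \<zeta>_def by (simp add: mult_ac flip: exp_of_nat_mult)
      then show ?thesis unfolding sum_E[of "\<lambda>e i. of_nat i ^ k * e ^ n"] by (simp add: J_def mult.commute)
    qed
    moreover have "(\<Sum>e\<in>E. real (\<mu> e) ^ k) = (\<Sum>j=1..d_chi. real (m j) ^ k) + real m_plus ^ k + real m_minus ^ k"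
      unfolding sum_E[of "\<lambda>e i. real i ^ k"] by (simp add: J_def)
    moreover have "fps_nth (fps_expansion (\<lambda>z. exp_coeff (\<lambda>j. h z j - z * (\<Sum>e\<in>E. of_nat (\<mu> e) * e ^ j)) n) 0) k *
        of_real (real n * fact (k - 1) * (- 1) ^ k / ln (real n) ^ (k - 1)) = prime_count_normalized k n chi"
    proof -
      have "sqrt q ^ n = q powr (real n / 2)"
        using q by (simp add: powr_half_sqrt[symmetric] powr_realpow[symmetric] powr_powr)
      then have "(1 / Q) ^ n = complex_of_real (1 / q powr (real n / 2))"
        by (simp add: Q_def power_divide flip: of_real_power)
      then show ?thesis
        unfolding scaled[symmetric] monic_sum_twist_coefficient prime_count_normalized_def q_def
        by (simp add: mult_ac)
    qed
    ultimately show "norm (prime_count_normalized k n chi -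
            ((\<Sum>j=1..d_chi. of_nat (m j) ^ k * exp (\<i> * of_nat n * of_real (\<gamma> j)))
             + of_nat m_plus ^ k + (-1) ^ n * of_nat m_minus ^ k))
      \<le> C' * (real k / ln (real n) *
              ((\<Sum>j=1..d_chi. real (m j) ^ k) + real m_plus ^ k + real m_minus ^ k))"
      using C'[OF k kA] by simp
  qed
qed

end
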